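(* Let $T$ be a rooted tree on leaves $0,1,\dots,n$, rooted at the leaf $0$, with all edges directed away from the root and with no vertices of degree two. Let $\mathcal{M}_T$ be the Brownian motion tree model on $T$, let $A_T$ be the integer matrix associated to $T$ defined in the context, and let $I_T=I(A_T)$ be its toric ideal. Then the reciprocal maximum likelihood degree of $\mathcal{M}_T$ and the maximum likelihood degree of the toric model $\mathcal{M}(A_T)$ are both equal to the degree of $$V(I_T)\cap V(\langle A_T\mathbf{p}-A_T\mathbf{u}\rangle)\subset\mathbb{C}^{\binom{n+1}{2}}$$ for a generic choice of $\mathbf{u}\in\mathbb{C}^{\binom{n+1}{2}}$.
   Context: The leaves of $T$ are its degree-one vertices $0,1,\dots,n$ (the root $0$ is itself a leaf); the other vertices are internal. For leaves $i,j$, $\mathrm{lca}(i,j)$ is their most recent common ancestor, with $\mathrm{lca}(i,i)=i$ and $\mathrm{lca}(0,i)=0$. Brownian motion tree model and its reciprocal ML-degree. Let $\mathbb{S}^n$ be the space of symmetric $n\times n$ matrices, with rows and columns indexed by the non-root leaves $1,\dots,n$. Let $$\mathcal{L}_T=\{\Sigma\in\mathbb{S}^n \mid \sigma_{ij}=\sigma_{kl}\text{ whenever }\mathrm{lca}(i,j)=\mathrm{lca}(k,l)\}$$ and $\mathcal{M}_T=\mathcal{L}_T\cap\mathbb{S}^n_{>0}$, where $\mathbb{S}^n_{>0}$ is the set of positive-definite matrices. The reciprocal log-likelihood function is $\ell_S^{\vee}(\Sigma)=\log\det(\Sigma)-\mathrm{trace}(S^{-1}\Sigma)$. The reciprocal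 maximum likelihood degree of $\mathcal{M}_T$ is the number, counted with multiplicity, of non-singular complex critical points of $\ell_S^\vee$ in parameters from the model, for generic symmetric $S$. That is, it is the number of invertible complex $\Sigma$ in the complexification of $\mathcal{L}_T$ with $\mathrm{trace}(\Sigma^{-1}E)=\mathrm{trace}(S^{-1}E)$ for all $E\in\mathcal{L}_T$, counted with multiplicity. The matrix $A_T$. It is the $0/1$ matrix with rows indexed by the non-root vertices $v$ of $T$ and columns indexed by the unordered pairs $\{i,j\}$ of distinct leaves in $\{0,\dots,n\}$, with $A_T(v,\{i,j\})=1$ if $v=i$ or $v=j$ or $v=\mathrm{lca}(i,j)$, and $A_T(v,\{i,j\})=0$ otherwise. The coordinates of $\mathbf{p}=(p_{ij})_{0\le i<j\le n}$ correspond to its columns. Toric models. For an integer $d\times m$ matrix $A$ with columns $\mathbf{a}_1,\dots,\mathbf{a}_m$ and the all-ones vector in its row span, $I(A)$ is the kernel of the map $\mathbb{C}[p_1,\dots,p_m]\to\mathbb{C}[t_1^{\pm},\dots,t_d^{\pm}]$, $p_i\mapsto\mathbf{t}^{\mathbf{a}_i}$. The toric model $\mathcal{M}(A)$ is the discrete statistical model (log-linear model) with design matrix $A$. Its maximum likelihood degree is the number of complex critical points of the log-likelihood function, counted with multiplicity. Equivalently, it is the number of points $\mathbf{p}\in V(I(A))\setminus V\big(p_1\cdots p_m(\sum_{i=1}^m p_i)\big)$ satisfying $A\mathbf{p}=A\mathbf{u}$ for generic $\mathbf{u}\in\mathbb{C}^m$, counted with multiplicity. The degree of the zero-dimensional affine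 scheme $V(I_T)\cap V(\langle A_T\mathbf{p}-A_T\mathbf{u}\rangle)$ is its number of points counted with scheme-theoretic multiplicity. *)

theory Defs
  imports
    "HOL-Library.Poly_Mapping"
    "HOL-Library.FuncSet"
    "HOL-Library.Nat_Bijection"
    "HOL-Computational_Algebra.Fraction_Field"
    "Graph_Theory.Arc_Walk"
    "Jordan_Normal_Form.Gauss_Jordan_Elimination"
begin

section \<open>Rooted trees\<close>

text \<open>
  The arcs point away from the root; uniqueness of the walk from \<open>r\<close> to \<open>r\<close> and to every
  other vertex excludes arcs into \<open>r\<close>, parallel arcs and cycles.
\<close>

definition rooted_tree :: "('v, 'e) pre_digraph \<Rightarrow> 'v \<Rightarrow> bool" where
  "rooted_tree T r \<longleftrightarrow> fin_digraph T \<and> r \<in> verts T \<and>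
     (\<forall>v\<in>verts T. \<exists>!p. pre_digraph.awalk T r p v)"

text \<open>Degrees are those of the underlying undirected tree.\<close>

definition vdeg :: "('v, 'e) pre_digraph \<Rightarrow> 'v \<Rightarrow> nat" where
  "vdeg T v = in_degree T v + out_degree T v"

definition leaf_rooted_tree :: "nat \<Rightarrow> (nat, 'e) pre_digraph \<Rightarrow> bool" where
  "leaf_rooted_tree n T \<longleftrightarrow> rooted_tree T 0 \<and>
     {v \<in> verts T. vdeg T v = 1} = {0..n} \<and>
     (\<forall>v\<in>verts T. vdeg T v \<noteq> 2)"

definition common_ancestor :: "('v, 'e) pre_digraph \<Rightarrow> 'v \<Rightarrow> 'v \<Rightarrow> 'v \<Rightarrow> bool" where
  "common_ancestor T i j v \<longleftrightarrow> v \<rightarrow>\<^sup>*\<^bsub>T\<^esub> i \<and> v \<rightarrow>\<^sup>*\<^bsub>T\<^esub> j"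

definition lca :: "('v, 'e) pre_digraph \<Rightarrow> 'v \<Rightarrow> 'v \<Rightarrow> 'v" where
  "lca T i j = (THE v. common_ancestor T i j v \<and>
     (\<forall>w. common_ancestor T i j w \<longrightarrow> w \<rightarrow>\<^sup>*\<^bsub>T\<^esub> v))"


section \<open>Polynomials and rational functions in finitely many variables\<close>

text \<open>
  The variables are the elements of a set \<open>X\<close> of indices; a point of the affine
  space with coordinates \<open>X\<close> is an element of \<open>X \<rightarrow>\<^sub>E UNIV\<close>.
\<close>

type_synonym 'x mpoly = "('x \<Rightarrow>\<^sub>0 nat) \<Rightarrow>\<^sub>0 complex"
type_synonym 'x ratfun = "'x mpoly fract"
type_synonym 'r laurent = "('r \<Rightarrow>\<^sub>0 int) \<Rightarrow>\<^sub>0 complex"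

definition PConst :: "complex \<Rightarrow> 'x mpoly" where
  "PConst c = Poly_Mapping.single 0 c"

definition PVar :: "'x \<Rightarrow> 'x mpoly" where
  "PVar x = Poly_Mapping.single (Poly_Mapping.single x 1) 1"

definition poly_ring :: "'x set \<Rightarrow> 'x mpoly set" where
  "poly_ring X = {f. \<forall>m\<in>Poly_Mapping.keys f. Poly_Mapping.keys m \<subseteq> X}"

text \<open>The substitution sending each variable \<open>i\<close> to \<open>x i\<close> and applying \<open>h\<close> to the coefficients.\<close>

definition psubst :: "(complex \<Rightarrow> 'b::comm_ring_1) \<Rightarrow> ('x \<Rightarrow> 'b) \<Rightarrow> 'x mpoly \<Rightarrow> 'b" where
  "psubst h x f = (\<Sum>m\<in>Poly_Mapping.keys f. h (Poly_Mapping.lookup f m) *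
     (\<Prod>i\<in>Poly_Mapping.keys m. x i ^ Poly_Mapping.lookup m i))"

definition peval :: "'x mpoly \<Rightarrow> ('x \<Rightarrow> complex) \<Rightarrow> complex" where
  "peval f a = psubst (\<lambda>c. c) a f"

definition zero_set :: "'x set \<Rightarrow> 'x mpoly set \<Rightarrow> ('x \<Rightarrow> complex) set" where
  "zero_set X G = {a \<in> X \<rightarrow>\<^sub>E UNIV. \<forall>g\<in>G. peval g a = 0}"

text \<open>\<open>P\<close> holds on a nonempty Zariski-open subset of the affine space with coordinates \<open>X\<close>.\<close>

definition generic :: "'x set \<Rightarrow> (('x \<Rightarrow> complex) \<Rightarrow> bool) \<Rightarrow> bool" where
  "generic X P \<longleftrightarrow> (\<exists>f\<in>poly_ring X. f \<noteq> 0 \<and>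
     (\<forall>u \<in> X \<rightarrow>\<^sub>E UNIV. peval f u \<noteq> 0 \<longrightarrow> P u))"


section \<open>Multiplicities\<close>

definition of_poly :: "'x::linorder mpoly \<Rightarrow> 'x ratfun" where
  "of_poly f = Fraction_Field.Fract f 1"

definition local_ring :: "'x::linorder set \<Rightarrow> ('x \<Rightarrow> complex) \<Rightarrow> 'x ratfun set" where
  "local_ring X a = {Fraction_Field.Fract f g | f g. f \<in> poly_ring X \<and> g \<in> poly_ring X \<and> peval g a \<noteq> 0}"

definition ideal_gen_in :: "'a::comm_ring_1 set \<Rightarrow> 'a set \<Rightarrow> 'a set" where
  "ideal_gen_in R G = {\<Sum>g\<in>F. r g * g | F r. finite F \<and> F \<subseteq> G \<and> (\<forall>g\<in>F. r g \<in> R)}"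

text \<open>
  \<open>dim\<^sub>\<complex> (V / W) = d\<close>, for complex subspaces \<open>W \<subseteq> V\<close> of the rational functions:
  some \<open>d\<close>-element \<open>B \<subseteq> V\<close> maps bijectively onto a basis of the quotient.
\<close>

definition quotient_has_dim :: "'x::linorder ratfun set \<Rightarrow> 'x ratfun set \<Rightarrow> nat \<Rightarrow> bool" where
  "quotient_has_dim V W d \<longleftrightarrow> (\<exists>B\<subseteq>V. finite B \<and> card B = d \<and>
     (\<forall>v\<in>V. \<exists>!c. c \<in> B \<rightarrow>\<^sub>E UNIV \<and> v - (\<Sum>b\<in>B. of_poly (PConst (c b)) * b) \<in> W))"

text \<open>
  The scheme-theoretic multiplicity at \<open>a\<close> of the scheme cut out near \<open>a\<close> by rational
  functions \<open>G\<close> regular at \<open>a\<close>: the dimension of the local ring of the scheme at \<open>a\<close>.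
\<close>

definition has_mult ::
    "'x::linorder set \<Rightarrow> 'x ratfun set \<Rightarrow> ('x \<Rightarrow> complex) \<Rightarrow> nat \<Rightarrow> bool" where
  "has_mult X G a d \<longleftrightarrow>
     quotient_has_dim (local_ring X a) (ideal_gen_in (local_ring X a) G) d"

text \<open>
  \<open>P\<close> is a finite set of \<open>d\<close> points, each counted with its (finite) multiplicity as a
  point of the scheme cut out by \<open>G\<close>.
\<close>

definition has_count ::
    "'x::linorder set \<Rightarrow> 'x ratfun set \<Rightarrow> ('x \<Rightarrow> complex) set \<Rightarrow> nat \<Rightarrow> bool" where
  "has_count X G P d \<longleftrightarrow> finite P \<and>
     (\<exists>\<mu>. (\<forall>a\<in>P. has_mult X G a (\<mu> a)) \<and> d = (\<Sum>a\<in>P. \<mu> a))"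

text \<open>The degree of the zero-dimensional affine scheme defined by the polynomials \<open>G\<close>.\<close>

definition has_degree :: "'x::linorder set \<Rightarrow> 'x mpoly set \<Rightarrow> nat \<Rightarrow> bool" where
  "has_degree X G d \<longleftrightarrow> has_count X (of_poly ` G) (zero_set X G) d"


section \<open>Toric models\<close>

text \<open>
  A matrix with finite row index set \<open>R\<close> and finite column index set \<open>C\<close> is a function
  \<open>A\<close>; only its values on \<open>R \<times> C\<close> matter.
\<close>

definition toric_monomial :: "'r set \<Rightarrow> ('r \<Rightarrow> 'c \<Rightarrow> int) \<Rightarrow> 'c \<Rightarrow> 'r laurent" where
  "toric_monomial R A c = Poly_Mapping.single (\<Sum>v\<in>R. Poly_Mapping.single v (A v c)) 1"

definition toric_ideal :: "'r set \<Rightarrow> 'c set \<Rightarrow> ('r \<Rightarrow> 'c \<Rightarrow> int) \<Rightarrow> 'c mpoly set" where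
  "toric_ideal R C A =
     {f \<in> poly_ring C. psubst (Poly_Mapping.single 0) (toric_monomial R A) f = 0}"

text \<open>The entries of \<open>A p - A u\<close>, as polynomials in \<open>p\<close>.\<close>

definition linear_forms ::
    "'r set \<Rightarrow> 'c set \<Rightarrow> ('r \<Rightarrow> 'c \<Rightarrow> int) \<Rightarrow> ('c \<Rightarrow> complex) \<Rightarrow> 'c mpoly set" where
  "linear_forms R C A u =
     (\<lambda>v. (\<Sum>c\<in>C. of_int (A v c) * PVar c) - PConst (\<Sum>c\<in>C. of_int (A v c) * u c)) ` R"

definition toric_fibre_equations ::
    "'r set \<Rightarrow> 'c set \<Rightarrow> ('r \<Rightarrow> 'c \<Rightarrow> int) \<Rightarrow> ('c \<Rightarrow> complex) \<Rightarrow> 'c mpoly set" where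
  "toric_fibre_equations R C A u = toric_ideal R C A \<union> linear_forms R C A u"

text \<open>
  The complex critical points of the log-likelihood function with data \<open>u\<close> on the toric
  model, given by the likelihood equations \<open>A p = A u\<close> for log-linear models, in the
  scaling \<open>\<Sum>p = \<Sum>u\<close>.
\<close>

definition toric_critical_points ::
    "'r set \<Rightarrow> 'c set \<Rightarrow> ('r \<Rightarrow> 'c \<Rightarrow> int) \<Rightarrow> ('c \<Rightarrow> complex) \<Rightarrow> ('c \<Rightarrow> complex) set" where
  "toric_critical_points R C A u =
     {p \<in> zero_set C (toric_fibre_equations R C A u).
        (\<forall>c\<in>C. p c \<noteq> 0) \<and> (\<Sum>c\<in>C. p c) \<noteq> 0}"

definition has_ML_degree ::
    "'r set \<Rightarrow> 'c::linorder set \<Rightarrow> ('r \<Rightarrow> 'c \<Rightarrow> int) \<Rightarrow> nat \<Rightarrow> bool" where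
  "has_ML_degree R C A d \<longleftrightarrow> generic C (\<lambda>u.
     has_count C (of_poly ` toric_fibre_equations R C A u) (toric_critical_points R C A u) d)"


section \<open>Pairs of indices\<close>

text \<open>
  The linear order only serves to make the polynomials with these variables an integral
  domain. (It is not put on \<open>nat \<times> nat\<close>, since the library has two incompatible
  order instances for products.)
\<close>

datatype idx = Idx nat nat

instantiation idx :: linorder
begin

fun idx_code :: "idx \<Rightarrow> nat" where
  "idx_code (Idx i j) = prod_encode (i, j)"

definition less_eq_idx :: "idx \<Rightarrow> idx \<Rightarrow> bool" where
  "x \<le> y \<longleftrightarrow> idx_code x \<le> idx_code y"

definition less_idx :: "idx \<Rightarrow> idx \<Rightarrow> bool" where
  "x < y \<longleftrightarrow> idx_code x < idx_code y"

instance
proof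
  fix x y :: idx
  assume "x \<le> y" "y \<le> x"
  then show "x = y"
    by (cases x; cases y) (simp add: less_eq_idx_def)
qed (auto simp: less_eq_idx_def less_idx_def)

end


section \<open>The Brownian motion tree model\<close>

text \<open>Row and column \<open>i\<close> of a matrix, counted from 0, belong to the leaf \<open>Suc i\<close>.\<close>

definition bmt_space :: "nat \<Rightarrow> (nat, 'e) pre_digraph \<Rightarrow> 'a mat set" where
  "bmt_space n T = {\<Sigma> \<in> carrier_mat n n. transpose_mat \<Sigma> = \<Sigma> \<and>
     (\<forall>i<n. \<forall>j<n. \<forall>k<n. \<forall>l<n. lca T (Suc i) (Suc j) = lca T (Suc k) (Suc l) \<longrightarrow>
        \<Sigma> $$ (i, j) = \<Sigma> $$ (k, l))}"

definition mat_trace :: "'a::comm_monoid_add mat \<Rightarrow> 'a" where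
  "mat_trace M = (\<Sum>i<dim_row M. M $$ (i, i))"

definition mat_inv :: "'a::field mat \<Rightarrow> 'a mat" where
  "mat_inv M = the (mat_inverse M)"

text \<open>The matrix whose entries are the coordinates of a point of matrix space.\<close>

definition coord_mat :: "nat \<Rightarrow> (idx \<Rightarrow> 'a) \<Rightarrow> 'a mat" where
  "coord_mat n a = mat n n (\<lambda>(i, j). a (Idx i j))"

definition mat_coords :: "nat \<Rightarrow> idx set" where
  "mat_coords n = {Idx i j | i j. i < n \<and> j < n}"

definition sym_coords :: "nat \<Rightarrow> idx set" where
  "sym_coords n = {Idx i j | i j. i \<le> j \<and> j < n}"

definition sym_mat :: "nat \<Rightarrow> (idx \<Rightarrow> 'a) \<Rightarrow> 'a mat" where
  "sym_mat n s = mat n n (\<lambda>(i, j). s (Idx (min i j) (max i j)))"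

text \<open>
  The critical points of \<open>\<Sigma> \<mapsto> log det \<Sigma> - trace (S\<inverse> \<Sigma>)\<close> on the complexification
  of the model: its derivative in direction \<open>E\<close> is
  \<open>trace (\<Sigma>\<inverse> E) - trace (S\<inverse> E)\<close>.
\<close>

definition rec_critical_points ::
    "nat \<Rightarrow> (nat, 'e) pre_digraph \<Rightarrow> complex mat \<Rightarrow> (idx \<Rightarrow> complex) set" where
  "rec_critical_points n T S = {a \<in> mat_coords n \<rightarrow>\<^sub>E UNIV.
     coord_mat n a \<in> bmt_space n T \<and> invertible_mat (coord_mat n a) \<and>
     (\<forall>E \<in> bmt_space n T.
        mat_trace (mat_inv (coord_mat n a) * map_mat complex_of_real E) =
        mat_trace (mat_inv S * map_mat complex_of_real E))}"

text \<open>
  The equations of the critical points inside the space of all complex matrices, with the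
  generic matrix over the field of rational functions for \<open>\<Sigma>\<close>. The linear
  equations of the model include those of the symmetric matrices, because
  \<open>lca\<close> is symmetric.
\<close>

definition rec_equations ::
    "nat \<Rightarrow> (nat, 'e) pre_digraph \<Rightarrow> complex mat \<Rightarrow> idx ratfun set" where
  "rec_equations n T S =
     {of_poly (PVar (Idx i j) - PVar (Idx k l)) | i j k l.
        i < n \<and> j < n \<and> k < n \<and> l < n \<and> lca T (Suc i) (Suc j) = lca T (Suc k) (Suc l)} \<union>
     {mat_trace (mat_inv (coord_mat n (\<lambda>x. of_poly (PVar x))) *
                 map_mat (\<lambda>r. of_poly (PConst (complex_of_real r))) E) -
      of_poly (PConst (mat_trace (mat_inv S * map_mat complex_of_real E))) | E.
        E \<in> bmt_space n T}"

definition has_rec_ML_degree :: "nat \<Rightarrow> (nat, 'e) pre_digraph \<Rightarrow> nat \<Rightarrow> bool" where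
  "has_rec_ML_degree n T d \<longleftrightarrow> generic (sym_coords n) (\<lambda>s.
     has_count (mat_coords n) (rec_equations n T (sym_mat n s))
       (rec_critical_points n T (sym_mat n s)) d)"


section \<open>The matrix of a tree\<close>

definition tree_rows :: "(nat, 'e) pre_digraph \<Rightarrow> nat set" where
  "tree_rows T = verts T - {0}"

text \<open>The unordered pair of distinct leaves \<open>i < j\<close> is represented by \<open>Idx i j\<close>.\<close>

definition leaf_pairs :: "nat \<Rightarrow> idx set" where
  "leaf_pairs n = {Idx i j | i j. i < j \<and> j \<le> n}"

fun tree_matrix :: "(nat, 'e) pre_digraph \<Rightarrow> nat \<Rightarrow> idx \<Rightarrow> int" where
  "tree_matrix T v (Idx i j) = (if v = i \<or> v = j \<or> v = lca T i j then 1 else 0)"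

end

theory Submission
  imports Defs "Jordan_Normal_Form.Char_Poly"
begin

text \<open>
  The toric variety is parametrized by one parameter \<open>t v\<close> for each non-root vertex \<open>v\<close>, with
  \<open>p\<^sub>0\<^sub>i = t i\<close> and \<open>p\<^sub>i\<^sub>j = t i * t j * t (lca i j)\<close> for non-root leaves \<open>i < j\<close>. Hence it has as
  many parameters as \<open>A\<^sub>T\<close> has rows, and the linear projection \<open>p \<mapsto> A\<^sub>T p\<close> sends it to a space whose
  dimension is the number of parameters. Let \<open>d\<close> be the number of points of a generic fibre of this
  projection. All three numbers are this \<open>d\<close>, and all points are counted once.

  The generic fibre. If the functions \<open>(A\<^sub>T p) v\<close> of \<open>t\<close> satisfy a polynomial relation, the generic
  fibre is empty and \<open>d = 0\<close>. Otherwise, by counting monomials (\<open>algebraic_dependence\<close>), each coordinate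
  \<open>p\<^sub>i\<^sub>j\<close> is algebraic over the polynomials in them. A point of the fibre is an extension of a
  homomorphism to the complex numbers from the ring of these polynomials to the ring generated by
  all \<open>p\<^sub>i\<^sub>j\<close>. Adjoining one algebraic element
  multiplies the number of extensions of a generic homomorphism by the degree of its minimal
  polynomial (\<open>extension_count\<close>), because irreducible polynomials are separable in characteristic 0,
  so \<open>d\<close> is a product of degrees (\<open>extension_points_count\<close>). The same argument shows that a function that
  is not zero on the variety vanishes at no point of the generic fibre. Therefore all coordinates, their
  sum, and the determinant used below are nonzero there. Separability also gives multiplicity one:
  modulo the equations of the fibre, each coordinate satisfies an equation in one variable with a simple
  root at the point, so that the equations generate the maximal ideal of the local ring
  (\<open>fibre_certificate\<close>, \<open>has_mult_1\<close>, collected in \<open>generic_fibre\<close>).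
  This proves the two statements about the toric model.

  The Brownian motion tree model. For an invertible \<open>\<Sigma>\<close> in the model, with inverse \<open>K\<close>, put
  \<open>p\<^sub>i\<^sub>j = - K\<^sub>i\<^sub>j\<close> and let \<open>p\<^sub>0\<^sub>i\<close> be the sum of row \<open>i\<close> of \<open>K\<close>. Then \<open>p\<close> lies on the toric variety
  (\<open>I_vanishes\<close>), and the points of the variety with nonzero coordinates and invertible \<open>K\<close> come from the
  model (\<open>inverse_in_space\<close>). Both facts rest on one lemma, \<open>inverse_binomial\<close>: if \<open>q\<close> is the vector of row
  sums of \<open>K\<close>, then \<open>K\<^sub>i\<^sub>j / (q\<^sub>i q\<^sub>j)\<close> depends for \<open>i \<noteq> j\<close> only on the lowest common ancestor of \<open>i\<close> and \<open>j\<close>.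
  In the coordinates \<open>p\<close> the likelihood equations say \<open>A\<^sub>T p = A\<^sub>T u\<close>, where \<open>u\<close> belongs to the inverse
  of the data matrix (\<open>tr_row_sums\<close>). So the critical points correspond to the
  points of the fibre (\<open>crit_bij\<close>), and the equations that show multiplicity one on the toric side can be
  pulled back along matrix inversion (\<open>rec_mult\<close>).
\<close>

section \<open>Substitution into polynomials\<close>

definition mono_val :: "('x \<Rightarrow> 'b::comm_ring_1) \<Rightarrow> ('x \<Rightarrow>\<^sub>0 nat) \<Rightarrow> 'b" where
  "mono_val x m = (\<Prod>i\<in>Poly_Mapping.keys m. x i ^ Poly_Mapping.lookup m i)"

lemma mono_val_superset:
  assumes "finite A" "Poly_Mapping.keys m \<subseteq> A"
  shows "mono_val x m = (\<Prod>i\<in>A. x i ^ Poly_Mapping.lookup m i)"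
  unfolding mono_val_def
  by (rule prod.mono_neutral_left) (use assms in \<open>auto simp: in_keys_iff\<close>)

lemma mono_val_0 [simp]: "mono_val x 0 = 1"
  by (simp add: mono_val_def)

lemma mono_val_add: "mono_val x (m + m') = mono_val x m * mono_val x m'"
proof -
  let ?A = "Poly_Mapping.keys m \<union> Poly_Mapping.keys m'"
  have fin: "finite ?A" by simp
  have "mono_val x (m + m') = (\<Prod>i\<in>?A. x i ^ Poly_Mapping.lookup (m + m') i)"
    by (rule mono_val_superset[OF fin keys_add])
  also have "\<dots> = (\<Prod>i\<in>?A. x i ^ Poly_Mapping.lookup m i) * (\<Prod>i\<in>?A. x i ^ Poly_Mapping.lookup m' i)"
    by (simp add: lookup_add power_add prod.distrib)
  also have "\<dots> = mono_val x m * mono_val x m'"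
    using mono_val_superset[of ?A m x] mono_val_superset[of ?A m' x] by simp
  finally show ?thesis .
qed

lemma mono_val_single [simp]: "mono_val x (Poly_Mapping.single i k) = x i ^ k"
  by (cases "k = 0") (auto simp: mono_val_def)

lemma psubst_alt: "psubst h x f = (\<Sum>m\<in>Poly_Mapping.keys f. h (Poly_Mapping.lookup f m) * mono_val x m)"
  by (simp add: psubst_def mono_val_def)

lemma sum_single_lookup:
  fixes f :: "'a \<Rightarrow>\<^sub>0 'b::comm_monoid_add"
  shows "(\<Sum>m\<in>Poly_Mapping.keys f. Poly_Mapping.single m (Poly_Mapping.lookup f m)) = f"
proof (rule poly_mapping_eqI)
  fix k
  have "(\<Sum>m\<in>Poly_Mapping.keys f. Poly_Mapping.lookup (Poly_Mapping.single m (Poly_Mapping.lookup f m)) k)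
     = (\<Sum>m\<in>Poly_Mapping.keys f. if m = k then Poly_Mapping.lookup f k else 0)"
    by (intro sum.cong) (auto simp: lookup_single when_def)
  also have "\<dots> = Poly_Mapping.lookup f k"
    by (auto simp: in_keys_iff)
  finally show "Poly_Mapping.lookup (\<Sum>m\<in>Poly_Mapping.keys f. Poly_Mapping.single m (Poly_Mapping.lookup f m)) k
     = Poly_Mapping.lookup f k" by (simp add: lookup_sum)
qed

lemma psubst_superset:
  assumes "h 0 = 0" "finite M" "Poly_Mapping.keys f \<subseteq> M"
  shows "psubst h x f = (\<Sum>m\<in>M. h (Poly_Mapping.lookup f m) * mono_val x m)"
  unfolding psubst_alt
  by (rule sum.mono_neutral_left) (use assms in \<open>auto simp: in_keys_iff\<close>)

lemma (in comm_ring_hom) hom_psubst: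
  "hom (psubst h x f) = psubst (\<lambda>c. hom (h c)) (\<lambda>i. hom (x i)) f"
  by (simp add: psubst_def hom_distribs hom_sum hom_prod)

lemma psubst_single:
  assumes "h 0 = 0"
  shows "psubst h x (Poly_Mapping.single m c) = h c * mono_val x m"
  using assms by (cases "c = 0") (auto simp: psubst_alt)

lemma psubst_hom:
  assumes "comm_ring_hom h"
  shows "comm_ring_hom (psubst h x)"
proof -
  interpret h: comm_ring_hom h by fact
  have add: "psubst h x (f + g) = psubst h x f + psubst h x g" for f g
  proof -
    let ?M = "Poly_Mapping.keys f \<union> Poly_Mapping.keys g"
    have "psubst h x (f + g) = (\<Sum>m\<in>?M. h (Poly_Mapping.lookup (f + g) m) * mono_val x m)"
      by (intro psubst_superset h.hom_zero keys_add) simp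
    also have "\<dots> = (\<Sum>m\<in>?M. h (Poly_Mapping.lookup f m) * mono_val x m)
         + (\<Sum>m\<in>?M. h (Poly_Mapping.lookup g m) * mono_val x m)"
      by (simp add: lookup_add h.hom_add distrib_right sum.distrib)
    also have "\<dots> = psubst h x f + psubst h x g"
      by (subst (1 2) psubst_superset[where M = ?M]) auto
    finally show ?thesis .
  qed
  have zero: "psubst h x 0 = 0" by (simp add: psubst_def)
  have sums: "psubst h x (sum F A) = (\<Sum>a\<in>A. psubst h x (F a))" for F and A :: "'k set"
    by (induction A rule: infinite_finite_induct) (auto simp: zero add)
  have mult: "psubst h x (f * g) = psubst h x f * psubst h x g" for f g
  proof -
    have "f * g = (\<Sum>m\<in>Poly_Mapping.keys f. Poly_Mapping.single m (Poly_Mapping.lookup f m)) *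
        (\<Sum>k\<in>Poly_Mapping.keys g. Poly_Mapping.single k (Poly_Mapping.lookup g k))"
      by (simp add: sum_single_lookup)
    also have "\<dots> = (\<Sum>m\<in>Poly_Mapping.keys f. \<Sum>k\<in>Poly_Mapping.keys g.
        Poly_Mapping.single (m + k) (Poly_Mapping.lookup f m * Poly_Mapping.lookup g k))"
      by (simp add: sum_product mult_single)
    finally have "psubst h x (f * g) = (\<Sum>m\<in>Poly_Mapping.keys f. \<Sum>k\<in>Poly_Mapping.keys g.
        h (Poly_Mapping.lookup f m * Poly_Mapping.lookup g k) * mono_val x (m + k))"
      by (simp add: sums psubst_single)
    also have "\<dots> = psubst h x f * psubst h x g"
      by (simp add: psubst_alt sum_product h.hom_mult mono_val_add mult_ac)
    finally show ?thesis .
  qed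
  show ?thesis
    by unfold_locales (auto simp: add mult zero psubst_single[of h x 0 1, simplified])
qed

lemma comm_ring_hom_ident: "comm_ring_hom (\<lambda>c::'a::comm_ring_1. c)"
  by unfold_locales auto

lemma comm_ring_hom_PConst: "comm_ring_hom PConst"
  by unfold_locales (auto simp: PConst_def single_add mult_single)

interpretation PConst: comm_ring_hom PConst by (rule comm_ring_hom_PConst)

interpretation peval: comm_ring_hom "\<lambda>f. peval f a" for a
  unfolding peval_def by (rule psubst_hom[OF comm_ring_hom_ident])

lemma psubst_PConst: "h 0 = 0 \<Longrightarrow> psubst h x (PConst c) = h c"
  by (simp add: PConst_def psubst_single)

lemma psubst_PVar:
  assumes "comm_ring_hom h" shows "psubst h x (PVar i) = x i"
proof -
  interpret h: comm_ring_hom h by fact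
  show ?thesis by (simp add: PVar_def psubst_single)
qed

lemma peval_PConst [simp]: "peval (PConst c) a = c"
  by (simp add: peval_def psubst_PConst)

lemma peval_PVar [simp]: "peval (PVar i) a = a i"
  by (simp add: peval_def psubst_PVar comm_ring_hom_ident)

lemma mono_val_PVar: "mono_val PVar m = Poly_Mapping.single m (1::complex)"
proof -
  have *: "PVar i ^ k = Poly_Mapping.single (Poly_Mapping.single i k) (1::complex)" for i :: 'a and k
    by (induction k) (auto simp: PVar_def mult_single single_add[symmetric])
  have **: "(\<Prod>i\<in>A. Poly_Mapping.single (g i) (1::complex)) = Poly_Mapping.single (\<Sum>i\<in>A. g i) 1"
    if "finite A" for A and g :: "'a \<Rightarrow> 'a \<Rightarrow>\<^sub>0 nat"
    using that by (induction A) (auto simp: mult_single)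
  show ?thesis
    by (simp add: mono_val_def * ** sum_single_lookup)
qed

lemma psubst_ident: "psubst PConst PVar f = f"
  by (simp add: psubst_alt mono_val_PVar PConst_def mult_single sum_single_lookup)

lemma psubst_psubst:
  assumes "comm_ring_hom h"
  shows "psubst h y (psubst PConst q f) = psubst h (\<lambda>i. psubst h y (q i)) f"
proof -
  interpret h: comm_ring_hom h by fact
  interpret H: comm_ring_hom "psubst h y" by (rule psubst_hom[OF assms])
  show ?thesis by (simp add: H.hom_psubst psubst_PConst)
qed

lemma peval_psubst: "peval (psubst PConst q f) a = peval f (\<lambda>i. peval (q i) a)"
  unfolding peval_def by (rule psubst_psubst[OF comm_ring_hom_ident])

lemma psubst_cong:
  assumes "f \<in> poly_ring X" "\<And>i. i \<in> X \<Longrightarrow> x i = y i"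
  shows "psubst h x f = psubst h y f"
  unfolding psubst_def
  by (intro sum.cong prod.cong refl arg_cong2[where f = times] arg_cong2[where f = power] assms(2))
     (use assms(1) in \<open>auto simp: poly_ring_def\<close>)

lemma peval_cong:
  assumes "f \<in> poly_ring X" "\<And>i. i \<in> X \<Longrightarrow> x i = y i"
  shows "peval f x = peval f y"
  unfolding peval_def using assms by (rule psubst_cong)

section \<open>Polynomials in a set of variables\<close>

lemma poly_ring_PConst [simp]: "PConst c \<in> poly_ring X"
  by (auto simp: poly_ring_def PConst_def)

lemma poly_ring_PVar [simp]: "PVar x \<in> poly_ring X \<longleftrightarrow> x \<in> X"
  by (auto simp: poly_ring_def PVar_def)

lemma poly_ring_0 [simp]: "0 \<in> poly_ring X"
  by (auto simp: poly_ring_def)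

lemma poly_ring_1 [simp]: "1 \<in> poly_ring X"
  using poly_ring_PConst[of 1 X] by simp

lemma poly_ring_add: "f \<in> poly_ring X \<Longrightarrow> g \<in> poly_ring X \<Longrightarrow> f + g \<in> poly_ring X"
  using keys_add[of f g] unfolding poly_ring_def by blast

lemma poly_ring_uminus: "f \<in> poly_ring X \<Longrightarrow> - f \<in> poly_ring X"
  unfolding poly_ring_def by (auto simp: in_keys_iff)

lemma poly_ring_diff: "f \<in> poly_ring X \<Longrightarrow> g \<in> poly_ring X \<Longrightarrow> f - g \<in> poly_ring X"
  using poly_ring_add[of f X "- g"] poly_ring_uminus[of g X] by simp

lemma poly_ring_mult:
  assumes "f \<in> poly_ring X" "g \<in> poly_ring X"
  shows "f * g \<in> poly_ring X"
  unfolding poly_ring_def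
proof (clarify)
  fix m x assume "m \<in> Poly_Mapping.keys (f * g)" and x: "x \<in> Poly_Mapping.keys m"
  then obtain k l where "k \<in> Poly_Mapping.keys f" "l \<in> Poly_Mapping.keys g" "m = k + l"
    using keys_mult[of f g] by blast
  moreover from this x have "x \<in> Poly_Mapping.keys k \<union> Poly_Mapping.keys l"
    using keys_add[of k l] by blast
  ultimately show "x \<in> X" using assms unfolding poly_ring_def by blast
qed

lemma poly_ring_sum: "(\<And>i. i \<in> A \<Longrightarrow> F i \<in> poly_ring X) \<Longrightarrow> sum F A \<in> poly_ring X"
  by (induction A rule: infinite_finite_induct) (auto intro: poly_ring_add)

lemma poly_ring_prod: "(\<And>i. i \<in> A \<Longrightarrow> F i \<in> poly_ring X) \<Longrightarrow> prod F A \<in> poly_ring X"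
  by (induction A rule: infinite_finite_induct) (auto intro: poly_ring_mult)

lemma poly_ring_power: "f \<in> poly_ring X \<Longrightarrow> f ^ k \<in> poly_ring X"
  by (induction k) (auto intro: poly_ring_mult)

lemma poly_ring_of_int [simp]: "of_int k \<in> poly_ring X"
proof -
  have "of_int k = (PConst (of_int k) :: 'a mpoly)"
    by (simp add: PConst_def)
  then show ?thesis by simp
qed

lemmas poly_ring_closed = poly_ring_add poly_ring_uminus poly_ring_diff poly_ring_mult
  poly_ring_sum poly_ring_prod poly_ring_power

lemma poly_ring_psubst:
  assumes "f \<in> poly_ring X" "\<And>i. i \<in> X \<Longrightarrow> q i \<in> poly_ring Y"
  shows "psubst PConst q f \<in> poly_ring Y"
  unfolding psubst_def
  by (intro poly_ring_closed poly_ring_PConst assms(2)) (use assms(1) in \<open>auto simp: poly_ring_def\<close>)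

lemma poly_ring_induct [consumes 1, case_names const var add mult]:
  assumes f: "f \<in> poly_ring X"
    and const: "\<And>c. P (PConst c)"
    and var: "\<And>x. x \<in> X \<Longrightarrow> P (PVar x)"
    and add: "\<And>f g. f \<in> poly_ring X \<Longrightarrow> g \<in> poly_ring X \<Longrightarrow> P f \<Longrightarrow> P g \<Longrightarrow> P (f + g)"
    and mult: "\<And>f g. f \<in> poly_ring X \<Longrightarrow> g \<in> poly_ring X \<Longrightarrow> P f \<Longrightarrow> P g \<Longrightarrow> P (f * g)"
  shows "P f"
proof -
  let ?Q = "\<lambda>f. f \<in> poly_ring X \<and> P f"
  have Q0: "?Q 0" and Q1: "?Q 1" using const[of 0] const[of 1] by auto
  have Qm: "?Q (f * g)" if "?Q f" "?Q g" for f g using that mult poly_ring_mult by blast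
  have Qa: "?Q (f + g)" if "?Q f" "?Q g" for f g using that add poly_ring_add by blast
  have pow: "?Q (PVar x ^ k)" if "x \<in> X" for x k
  proof (induction k)
    case 0 then show ?case using Q1 by simp
  next
    case (Suc k) then show ?case using Qm[of "PVar x" "PVar x ^ k"] var that by simp
  qed
  have prods: "?Q (prod F A)" if "\<And>a. a \<in> A \<Longrightarrow> ?Q (F a)" for F and A :: "'a set"
    using that
  proof (induction A rule: infinite_finite_induct)
    case (insert x A)
    have "?Q (F x)" "?Q (prod F A)" using insert by blast+
    from Qm[OF this] show ?case using insert by simp
  qed (use Q1 in auto)
  have sums: "?Q (sum F A)" if "\<And>a. a \<in> A \<Longrightarrow> ?Q (F a)" for F and A :: "('a \<Rightarrow>\<^sub>0 nat) set"
    using that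
  proof (induction A rule: infinite_finite_induct)
    case (insert x A)
    have "?Q (F x)" "?Q (sum F A)" using insert by blast+
    from Qa[OF this] show ?case using insert by simp
  qed (use Q0 in auto)
  have "?Q (psubst PConst PVar f)"
    unfolding psubst_def
  proof (rule sums)
    fix m assume m: "m \<in> Poly_Mapping.keys f"
    have "?Q (\<Prod>i\<in>Poly_Mapping.keys m. PVar i ^ Poly_Mapping.lookup m i)"
      by (rule prods, rule pow) (use f m in \<open>auto simp: poly_ring_def\<close>)
    then show "?Q (PConst (Poly_Mapping.lookup f m) * (\<Prod>i\<in>Poly_Mapping.keys m. PVar i ^ Poly_Mapping.lookup m i))"
      using Qm const poly_ring_PConst by blast
  qed
  then show ?thesis by (simp add: psubst_ident)
qed

lemma finite_vars: "\<exists>Y. finite Y \<and> Y \<subseteq> X \<and> f \<in> poly_ring Y" if "f \<in> poly_ring X"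
proof (intro exI conjI)
  let ?Y = "\<Union>m\<in>Poly_Mapping.keys f. Poly_Mapping.keys m"
  show "finite ?Y" by auto
  show "?Y \<subseteq> X" "f \<in> poly_ring ?Y" using that by (auto simp: poly_ring_def)
qed

lemma digits_less:
  assumes "\<And>i. i < k \<Longrightarrow> m i < (N::nat)"
  shows "(\<Sum>i<k. m i * N ^ i) < N ^ k"
  using assms
proof (induction k)
  case (Suc k)
  have "(\<Sum>i<k. m i * N ^ i) < N ^ k" using Suc by auto
  moreover have "Suc (m k) * N ^ k \<le> N * N ^ k" using Suc.prems[of k] by (intro mult_right_mono) auto
  ultimately show ?case by simp
qed simp

text \<open>
  This keeps apart the images of the monomials under the Kronecker substitution.
\<close>
lemma digits_unique:
  assumes "\<forall>i<k. m i < (N::nat)" "\<forall>i<k. m' i < N"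
    and "(\<Sum>i<k. m i * N ^ i) = (\<Sum>i<k. m' i * N ^ i)"
  shows "\<forall>i<k. m i = m' i"
  using assms
proof (induction k)
  case 0
  show ?case by blast
next
  case (Suc k)
  have l: "(\<Sum>i<k. m i * N ^ i) < N ^ k" "(\<Sum>i<k. m' i * N ^ i) < N ^ k"
    using Suc.prems by (auto intro: digits_less)
  then have nz: "N ^ k \<noteq> 0" by linarith
  have div: "(a + b * N ^ k) div N ^ k = b" if "a < N ^ k" for a b
    using that nz by (metis add.right_neutral add.commute div_less div_mult_self1)
  have eq: "(\<Sum>i<k. m i * N ^ i) + m k * N ^ k = (\<Sum>i<k. m' i * N ^ i) + m' k * N ^ k"
    using Suc.prems(3) by (simp only: sum.lessThan_Suc)
  have "m k = m' k"
    using div[OF l(1), of "m k"] unfolding eq div[OF l(2), of "m' k"] by (rule sym)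
  moreover from this have "(\<Sum>i<k. m i * N ^ i) = (\<Sum>i<k. m' i * N ^ i)"
    using Suc.prems(3) by (simp only: sum.lessThan_Suc)
  then have "\<forall>i<k. m i = m' i"
    using Suc.IH Suc.prems(1,2) less_Suc_eq by blast
  ultimately show ?case by (metis less_Suc_eq)
qed

text \<open>
  Kronecker substitution: sending the \<open>i\<close>-th variable to \<open>w ^ N ^ i\<close> with \<open>N\<close> larger than all
  exponents keeps the monomials apart, so a nonzero polynomial stays nonzero in one variable.
\<close>
lemma nonzero_poly_nonvanishing:
  assumes f: "f \<in> poly_ring X" "f \<noteq> 0"
  shows "\<exists>a \<in> X \<rightarrow>\<^sub>E UNIV. peval f a \<noteq> 0"
proof -
  obtain Y where Y: "finite Y" "Y \<subseteq> X" "f \<in> poly_ring Y" using finite_vars[OF f(1)] by blast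
  obtain e where e: "bij_betw e {..<card Y} Y"
    using ex_bij_betw_nat_finite[OF Y(1)] by (auto simp: atLeast0LessThan)
  let ?k = "card Y"
  define ix where "ix = inv_into {..<?k} e"
  have ix: "i < ?k \<Longrightarrow> ix (e i) = i" for i
    using e by (simp add: ix_def bij_betw_def inv_into_f_f)
  obtain N where N: "\<And>m i. m \<in> Poly_Mapping.keys f \<Longrightarrow> Poly_Mapping.lookup m i < N"
  proof -
    let ?S = "\<Union>m\<in>Poly_Mapping.keys f. Poly_Mapping.range m"
    have "finite ?S" by auto
    have "Poly_Mapping.lookup m i < Suc (Max (insert 0 ?S))" if m: "m \<in> Poly_Mapping.keys f" for m i
    proof (cases "i \<in> Poly_Mapping.keys m")
      case True
      then have "Poly_Mapping.lookup m i \<in> ?S"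
        by (intro UN_I[OF m] in_keys_lookup_in_range)
      then have "Poly_Mapping.lookup m i \<le> Max (insert 0 ?S)"
        using \<open>finite ?S\<close> by (intro Max_ge) (simp_all only: finite_insert insert_iff simp_thms)
      then show ?thesis by (rule le_imp_less_Suc)
    next
      case False
      then have "Poly_Mapping.lookup m i = 0" by (simp add: in_keys_iff)
      then show ?thesis by (simp only: zero_less_Suc)
    qed
    then show ?thesis using that by blast
  qed
  define E where "E m = (\<Sum>i<?k. Poly_Mapping.lookup m (e i) * N ^ i)" for m
  have E_inj: "inj_on E (Poly_Mapping.keys f)"
  proof (rule inj_onI, rule poly_mapping_eqI)
    fix m m' x assume m: "m \<in> Poly_Mapping.keys f" "m' \<in> Poly_Mapping.keys f" "E m = E m'"
    show "Poly_Mapping.lookup m x = Poly_Mapping.lookup m' x"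
    proof (cases "x \<in> Y")
      case True
      then obtain i where "i < ?k" "x = e i" using e by (auto simp: bij_betw_def)
      then show ?thesis
        using digits_unique[of ?k "\<lambda>i. Poly_Mapping.lookup m (e i)" N "\<lambda>i. Poly_Mapping.lookup m' (e i)"]
          m N by (simp add: E_def)
    next
      case False
      then have "x \<notin> Poly_Mapping.keys m" "x \<notin> Poly_Mapping.keys m'"
        using Y(3) m by (auto simp: poly_ring_def)
      then show ?thesis by (simp add: in_keys_iff)
    qed
  qed
  define p where "p = (\<Sum>m\<in>Poly_Mapping.keys f. Polynomial.monom (Poly_Mapping.lookup f m) (E m))"
  obtain m0 where m0: "m0 \<in> Poly_Mapping.keys f"
    using f(2) by (metis all_not_in_conv keys_eq_empty)
  have "Polynomial.coeff p (E m0) = (\<Sum>m\<in>Poly_Mapping.keys f. if m = m0 then Poly_Mapping.lookup f m0 else 0)"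
    unfolding p_def coeff_sum
    by (intro sum.cong) (use E_inj m0 in \<open>auto simp: inj_on_def\<close>)
  then have "p \<noteq> 0" using m0 by (auto simp: in_keys_iff)
  then have "finite {w. poly p w = 0}" by (rule poly_roots_finite)
  then obtain w where w: "poly p w \<noteq> 0"
    using infinite_UNIV_char_0[where 'a = complex] by (metis (mono_tags, lifting) UNIV_eq_I mem_Collect_eq)
  define a where "a = (\<lambda>x\<in>X. w ^ (N ^ ix x))"
  have "peval f a = (\<Sum>m\<in>Poly_Mapping.keys f. Poly_Mapping.lookup f m * w ^ E m)"
    unfolding peval_def psubst_alt
  proof (intro sum.cong refl arg_cong2[where f = times])
    fix m assume m: "m \<in> Poly_Mapping.keys f"
    have "mono_val a m = (\<Prod>x\<in>Y. a x ^ Poly_Mapping.lookup m x)"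
      by (rule mono_val_superset) (use Y m in \<open>auto simp: poly_ring_def\<close>)
    also have "\<dots> = (\<Prod>i<?k. a (e i) ^ Poly_Mapping.lookup m (e i))"
      using prod.reindex_bij_betw[OF e, of "\<lambda>x. a x ^ Poly_Mapping.lookup m x"] by simp
    also have "\<dots> = (\<Prod>i<?k. w ^ (Poly_Mapping.lookup m (e i) * N ^ i))"
    proof (intro prod.cong refl)
      fix i assume "i \<in> {..<?k}"
      then have "e i \<in> X" "ix (e i) = i" using e Y(2) ix by (auto simp: bij_betw_def)
      then show "a (e i) ^ Poly_Mapping.lookup m (e i) = w ^ (Poly_Mapping.lookup m (e i) * N ^ i)"
        by (simp add: a_def mult.commute flip: power_mult)
    qed
    also have "\<dots> = w ^ E m" by (simp add: E_def power_sum)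
    finally show "mono_val a m = w ^ E m" .
  qed
  also have "\<dots> = poly p w" by (simp add: p_def poly_sum poly_monom)
  finally have "peval f a \<noteq> 0" using w by simp
  moreover have "a \<in> X \<rightarrow>\<^sub>E UNIV" by (simp add: a_def)
  ultimately show ?thesis by blast
qed

section \<open>Subrings, partial homomorphisms and ideals\<close>

text \<open>
  Points of varieties are treated as homomorphisms to the complex numbers that are only meaningful on a
  subring: the ring generated by some functions, or a local ring inside the field of rational functions.
\<close>
definition is_subring :: "'a::comm_ring_1 set \<Rightarrow> bool" where
  "is_subring S \<longleftrightarrow> 1 \<in> S \<and> (\<forall>x\<in>S. \<forall>y\<in>S. x - y \<in> S \<and> x * y \<in> S)"

definition hom_on :: "'a::comm_ring_1 set \<Rightarrow> ('a \<Rightarrow> 'b::comm_ring_1) \<Rightarrow> bool" where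
  "hom_on S \<chi> \<longleftrightarrow> \<chi> 1 = 1 \<and>
     (\<forall>x\<in>S. \<forall>y\<in>S. \<chi> (x + y) = \<chi> x + \<chi> y \<and> \<chi> (x * y) = \<chi> x * \<chi> y)"

context
  fixes S :: "'a::comm_ring_1 set"
  assumes S: "is_subring S"
begin

lemma subring_1: "1 \<in> S" and subring_diff: "x \<in> S \<Longrightarrow> y \<in> S \<Longrightarrow> x - y \<in> S"
  and subring_mult: "x \<in> S \<Longrightarrow> y \<in> S \<Longrightarrow> x * y \<in> S"
  using S by (auto simp: is_subring_def)

lemma subring_0: "0 \<in> S"
  using subring_diff[OF subring_1 subring_1] by simp

lemma subring_uminus: "x \<in> S \<Longrightarrow> - x \<in> S"
  using subring_diff[OF subring_0, of x] by simp

lemma subring_add: "x \<in> S \<Longrightarrow> y \<in> S \<Longrightarrow> x + y \<in> S"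
  using subring_diff[of x "- y"] subring_uminus[of y] by simp

lemma subring_sum: "(\<And>i. i \<in> A \<Longrightarrow> F i \<in> S) \<Longrightarrow> sum F A \<in> S"
  by (induction A rule: infinite_finite_induct) (auto intro: subring_add subring_0)

lemma subring_prod: "(\<And>i. i \<in> A \<Longrightarrow> F i \<in> S) \<Longrightarrow> prod F A \<in> S"
  by (induction A rule: infinite_finite_induct) (auto intro: subring_mult subring_1)

lemma subring_power: "x \<in> S \<Longrightarrow> x ^ k \<in> S"
  by (induction k) (auto intro: subring_mult subring_1)

lemma subring_of_nat: "of_nat k \<in> S"
  by (induction k) (auto intro: subring_add subring_0 subring_1)

lemmas subring_closed = subring_0 subring_1 subring_add subring_diff subring_uminus subring_mult
  subring_sum subring_prod subring_power

lemma psubst_in_subring: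
  assumes "f \<in> poly_ring X" "\<And>c. h c \<in> S" "\<And>i. i \<in> X \<Longrightarrow> x i \<in> S"
  shows "psubst h x f \<in> S"
  unfolding psubst_def
  by (intro subring_closed assms(2,3)) (use assms(1) in \<open>auto simp: poly_ring_def\<close>)

context
  fixes \<chi> :: "'a \<Rightarrow> 'b::comm_ring_1"
  assumes \<chi>: "hom_on S \<chi>"
begin

lemma hom_on_1: "\<chi> 1 = 1" and hom_on_add: "x \<in> S \<Longrightarrow> y \<in> S \<Longrightarrow> \<chi> (x + y) = \<chi> x + \<chi> y"
  and hom_on_mult: "x \<in> S \<Longrightarrow> y \<in> S \<Longrightarrow> \<chi> (x * y) = \<chi> x * \<chi> y"
  using \<chi> by (auto simp: hom_on_def)

lemma hom_on_0: "\<chi> 0 = 0"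
  using hom_on_add[OF subring_0 subring_0] by simp

lemma hom_on_diff: "x \<in> S \<Longrightarrow> y \<in> S \<Longrightarrow> \<chi> (x - y) = \<chi> x - \<chi> y"
  using hom_on_add[of "x - y" y] subring_diff[of x y] by (simp add: algebra_simps)

lemma hom_on_uminus: "x \<in> S \<Longrightarrow> \<chi> (- x) = - \<chi> x"
  using hom_on_diff[OF subring_0, of x] by (simp add: hom_on_0)

lemma hom_on_sum: "(\<And>i. i \<in> A \<Longrightarrow> F i \<in> S) \<Longrightarrow> \<chi> (sum F A) = (\<Sum>i\<in>A. \<chi> (F i))"
  by (induction A rule: infinite_finite_induct) (auto simp: hom_on_0 hom_on_add subring_sum)

lemma hom_on_prod: "(\<And>i. i \<in> A \<Longrightarrow> F i \<in> S) \<Longrightarrow> \<chi> (prod F A) = (\<Prod>i\<in>A. \<chi> (F i))"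
  by (induction A rule: infinite_finite_induct) (auto simp: hom_on_1 hom_on_mult subring_prod)

lemma hom_on_power: "x \<in> S \<Longrightarrow> \<chi> (x ^ k) = \<chi> x ^ k"
  by (induction k) (auto simp: hom_on_1 hom_on_mult subring_power)

lemma hom_on_psubst:
  assumes f: "f \<in> poly_ring X" and h: "\<And>c. h c \<in> S" and x: "\<And>i. i \<in> X \<Longrightarrow> x i \<in> S"
  shows "\<chi> (psubst h x f) = psubst (\<lambda>c. \<chi> (h c)) (\<lambda>i. \<chi> (x i)) f"
proof -
  have x': "x i \<in> S" if "m \<in> Poly_Mapping.keys f" "i \<in> Poly_Mapping.keys m" for m i
    using f that x by (auto simp: poly_ring_def)
  have p: "(\<Prod>i\<in>Poly_Mapping.keys m. x i ^ Poly_Mapping.lookup m i) \<in> S" if "m \<in> Poly_Mapping.keys f" for m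
    by (intro subring_prod subring_power x'[OF that])
  have "\<chi> (psubst h x f) = (\<Sum>m\<in>Poly_Mapping.keys f. \<chi> (h (Poly_Mapping.lookup f m) *
      (\<Prod>i\<in>Poly_Mapping.keys m. x i ^ Poly_Mapping.lookup m i)))"
    unfolding psubst_def by (intro hom_on_sum subring_mult h p)
  also have "\<dots> = psubst (\<lambda>c. \<chi> (h c)) (\<lambda>i. \<chi> (x i)) f"
    unfolding psubst_def
  proof (intro sum.cong refl)
    fix m assume m: "m \<in> Poly_Mapping.keys f"
    have "\<chi> (\<Prod>i\<in>Poly_Mapping.keys m. x i ^ Poly_Mapping.lookup m i)
       = (\<Prod>i\<in>Poly_Mapping.keys m. \<chi> (x i ^ Poly_Mapping.lookup m i))"
      by (intro hom_on_prod subring_power x'[OF m])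
    also have "\<dots> = (\<Prod>i\<in>Poly_Mapping.keys m. \<chi> (x i) ^ Poly_Mapping.lookup m i)"
      by (intro prod.cong refl hom_on_power x'[OF m])
    finally show "\<chi> (h (Poly_Mapping.lookup f m) * (\<Prod>i\<in>Poly_Mapping.keys m. x i ^ Poly_Mapping.lookup m i))
      = \<chi> (h (Poly_Mapping.lookup f m)) * (\<Prod>i\<in>Poly_Mapping.keys m. \<chi> (x i) ^ Poly_Mapping.lookup m i)"
      using hom_on_mult[OF h p[OF m]] by simp
  qed
  finally show ?thesis .
qed

end

lemma ideal_genI:
  "finite F \<Longrightarrow> F \<subseteq> G \<Longrightarrow> (\<And>g. g \<in> F \<Longrightarrow> r g \<in> S) \<Longrightarrow> (\<Sum>g\<in>F. r g * g) \<in> ideal_gen_in S G"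
  unfolding ideal_gen_in_def by (rule CollectI, rule exI[of _ F], rule exI[of _ r]) auto

lemma ideal_gen_0: "0 \<in> ideal_gen_in S G"
  unfolding ideal_gen_in_def by (auto intro!: exI[of _ "{}"])

lemma ideal_gen_gen_mult: "g \<in> G \<Longrightarrow> r \<in> S \<Longrightarrow> r * g \<in> ideal_gen_in S G"
  unfolding ideal_gen_in_def by (rule CollectI, rule exI[of _ "{g}"], rule exI[of _ "\<lambda>_. r"]) auto

lemma ideal_gen_gen: "g \<in> G \<Longrightarrow> g \<in> ideal_gen_in S G"
  using ideal_gen_gen_mult[OF _ subring_1] by simp

lemma ideal_gen_add:
  assumes "x \<in> ideal_gen_in S G" "y \<in> ideal_gen_in S G"
  shows "x + y \<in> ideal_gen_in S G"
proof -
  obtain F r where F: "x = (\<Sum>g\<in>F. r g * g)" "finite F" "F \<subseteq> G" "\<forall>g\<in>F. r g \<in> S"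
    using assms(1) unfolding ideal_gen_in_def by blast
  obtain F' r' where F': "y = (\<Sum>g\<in>F'. r' g * g)" "finite F'" "F' \<subseteq> G" "\<forall>g\<in>F'. r' g \<in> S"
    using assms(2) unfolding ideal_gen_in_def by blast
  let ?s = "\<lambda>g. (if g \<in> F then r g else 0) + (if g \<in> F' then r' g else 0)"
  have "x = (\<Sum>g\<in>F\<union>F'. (if g \<in> F then r g else 0) * g)"
    unfolding F(1) using F(2) F'(2) by (intro sum.mono_neutral_cong_left) auto
  moreover have "y = (\<Sum>g\<in>F\<union>F'. (if g \<in> F' then r' g else 0) * g)"
    unfolding F'(1) using F(2) F'(2) by (intro sum.mono_neutral_cong_left) auto
  ultimately have "x + y = (\<Sum>g\<in>F\<union>F'. ?s g * g)"
    by (simp only: distrib_right sum.distrib)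
  moreover have "\<forall>g\<in>F\<union>F'. ?s g \<in> S"
    using F(4) F'(4) by (auto intro: subring_add subring_0)
  moreover have "finite (F \<union> F')" "F \<union> F' \<subseteq> G" using F F' by auto
  ultimately show ?thesis using ideal_genI[of "F \<union> F'" G ?s] by simp
qed

lemma ideal_gen_mult:
  assumes "x \<in> ideal_gen_in S G" "s \<in> S"
  shows "s * x \<in> ideal_gen_in S G"
proof -
  obtain F r where F: "x = (\<Sum>g\<in>F. r g * g)" "finite F" "F \<subseteq> G" "\<forall>g\<in>F. r g \<in> S"
    using assms(1) unfolding ideal_gen_in_def by blast
  have "s * x = (\<Sum>g\<in>F. (s * r g) * g)" by (simp add: F(1) sum_distrib_left mult.assoc)
  moreover have "\<forall>g\<in>F. s * r g \<in> S" using F(4) assms(2) by (auto intro: subring_mult)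
  ultimately show ?thesis using F ideal_genI[of F G "\<lambda>g. s * r g"] by simp
qed

lemma ideal_gen_uminus: "x \<in> ideal_gen_in S G \<Longrightarrow> - x \<in> ideal_gen_in S G"
  using ideal_gen_mult[of x G "- 1"] subring_uminus[OF subring_1] by simp

lemma ideal_gen_diff: "x \<in> ideal_gen_in S G \<Longrightarrow> y \<in> ideal_gen_in S G \<Longrightarrow> x - y \<in> ideal_gen_in S G"
  using ideal_gen_add[of x G "- y"] ideal_gen_uminus[of y G] by simp

lemma ideal_gen_sum: "(\<And>i. i \<in> A \<Longrightarrow> F i \<in> ideal_gen_in S G) \<Longrightarrow> sum F A \<in> ideal_gen_in S G"
  by (induction A rule: infinite_finite_induct) (auto intro: ideal_gen_add ideal_gen_0)

lemma ideal_gen_induct [consumes 1, case_names zero add mult]: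
  assumes "x \<in> ideal_gen_in S G" "P 0" "\<And>x y. P x \<Longrightarrow> P y \<Longrightarrow> P (x + y)"
    "\<And>r g. r \<in> S \<Longrightarrow> g \<in> G \<Longrightarrow> P (r * g)"
  shows "P x"
proof -
  obtain F r where F: "x = (\<Sum>g\<in>F. r g * g)" "finite F" "F \<subseteq> G" "\<forall>g\<in>F. r g \<in> S"
    using assms(1) unfolding ideal_gen_in_def by blast
  from F(2-4) have "P (\<Sum>g\<in>F. r g * g)"
    by (induction F) (auto intro: assms)
  then show ?thesis by (simp add: F(1))
qed

lemma ideal_gen_mono:
  assumes "x \<in> ideal_gen_in S G" "\<And>g. g \<in> G \<Longrightarrow> g \<in> ideal_gen_in S G'"
  shows "x \<in> ideal_gen_in S G'"
  using assms(1)
  by (induction rule: ideal_gen_induct) (auto intro: ideal_gen_0 ideal_gen_add ideal_gen_mult assms(2))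

end

text \<open>
  Equations are transported along a homomorphism by checking the generators. This is used for the
  evaluation at a point, and for the substitutions that compare the toric equations with the
  likelihood equations.
\<close>
lemma hom_on_ideal_gen:
  assumes S: "is_subring S" and S': "is_subring S'" and \<chi>: "hom_on S \<chi>" and GS: "G \<subseteq> S"
    and into: "\<And>s. s \<in> S \<Longrightarrow> \<chi> s \<in> S'" and gen: "\<And>g. g \<in> G \<Longrightarrow> \<chi> g \<in> ideal_gen_in S' G'"
    and x: "x \<in> ideal_gen_in S G"
  shows "\<chi> x \<in> ideal_gen_in S' G'"
proof -
  have "x \<in> S \<and> \<chi> x \<in> ideal_gen_in S' G'"
    using x
  proof (induction rule: ideal_gen_induct[OF S, consumes 1, case_names zero add mult])
    case zero
    show ?case using hom_on_0[OF S \<chi>] ideal_gen_0[OF S'] subring_0[OF S] by simp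
  next
    case (add x y)
    then show ?case using hom_on_add[OF S \<chi>] ideal_gen_add[OF S'] subring_add[OF S] by simp
  next
    case (mult r g)
    then show ?case using hom_on_mult[OF S \<chi>, of r g] ideal_gen_mult[OF S'] subring_mult[OF S] gen into GS
      by (metis subsetD)
  qed
  then show ?thesis ..
qed

lemma ideal_gen_vanish:
  assumes S: "is_subring S" and \<chi>: "hom_on S \<chi>" and GS: "G \<subseteq> S"
    and gen: "\<And>g. g \<in> G \<Longrightarrow> \<chi> g = 0" and x: "x \<in> ideal_gen_in S G"
  shows "\<chi> x = 0"
proof -
  have U: "is_subring (UNIV :: 'b set)" by (simp add: is_subring_def)
  have "\<chi> x \<in> ideal_gen_in UNIV {}"
    by (rule hom_on_ideal_gen[OF S U \<chi> GS _ _ x]) (use gen ideal_gen_0[OF U] in auto)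
  then show ?thesis by (auto simp: ideal_gen_in_def)
qed

lemma is_subring_poly_ring: "is_subring (poly_ring X)"
  by (auto simp: is_subring_def poly_ring_diff poly_ring_mult)

lemma hom_on_ring_hom: "comm_ring_hom \<chi> \<Longrightarrow> hom_on S \<chi>"
proof -
  assume "comm_ring_hom \<chi>"
  then interpret comm_ring_hom \<chi> .
  show ?thesis by (simp add: hom_on_def hom_add hom_mult)
qed

lemma comm_ring_hom_of_poly: "comm_ring_hom of_poly"
  by unfold_locales (auto simp: of_poly_def Zero_fract_def One_fract_def)

interpretation of_poly: comm_ring_hom of_poly by (rule comm_ring_hom_of_poly)

lemma of_poly_eq_iff [simp]: "of_poly f = of_poly g \<longleftrightarrow> f = g"
  by (simp add: of_poly_def eq_fract)

lemma of_poly_eq_0_iff [simp]: "of_poly f = 0 \<longleftrightarrow> f = 0"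
  using of_poly_eq_iff[of f 0] by simp

lemma Fract_of_poly: "Fraction_Field.Fract f g = of_poly f / of_poly g"
  by (simp add: of_poly_def)

section \<open>Places of fields of rational functions\<close>

text \<open>
  A homomorphism from polynomials to a field extends to the fractions whose denominator it does not kill.
  The target is the complex numbers for the evaluation at a point, and a field of
  rational functions for the evaluation at the generic point of a subvariety.
\<close>
definition reg :: "('x::linorder mpoly \<Rightarrow> 'b::field) \<Rightarrow> 'x ratfun set" where
  "reg \<phi> = {of_poly f / of_poly g | f g. \<phi> g \<noteq> 0}"

definition ev :: "('x::linorder mpoly \<Rightarrow> 'b::field) \<Rightarrow> 'x ratfun \<Rightarrow> 'b" where
  "ev \<phi> r = (SOME c. \<exists>f g. r = of_poly f / of_poly g \<and> \<phi> g \<noteq> 0 \<and> c = \<phi> f / \<phi> g)"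

context
  fixes \<phi> :: "'x::linorder mpoly \<Rightarrow> 'b::field"
  assumes \<phi>: "comm_ring_hom \<phi>"
begin

interpretation \<phi>: comm_ring_hom \<phi> by (rule \<phi>)

lemma ev_div:
  assumes "\<phi> g \<noteq> 0"
  shows "ev \<phi> (of_poly f / of_poly g) = \<phi> f / \<phi> g"
  unfolding ev_def
proof (rule some_equality)
  fix c assume "\<exists>f' g'. of_poly f / of_poly g = of_poly f' / of_poly g' \<and> \<phi> g' \<noteq> 0 \<and> c = \<phi> f' / \<phi> g'"
  then obtain f' g' where 1: "of_poly f / of_poly g = of_poly f' / of_poly g'" "\<phi> g' \<noteq> 0" "c = \<phi> f' / \<phi> g'"
    by blast
  have "g \<noteq> 0" "g' \<noteq> 0" using assms 1(2) by auto
  then have "of_poly (f * g') = of_poly (f' * g)"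
    using 1(1) by (simp add: frac_eq_eq of_poly.hom_mult)
  then have "\<phi> (f * g') = \<phi> (f' * g)" by simp
  then show "c = \<phi> f / \<phi> g" using assms 1 by (simp add: \<phi>.hom_mult frac_eq_eq)
qed (use assms in auto)

lemma regI: "\<phi> g \<noteq> 0 \<Longrightarrow> of_poly f / of_poly g \<in> reg \<phi>"
  unfolding reg_def by blast

lemma regE:
  assumes "r \<in> reg \<phi>"
  obtains f g where "r = of_poly f / of_poly g" "\<phi> g \<noteq> 0" "g \<noteq> 0" "ev \<phi> r = \<phi> f / \<phi> g"
proof -
  obtain f g where "r = of_poly f / of_poly g" "\<phi> g \<noteq> 0" using assms unfolding reg_def by blast
  moreover then have "g \<noteq> 0" by auto
  ultimately show ?thesis using that ev_div by blast
qed

lemma of_poly_reg: "of_poly f \<in> reg \<phi>" and ev_of_poly: "ev \<phi> (of_poly f) = \<phi> f"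
  using regI[of 1 f] ev_div[of 1 f] by auto

lemma reg_subring: "is_subring (reg \<phi>)"
  unfolding is_subring_def
proof (intro conjI ballI)
  show "1 \<in> reg \<phi>" using of_poly_reg[of 1] by simp
next
  fix x y assume "x \<in> reg \<phi>" "y \<in> reg \<phi>"
  then obtain f g f' g' where 1: "x = of_poly f / of_poly g" "\<phi> g \<noteq> 0" "g \<noteq> 0"
    "y = of_poly f' / of_poly g'" "\<phi> g' \<noteq> 0" "g' \<noteq> 0" by (metis regE)
  have "x - y = of_poly (f * g' - f' * g) / of_poly (g * g')"
    using 1 by (simp add: of_poly.hom_mult of_poly.hom_minus diff_frac_eq)
  moreover have "x * y = of_poly (f * f') / of_poly (g * g')"
    using 1 by (simp add: of_poly.hom_mult)
  ultimately show "x - y \<in> reg \<phi>" "x * y \<in> reg \<phi>"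
    using regI[of "g * g'"] 1 by (simp_all only: \<phi>.hom_mult mult_eq_0_iff simp_thms)
qed

lemma ev_hom: "hom_on (reg \<phi>) (ev \<phi>)"
  unfolding hom_on_def
proof (intro conjI ballI)
  show "ev \<phi> 1 = 1" using ev_of_poly[of 1] by simp
next
  fix x y assume "x \<in> reg \<phi>" "y \<in> reg \<phi>"
  then obtain f g f' g' where 1: "x = of_poly f / of_poly g" "\<phi> g \<noteq> 0" "g \<noteq> 0" "ev \<phi> x = \<phi> f / \<phi> g"
    "y = of_poly f' / of_poly g'" "\<phi> g' \<noteq> 0" "g' \<noteq> 0" "ev \<phi> y = \<phi> f' / \<phi> g'" by (metis regE)
  have gg: "\<phi> (g * g') \<noteq> 0" using 1 by (simp add: \<phi>.hom_mult)
  have "x + y = of_poly (f * g' + f' * g) / of_poly (g * g')"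
    using 1 by (simp add: of_poly.hom_mult of_poly.hom_add add_frac_eq)
  then show "ev \<phi> (x + y) = ev \<phi> x + ev \<phi> y"
    using ev_div[OF gg, of "f * g' + f' * g"] 1 by (simp add: \<phi>.hom_mult \<phi>.hom_add add_frac_eq)
  have "x * y = of_poly (f * f') / of_poly (g * g')"
    using 1 by (simp add: of_poly.hom_mult)
  then show "ev \<phi> (x * y) = ev \<phi> x * ev \<phi> y"
    using ev_div[OF gg, of "f * f'"] 1 by (simp add: \<phi>.hom_mult)
qed

end

lemma comm_ring_hom_peval: "comm_ring_hom (\<lambda>f. peval f a)"
  unfolding peval_def by (rule psubst_hom[OF comm_ring_hom_ident])

section \<open>Local rings and points of multiplicity one\<close>

abbreviation ev_at :: "('x::linorder \<Rightarrow> complex) \<Rightarrow> 'x ratfun \<Rightarrow> complex" where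
  "ev_at a \<equiv> ev (\<lambda>f. peval f a)"

lemma local_ring_alt:
  "local_ring X a = {of_poly f / of_poly g | f g. f \<in> poly_ring X \<and> g \<in> poly_ring X \<and> peval g a \<noteq> 0}"
  by (simp add: local_ring_def Fract_of_poly)

lemma local_ringI:
  "f \<in> poly_ring X \<Longrightarrow> g \<in> poly_ring X \<Longrightarrow> peval g a \<noteq> 0 \<Longrightarrow> of_poly f / of_poly g \<in> local_ring X a"
  unfolding local_ring_alt by blast

lemma local_ring_of_poly: "f \<in> poly_ring X \<Longrightarrow> of_poly f \<in> local_ring X a"
  using local_ringI[of f X 1 a] by simp

lemma local_ring_inverse_poly:
  "f \<in> poly_ring X \<Longrightarrow> peval f a \<noteq> 0 \<Longrightarrow> inverse (of_poly f) \<in> local_ring X a"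
  using local_ringI[of 1 X f a] by (simp add: divide_inverse)

lemma local_ring_reg: "local_ring X a \<subseteq> reg (\<lambda>f. peval f a)"
  unfolding local_ring_alt reg_def by blast

lemma local_ring_subring: "is_subring (local_ring X a)"
  unfolding is_subring_def
proof (intro conjI ballI)
  show "1 \<in> local_ring X a" using local_ring_of_poly[of 1] by simp
next
  fix x y assume "x \<in> local_ring X a" "y \<in> local_ring X a"
  then obtain f g f' g' where 1: "x = of_poly f / of_poly g" "peval g a \<noteq> 0" "f \<in> poly_ring X" "g \<in> poly_ring X"
    "y = of_poly f' / of_poly g'" "peval g' a \<noteq> 0" "f' \<in> poly_ring X" "g' \<in> poly_ring X"
    unfolding local_ring_alt by blast
  have nz: "g \<noteq> 0" "g' \<noteq> 0" using 1 by auto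
  have gg: "peval (g * g') a \<noteq> 0" "g * g' \<in> poly_ring X" using 1 by (auto simp: peval.hom_mult poly_ring_mult)
  have "x - y = of_poly (f * g' - f' * g) / of_poly (g * g')"
    using 1 nz by (simp add: of_poly.hom_mult of_poly.hom_minus diff_frac_eq)
  moreover have "x * y = of_poly (f * f') / of_poly (g * g')"
    using 1 by (simp add: of_poly.hom_mult)
  ultimately show "x - y \<in> local_ring X a" "x * y \<in> local_ring X a"
    using local_ringI[OF _ gg(2,1)] 1 by (simp_all add: poly_ring_closed)
qed

lemma ev_at_hom: "hom_on (local_ring X a) (ev_at a)"
  using ev_hom[OF comm_ring_hom_peval, of a] local_ring_reg[of X a] unfolding hom_on_def by blast

lemma ev_at_of_poly [simp]: "ev_at a (of_poly f) = peval f a"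
  by (rule ev_of_poly[OF comm_ring_hom_peval])

text \<open>
  A polynomial minus its value at \<open>a\<close> is a combination of the \<open>x - a x\<close>, so these generate
  the maximal ideal of the local ring.
\<close>
lemma has_mult_1:
  assumes G: "G \<subseteq> local_ring X a" "\<And>g. g \<in> G \<Longrightarrow> ev_at a g = 0"
    and lin: "\<And>x. x \<in> X \<Longrightarrow> of_poly (PVar x - PConst (a x)) \<in> ideal_gen_in (local_ring X a) G"
  shows "has_mult X G a 1"
proof -
  let ?O = "local_ring X a" let ?J = "ideal_gen_in (local_ring X a) G"
  note O = local_ring_subring[of X a]
  note ev = ev_at_hom[of X a]
  have poly: "of_poly (f - PConst (peval f a)) \<in> ?J" if "f \<in> poly_ring X" for f
    using that
  proof (induction rule: poly_ring_induct)
    case (const c) then show ?case using ideal_gen_0[OF O] by simp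
  next
    case (var x) then show ?case using lin by simp
  next
    case (add f g)
    have "of_poly (f + g - PConst (peval (f + g) a)) =
      of_poly (f - PConst (peval f a)) + of_poly (g - PConst (peval g a))"
      by (simp add: peval.hom_add PConst.hom_add flip: of_poly.hom_add)
    then show ?case using add ideal_gen_add[OF O] by simp
  next
    case (mult f g)
    have "of_poly (f * g - PConst (peval (f * g) a)) =
      of_poly g * of_poly (f - PConst (peval f a)) + of_poly (PConst (peval f a)) * of_poly (g - PConst (peval g a))"
      by (simp add: peval.hom_mult PConst.hom_mult algebra_simps flip: of_poly.hom_add of_poly.hom_mult)
    then show ?case
      using mult by (simp only:) (intro ideal_gen_add[OF O] ideal_gen_mult[OF O] local_ring_of_poly poly_ring_PConst)
  qed
  have J0: "ev_at a x = 0" if "x \<in> ?J" for x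
    by (rule ideal_gen_vanish[OF O ev G that])
  have cO: "of_poly (PConst c) \<in> ?O" for c by (simp add: local_ring_of_poly)
  have main: "v - of_poly (PConst c) \<in> ?J \<longleftrightarrow> c = ev_at a v" if v: "v \<in> ?O" for v c
  proof
    assume "v - of_poly (PConst c) \<in> ?J"
    from J0[OF this] show "c = ev_at a v" using hom_on_diff[OF O ev v cO, of c] by simp
  next
    assume c: "c = ev_at a v"
    obtain f g where fg: "f \<in> poly_ring X" "g \<in> poly_ring X" "peval g a \<noteq> 0" "v = of_poly f / of_poly g"
      using v unfolding local_ring_alt by blast
    then have "g \<noteq> 0" by auto
    have cv: "c = peval f a / peval g a"
      unfolding c fg(4) by (rule ev_div[OF comm_ring_hom_peval fg(3)])
    let ?F = "f - PConst c * g"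
    have F: "?F \<in> poly_ring X" "peval ?F a = 0"
      using fg cv by (auto simp: poly_ring_closed peval.hom_mult peval.hom_minus)
    have "v - of_poly (PConst c) = inverse (of_poly g) * of_poly ?F"
      using fg \<open>g \<noteq> 0\<close> by (simp add: of_poly.hom_minus of_poly.hom_mult field_simps)
    moreover have "of_poly ?F \<in> ?J" using poly[OF F(1)] F(2) by simp
    ultimately show "v - of_poly (PConst c) \<in> ?J"
      using ideal_gen_mult[OF O _ local_ring_inverse_poly[OF fg(2,3)]] by simp
  qed
  show ?thesis
    unfolding has_mult_def quotient_has_dim_def
  proof (intro exI[of _ "{1}"] conjI ballI)
    show "{1} \<subseteq> ?O" using subring_1[OF O] by simp
    fix v assume v: "v \<in> ?O"
    show "\<exists>!c. c \<in> {1} \<rightarrow>\<^sub>E UNIV \<and> v - (\<Sum>b\<in>{1}. of_poly (PConst (c b)) * b) \<in> ?J"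
    proof (rule ex1I[of _ "\<lambda>b\<in>{1}. ev_at a v"])
      fix c assume c: "c \<in> {1} \<rightarrow>\<^sub>E UNIV \<and> v - (\<Sum>b\<in>{1}. of_poly (PConst (c b)) * b) \<in> ?J"
      then have "c 1 = ev_at a v" using main[OF v] by simp
      with c show "c = (\<lambda>b\<in>{1}. ev_at a v)" by (auto simp: PiE_def extensional_def fun_eq_iff)
    qed (use main[OF v] in auto)
  qed auto
qed

section \<open>Extending homomorphisms to finitely many algebraic elements\<close>

definition polys_over :: "'a::comm_ring_1 set \<Rightarrow> 'a poly set" where
  "polys_over S = {p. \<forall>i. poly.coeff p i \<in> S}"

definition adjoin :: "'a::comm_ring_1 set \<Rightarrow> 'a \<Rightarrow> 'a set" where
  "adjoin S w = {poly p w | p. p \<in> polys_over S}"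

definition algebraic_over :: "'a::comm_ring_1 set \<Rightarrow> 'a \<Rightarrow> bool" where
  "algebraic_over S w \<longleftrightarrow> (\<exists>p\<in>polys_over S. p \<noteq> 0 \<and> poly p w = 0)"

context
  fixes S :: "'a::{idom,ring_char_0} set"
  assumes S: "is_subring S"
begin

lemma polys_over_const: "s \<in> S \<Longrightarrow> [:s:] \<in> polys_over S"
  and polys_over_X: "[:0, 1:] \<in> polys_over S"
  by (auto simp: polys_over_def coeff_pCons subring_closed[OF S] split: nat.splits)

lemma polys_over_subring: "is_subring (polys_over S)"
  unfolding is_subring_def
proof (intro conjI ballI)
  show "1 \<in> polys_over S" using polys_over_const[OF subring_1[OF S]] by (simp add: one_pCons)
  fix p q assume "p \<in> polys_over S" "q \<in> polys_over S"
  then show "p - q \<in> polys_over S" "p * q \<in> polys_over S"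
    by (auto simp: polys_over_def coeff_mult intro!: subring_closed[OF S])
qed

lemma polys_over_smult: "s \<in> S \<Longrightarrow> p \<in> polys_over S \<Longrightarrow> smult s p \<in> polys_over S"
  by (auto simp: polys_over_def intro: subring_mult[OF S])

lemma polys_over_monom: "s \<in> S \<Longrightarrow> Polynomial.monom s k \<in> polys_over S"
  by (auto simp: polys_over_def intro: subring_0[OF S])

lemma polys_over_pderiv: "p \<in> polys_over S \<Longrightarrow> pderiv p \<in> polys_over S"
  by (auto simp: polys_over_def coeff_pderiv intro!: subring_mult[OF S] subring_of_nat[OF S]
      simp del: of_nat_Suc)

lemma adjoinI: "p \<in> polys_over S \<Longrightarrow> poly p w \<in> adjoin S w"
  unfolding adjoin_def by blast

lemma adjoin_subring: "is_subring (adjoin S w)"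
  unfolding is_subring_def
proof (intro conjI ballI)
  show "1 \<in> adjoin S w" unfolding adjoin_def
    using subring_1[OF polys_over_subring] by (metis (mono_tags, lifting) mem_Collect_eq poly_1)
  fix x y assume "x \<in> adjoin S w" "y \<in> adjoin S w"
  then obtain p q where "p \<in> polys_over S" "q \<in> polys_over S" "x = poly p w" "y = poly q w"
    unfolding adjoin_def by blast
  then show "x - y \<in> adjoin S w" "x * y \<in> adjoin S w"
    using adjoinI[OF subring_diff[OF polys_over_subring, of p q], of w]
      adjoinI[OF subring_mult[OF polys_over_subring, of p q], of w] by simp_all
qed

lemma adjoin_base: "s \<in> S \<Longrightarrow> s \<in> adjoin S w"
  unfolding adjoin_def using polys_over_const by (auto intro!: exI[of _ "[:s:]"])

lemma adjoin_gen: "w \<in> adjoin S w"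
  unfolding adjoin_def using polys_over_X by (auto intro!: exI[of _ "[:0, 1:]"])

text \<open>
  Subrings need not be fields, so division with remainder costs a power of the leading coefficient.
\<close>
lemma polys_over_pseudo_div:
  assumes "H \<in> polys_over S" "H \<noteq> 0" "F \<in> polys_over S"
  shows "\<exists>N q r. q \<in> polys_over S \<and> r \<in> polys_over S \<and>
    smult (lead_coeff H ^ N) F = q * H + r \<and> (r = 0 \<or> degree r < degree H)"
  using assms(3)
proof (induction "if F = 0 then 0 else Suc (degree F)" arbitrary: F rule: less_induct)
  case less
  show ?case
  proof (cases "F = 0 \<or> degree F < degree H")
    case True
    then show ?thesis
      using less.prems subring_0[OF polys_over_subring] by (intro exI[of _ 0] exI[of _ F]) auto
  next
    case False
    define M where "M = Polynomial.monom (lead_coeff F) (degree F - degree H)"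
    define F1 where "F1 = smult (lead_coeff H) F - M * H"
    have lS: "lead_coeff H \<in> S" "lead_coeff F \<in> S" using assms(1) less.prems by (auto simp: polys_over_def)
    have M: "M \<in> polys_over S" unfolding M_def by (intro polys_over_monom lS)
    have F1: "F1 \<in> polys_over S"
      unfolding F1_def using less.prems assms(1) M lS
      by (intro subring_closed[OF polys_over_subring] polys_over_smult)
    have dM: "degree M = degree F - degree H" unfolding M_def using False by (simp add: degree_monom_eq)
    have "degree F1 \<le> degree F"
      unfolding F1_def using False degree_mult_le[of M H] dM
      by (intro degree_diff_le) (auto intro: order_trans[OF degree_smult_le])
    moreover have "poly.coeff (M * H) (degree F) = lead_coeff F * lead_coeff H"
      using coeff_mult_degree_sum[of M H] dM False by (simp add: M_def)
    then have "poly.coeff F1 (degree F) = 0" by (simp add: F1_def)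
    ultimately have "F1 = 0 \<or> degree F1 < degree F" by (rule eq_zero_or_degree_less)
    then have "(if F1 = 0 then 0 else Suc (degree F1)) < (if F = 0 then 0 else Suc (degree F))"
      using False by auto
    from less.hyps[OF this F1] obtain N q r where 1: "q \<in> polys_over S" "r \<in> polys_over S"
      "smult (lead_coeff H ^ N) F1 = q * H + r" "r = 0 \<or> degree r < degree H" by blast
    have "smult (lead_coeff H ^ Suc N) F = (q + smult (lead_coeff H ^ N) M) * H + r"
    proof -
      have "smult (lead_coeff H ^ Suc N) F = smult (lead_coeff H ^ N) (F1 + M * H)"
        by (simp add: F1_def mult.commute)
      also have "\<dots> = (q + smult (lead_coeff H ^ N) M) * H + r"
        using 1(3) by (simp add: smult_add_right distrib_right)
      finally show ?thesis .
    qed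
    moreover have "q + smult (lead_coeff H ^ N) M \<in> polys_over S"
      by (intro subring_add[OF polys_over_subring] 1 polys_over_smult M subring_power[OF S] lS)
    ultimately show ?thesis using 1 by blast
  qed
qed

context
  fixes \<chi> :: "'a \<Rightarrow> complex"
  assumes \<chi>: "hom_on S \<chi>"
begin

lemma coeff_mp: "poly.coeff (map_poly \<chi> p) i = \<chi> (poly.coeff p i)"
  by (simp add: coeff_map_poly hom_on_0[OF S \<chi>])

lemma mp_const: "map_poly \<chi> [:s:] = [:\<chi> s:]"
  by (rule poly_eqI) (simp add: coeff_mp coeff_pCons hom_on_0[OF S \<chi>] split: nat.splits)

lemma degree_mp: "degree (map_poly \<chi> p) \<le> degree p"
  by (rule degree_le) (simp add: coeff_mp coeff_eq_0 hom_on_0[OF S \<chi>])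

lemma mp_mult: "p \<in> polys_over S \<Longrightarrow> q \<in> polys_over S \<Longrightarrow> map_poly \<chi> (p * q) = map_poly \<chi> p * map_poly \<chi> q"
  by (rule poly_eqI)
     (auto simp: coeff_mp coeff_mult polys_over_def hom_on_sum[OF S \<chi>] hom_on_mult[OF S \<chi>] subring_mult[OF S])

lemma mp_add: "p \<in> polys_over S \<Longrightarrow> q \<in> polys_over S \<Longrightarrow> map_poly \<chi> (p + q) = map_poly \<chi> p + map_poly \<chi> q"
  by (rule poly_eqI) (auto simp: coeff_mp polys_over_def hom_on_add[OF S \<chi>])

lemma mp_diff: "p \<in> polys_over S \<Longrightarrow> q \<in> polys_over S \<Longrightarrow> map_poly \<chi> (p - q) = map_poly \<chi> p - map_poly \<chi> q"
  by (rule poly_eqI) (auto simp: coeff_mp polys_over_def hom_on_diff[OF S \<chi>])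

lemma mp_smult: "s \<in> S \<Longrightarrow> p \<in> polys_over S \<Longrightarrow> map_poly \<chi> (smult s p) = smult (\<chi> s) (map_poly \<chi> p)"
  by (rule poly_eqI) (auto simp: coeff_mp polys_over_def hom_on_mult[OF S \<chi>])

lemma hom_on_of_nat: "\<chi> (of_nat k) = of_nat k"
  by (induction k) (auto simp: hom_on_0[OF S \<chi>] hom_on_1[OF S \<chi>] hom_on_add[OF S \<chi>]
    subring_1[OF S] subring_of_nat[OF S])

lemma mp_pderiv:
  assumes "p \<in> polys_over S" shows "map_poly \<chi> (pderiv p) = pderiv (map_poly \<chi> p)"
proof (rule poly_eqI)
  fix n
  have "\<chi> (of_nat (Suc n) * poly.coeff p (Suc n)) = of_nat (Suc n) * \<chi> (poly.coeff p (Suc n))"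
    using assms hom_on_mult[OF S \<chi> subring_of_nat[OF S, of "Suc n"], of "poly.coeff p (Suc n)"]
    by (simp only: polys_over_def mem_Collect_eq hom_on_of_nat)
  then show "poly.coeff (map_poly \<chi> (pderiv p)) n = poly.coeff (pderiv (map_poly \<chi> p)) n"
    by (simp only: coeff_mp coeff_pderiv)
qed

lemma hom_on_poly:
  assumes \<chi>': "hom_on (adjoin S w) \<chi>'" "\<And>s. s \<in> S \<Longrightarrow> \<chi>' s = \<chi> s" and p: "p \<in> polys_over S"
  shows "\<chi>' (poly p w) = poly (map_poly \<chi> p) (\<chi>' w)"
proof -
  note A = adjoin_subring[of w]
  have cA: "poly.coeff p i \<in> S" for i using p by (simp add: polys_over_def)
  have wA: "w ^ i \<in> adjoin S w" for i by (intro subring_power[OF A] adjoin_gen)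
  have "\<chi>' (poly p w) = (\<Sum>i\<le>degree p. \<chi>' (poly.coeff p i * w ^ i))"
    unfolding poly_altdef by (intro hom_on_sum[OF A \<chi>'(1)] subring_mult[OF A] adjoin_base cA wA)
  also have "\<dots> = (\<Sum>i\<le>degree p. \<chi> (poly.coeff p i) * \<chi>' w ^ i)"
    using hom_on_mult[OF A \<chi>'(1) adjoin_base[OF cA] wA] hom_on_power[OF A \<chi>'(1) adjoin_gen] \<chi>'(2)[OF cA]
    by simp
  also have "\<dots> = poly (map_poly \<chi> p) (\<chi>' w)"
  proof -
    have "(\<Sum>i\<le>degree p. \<chi> (poly.coeff p i) * \<chi>' w ^ i) =
      (\<Sum>i\<le>degree (map_poly \<chi> p). poly.coeff (map_poly \<chi> p) i * \<chi>' w ^ i)"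
      unfolding coeff_mp[symmetric] using degree_mp[of p]
      by (intro sum.mono_neutral_right) (auto simp: not_le coeff_eq_0)
    then show ?thesis by (simp add: poly_altdef)
  qed
  finally show ?thesis .
qed

end

context
  fixes w :: 'a and F :: "'a poly"
  assumes F: "F \<in> polys_over S" "F \<noteq> 0" "poly F w = 0"
    and F_min: "\<And>G. G \<in> polys_over S \<Longrightarrow> poly G w = 0 \<Longrightarrow> degree G < degree F \<Longrightarrow> G = 0"
begin

text \<open>
  A relation of \<open>w\<close> leaves, after pseudo-division by the minimal one, a remainder of lower degree that is
  again a relation.
\<close>
lemma min_poly_divides:
  assumes "G \<in> polys_over S" "poly G w = 0"
  shows "\<exists>N q. q \<in> polys_over S \<and> smult (lead_coeff F ^ N) G = q * F"
proof -
  obtain N q r where 1: "q \<in> polys_over S" "r \<in> polys_over S"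
      "smult (lead_coeff F ^ N) G = q * F + r" "r = 0 \<or> degree r < degree F"
    using polys_over_pseudo_div[OF F(1,2) assms(1)] by blast
  have "poly (smult (lead_coeff F ^ N) G) w = poly (q * F + r) w" using 1(3) by simp
  then have "poly r w = 0" using assms(2) F(3) by simp
  then have "r = 0" using 1 F_min by blast
  then show ?thesis using 1 by auto
qed

lemma degree_min_poly: "degree F > 0"
proof (rule ccontr)
  assume "\<not> degree F > 0"
  then obtain c where "F = [:c:]" by (auto elim: degree_eq_zeroE)
  then show False using F by simp
qed

text \<open>
  A nonzero \<open>g\<close> divides a nonzero element of \<open>S\<close>, because \<open>S[w]\<close> is algebraic over \<open>S\<close>: among the nonzero multiples of
  \<open>g\<close>, written as polynomials in \<open>w\<close>, one of least degree is constant, since otherwise dividing the minimal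
  relation by it would give a smaller multiple. Homomorphisms that do not kill this element
  of \<open>S\<close> extend only to homomorphisms that do not kill \<open>g\<close>.
\<close>
lemma nonzero_divides_base:
  assumes "g \<in> adjoin S w" "g \<noteq> 0"
  shows "\<exists>h\<in>S. h \<noteq> 0 \<and> (\<exists>v\<in>adjoin S w. h = g * v)"
proof -
  define Q where "Q H \<longleftrightarrow> H \<in> polys_over S \<and> poly H w \<noteq> 0 \<and> (\<exists>v\<in>adjoin S w. poly H w = g * v)" for H
  obtain G where "G \<in> polys_over S" "g = poly G w" using assms(1) unfolding adjoin_def by blast
  then have "Q G" unfolding Q_def using assms(2) subring_1[OF adjoin_subring] by (auto intro!: bexI[of _ 1])
  then obtain H where H: "Q H" and H_min: "\<And>H'. Q H' \<Longrightarrow> degree H \<le> degree H'"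
    using arg_min_natI[of Q G degree] arg_min_nat_le[of Q _ degree] by metis
  obtain v where v: "v \<in> adjoin S w" "poly H w = g * v" using H by (auto simp: Q_def)
  have HS: "H \<in> polys_over S" "H \<noteq> 0" "poly H w \<noteq> 0" using H by (auto simp: Q_def)
  have lS: "lead_coeff H \<in> S" "lead_coeff F \<in> S" using HS F by (auto simp: polys_over_def)
  have inA: "p \<in> polys_over S \<Longrightarrow> poly p w \<in> adjoin S w" for p unfolding adjoin_def by blast
  have less: "degree H < degree F"
  proof (rule ccontr)
    assume ge: "\<not> degree H < degree F"
    obtain N q r where 1: "q \<in> polys_over S" "r \<in> polys_over S"
      "smult (lead_coeff F ^ N) H = q * F + r" "r = 0 \<or> degree r < degree F"
      using polys_over_pseudo_div[OF F(1,2) HS(1)] by blast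
    have "poly (smult (lead_coeff F ^ N) H) w = poly (q * F + r) w" using 1(3) by simp
    then have r: "poly r w = g * (lead_coeff F ^ N * v)" using F(3) v by (simp add: mult.left_commute)
    moreover have "poly r w \<noteq> 0" using r v HS F(2) by auto
    moreover have "lead_coeff F ^ N * v \<in> adjoin S w"
      by (intro subring_closed[OF adjoin_subring] v adjoin_base lS)
    ultimately have "Q r" using 1 unfolding Q_def by blast
    moreover have "r \<noteq> 0" using \<open>poly r w \<noteq> 0\<close> by auto
    ultimately show False using H_min[of r] 1 ge by linarith
  qed
  have "degree H = 0"
  proof (rule ccontr)
    assume d: "degree H \<noteq> 0"
    obtain N s r where 1: "s \<in> polys_over S" "r \<in> polys_over S"
      "smult (lead_coeff H ^ N) F = s * H + r" "r = 0 \<or> degree r < degree H"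
      using polys_over_pseudo_div[OF HS(1,2) F(1)] by blast
    have "poly (smult (lead_coeff H ^ N) F) w = poly (s * H + r) w" using 1(3) by simp
    then have r: "poly r w = - (poly s w * poly H w)" using F(3) by (simp add: eq_neg_iff_add_eq_0 add.commute)
    have "poly r w = 0"
    proof (rule ccontr)
      assume nz: "poly r w \<noteq> 0"
      have "poly r w = g * (- (poly s w * v))" using r v by simp
      moreover have "- (poly s w * v) \<in> adjoin S w"
        by (intro subring_closed[OF adjoin_subring] v inA 1)
      ultimately have "Q r" using 1 nz unfolding Q_def by blast
      moreover have "r \<noteq> 0" using nz by auto
      ultimately show False using H_min[of r] 1 by linarith
    qed
    then have "r = 0" using 1 F_min[of r] less by linarith
    then have eq: "smult (lead_coeff H ^ N) F = s * H" using 1 by simp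
    have "poly s w = 0" using r \<open>poly r w = 0\<close> HS by simp
    have "s \<noteq> 0" using eq F(2) HS(2) by auto
    then have "degree F = degree s + degree H"
      using arg_cong[OF eq, of degree] HS(2) by (simp add: degree_mult_eq)
    then have "s = 0" using F_min[OF 1(1) \<open>poly s w = 0\<close>] d by linarith
    then show False using \<open>s \<noteq> 0\<close> by simp
  qed
  then obtain c where "H = [:c:]" by (auto elim: degree_eq_zeroE)
  then show ?thesis using HS v lS by (intro bexI[of _ c]) auto
qed

context
  fixes \<chi> :: "'a \<Rightarrow> complex"
  assumes \<chi>: "hom_on S \<chi>"
begin

lemma extension_root:
  assumes \<chi>': "hom_on (adjoin S w) \<chi>'" "\<And>s. s \<in> S \<Longrightarrow> \<chi>' s = \<chi> s"
  shows "poly (map_poly \<chi> F) (\<chi>' w) = 0"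
  using hom_on_poly[OF \<chi> \<chi>' F(1)] hom_on_0[OF adjoin_subring \<chi>'(1)] F(3) by simp

text \<open>
  A root \<open>\<tau>\<close> of the image of the minimal relation \<open>F\<close> is a possible value of \<open>w\<close>: every relation of \<open>w\<close>, times a
  power of the leading coefficient, is a multiple of \<open>F\<close>, so its image vanishes at \<open>\<tau>\<close>.
\<close>
lemma root_extension:
  assumes l: "\<chi> (lead_coeff F) \<noteq> 0" and \<tau>: "poly (map_poly \<chi> F) \<tau> = 0"
  shows "\<exists>\<chi>'. hom_on (adjoin S w) \<chi>' \<and> (\<forall>s\<in>S. \<chi>' s = \<chi> s) \<and> \<chi>' w = \<tau>"
proof -
  have lS: "lead_coeff F \<in> S" using F by (auto simp: polys_over_def)
  have zero: "poly (map_poly \<chi> p) \<tau> = 0" if p: "p \<in> polys_over S" "poly p w = 0" for p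
  proof -
    obtain N q where q: "q \<in> polys_over S" "smult (lead_coeff F ^ N) p = q * F"
      using min_poly_divides[OF p] by blast
    have "smult (\<chi> (lead_coeff F) ^ N) (map_poly \<chi> p) = map_poly \<chi> q * map_poly \<chi> F"
      using arg_cong[OF q(2), of "map_poly \<chi>"] mp_smult[OF \<chi> subring_power[OF S lS] p(1), of N] mp_mult[OF \<chi> q(1) F(1)]
        hom_on_power[OF S \<chi> lS, of N] by simp
    then have "poly (smult (\<chi> (lead_coeff F) ^ N) (map_poly \<chi> p)) \<tau> = 0" using \<tau> by simp
    then show ?thesis using l by simp
  qed
  define \<chi>' where "\<chi>' x = poly (map_poly \<chi> (SOME p. p \<in> polys_over S \<and> x = poly p w)) \<tau>" for x
  have \<chi>': "\<chi>' (poly p w) = poly (map_poly \<chi> p) \<tau>" if p: "p \<in> polys_over S" for p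
  proof -
    let ?q = "SOME q. q \<in> polys_over S \<and> poly p w = poly q w"
    have q: "?q \<in> polys_over S \<and> poly p w = poly ?q w" by (rule someI[of _ p]) (use p in auto)
    then have "poly (map_poly \<chi> (p - ?q)) \<tau> = 0"
      by (intro zero subring_diff[OF polys_over_subring] p) auto
    then show ?thesis unfolding \<chi>'_def using q p by (simp add: mp_diff[OF \<chi>])
  qed
  have "hom_on (adjoin S w) \<chi>'"
    unfolding hom_on_def
  proof (intro conjI ballI)
    show "\<chi>' 1 = 1" using \<chi>'[OF subring_1[OF polys_over_subring]] hom_on_1[OF S \<chi>]
      by (simp add: map_poly_1)
    fix x y assume "x \<in> adjoin S w" "y \<in> adjoin S w"
    then obtain p q where "p \<in> polys_over S" "q \<in> polys_over S" "x = poly p w" "y = poly q w"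
      unfolding adjoin_def by blast
    then show "\<chi>' (x + y) = \<chi>' x + \<chi>' y" "\<chi>' (x * y) = \<chi>' x * \<chi>' y"
      using \<chi>'[of "p + q"] \<chi>'[of "p * q"] \<chi>'[of p] \<chi>'[of q]
      by (simp_all add: subring_closed[OF polys_over_subring] mp_add[OF \<chi>] mp_mult[OF \<chi>])
  qed
  moreover have "\<chi>' s = \<chi> s" if "s \<in> S" for s
    using \<chi>'[OF polys_over_const[OF that]] by (simp add: mp_const[OF \<chi>])
  moreover have "\<chi>' w = \<tau>"
    using \<chi>'[OF polys_over_X] by (simp add: map_poly_pCons hom_on_0[OF S \<chi>] hom_on_1[OF S \<chi>])
  ultimately show ?thesis by blast
qed

end

end

text \<open>
  In characteristic 0 the derivative of a minimal relation is nonzero of lower degree, hence no relation: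
  \<open>w\<close> is a simple root.
\<close>
lemma minimal_relation:
  assumes "algebraic_over S w"
  obtains F where "F \<in> polys_over S" "F \<noteq> 0" "poly F w = 0" "poly (pderiv F) w \<noteq> 0"
    "\<And>G. G \<in> polys_over S \<Longrightarrow> poly G w = 0 \<Longrightarrow> degree G < degree F \<Longrightarrow> G = 0"
proof -
  define Q where "Q p \<longleftrightarrow> p \<in> polys_over S \<and> p \<noteq> 0 \<and> poly p w = 0" for p
  obtain p0 where "Q p0" using assms by (auto simp: Q_def algebraic_over_def)
  then obtain F where QF: "Q F" and min: "\<And>H'. Q H' \<Longrightarrow> degree F \<le> degree H'"
    using arg_min_natI[of Q p0 degree] arg_min_nat_le[of Q _ degree] by metis
  have F: "F \<in> polys_over S" "F \<noteq> 0" "poly F w = 0" using QF by (auto simp: Q_def)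
  have F_min: "G = 0" if "G \<in> polys_over S" "poly G w = 0" "degree G < degree F" for G
    using min[of G] that by (auto simp: Q_def)
  have d0: "degree F > 0" by (rule degree_min_poly[OF F F_min])
  have F': "poly (pderiv F) w \<noteq> 0"
  proof
    assume "poly (pderiv F) w = 0"
    then have "pderiv F = 0"
      by (rule F_min[OF polys_over_pderiv[OF F(1)]]) (use d0 in \<open>simp add: degree_pderiv\<close>)
    then show False using d0 by (simp add: pderiv_eq_0_iff)
  qed
  show ?thesis by (rule that[OF F F' F_min])
qed

text \<open>
  The extensions of \<open>\<chi>\<close> to \<open>S[w]\<close> are the roots of the image of a minimal relation \<open>F\<close> of \<open>w\<close>. If \<open>\<chi>\<close> kills neither the
  leading coefficient of \<open>F\<close> nor a suitable multiple in \<open>S\<close> of the derivative of \<open>F\<close> at \<open>w\<close>, these roots are simple and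
  their number is the degree of \<open>F\<close>. The given \<open>g\<close> is treated like the derivative.
\<close>
lemma extension_count:
  assumes "algebraic_over S w"
  shows "\<exists>d. \<forall>g\<in>adjoin S w. g \<noteq> 0 \<longrightarrow> (\<exists>h\<in>S. h \<noteq> 0 \<and>
    (\<forall>\<chi> :: 'a \<Rightarrow> complex. hom_on S \<chi> \<longrightarrow> \<chi> h \<noteq> 0 \<longrightarrow>
      finite {\<tau>. \<exists>\<chi>'. hom_on (adjoin S w) \<chi>' \<and> (\<forall>s\<in>S. \<chi>' s = \<chi> s) \<and> \<chi>' w = \<tau>} \<and>
      card {\<tau>. \<exists>\<chi>'. hom_on (adjoin S w) \<chi>' \<and> (\<forall>s\<in>S. \<chi>' s = \<chi> s) \<and> \<chi>' w = \<tau>} = d \<and>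
      (\<forall>\<chi>'. hom_on (adjoin S w) \<chi>' \<and> (\<forall>s\<in>S. \<chi>' s = \<chi> s) \<longrightarrow> \<chi>' g \<noteq> 0)))"
proof -
  obtain F where F: "F \<in> polys_over S" "F \<noteq> 0" "poly F w = 0" and F': "poly (pderiv F) w \<noteq> 0"
    and F_min: "\<And>G. G \<in> polys_over S \<Longrightarrow> poly G w = 0 \<Longrightarrow> degree G < degree F \<Longrightarrow> G = 0"
    using minimal_relation[OF assms] by metis
  note A = adjoin_subring[of w]
  have lS: "lead_coeff F \<in> S" using F by (auto simp: polys_over_def)
  show ?thesis
  proof (intro exI[of _ "degree F"] ballI impI)
    fix g assume g: "g \<in> adjoin S w" "g \<noteq> 0"
    let ?g = "g * poly (pderiv F) w"
    have F'A: "poly (pderiv F) w \<in> adjoin S w" unfolding adjoin_def using polys_over_pderiv[OF F(1)] by blast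
    have "?g \<in> adjoin S w" "?g \<noteq> 0" using g F' F'A by (auto intro: subring_mult[OF A])
    then obtain h1 v where h1: "h1 \<in> S" "h1 \<noteq> 0" "v \<in> adjoin S w" "h1 = ?g * v"
      using nonzero_divides_base[OF F F_min] by blast
    show "\<exists>h\<in>S. h \<noteq> 0 \<and> (\<forall>\<chi> :: 'a \<Rightarrow> complex. hom_on S \<chi> \<longrightarrow> \<chi> h \<noteq> 0 \<longrightarrow>
      finite {\<tau>. \<exists>\<chi>'. hom_on (adjoin S w) \<chi>' \<and> (\<forall>s\<in>S. \<chi>' s = \<chi> s) \<and> \<chi>' w = \<tau>} \<and>
      card {\<tau>. \<exists>\<chi>'. hom_on (adjoin S w) \<chi>' \<and> (\<forall>s\<in>S. \<chi>' s = \<chi> s) \<and> \<chi>' w = \<tau>} = degree F \<and>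
      (\<forall>\<chi>'. hom_on (adjoin S w) \<chi>' \<and> (\<forall>s\<in>S. \<chi>' s = \<chi> s) \<longrightarrow> \<chi>' g \<noteq> 0))"
    proof (intro bexI[of _ "h1 * lead_coeff F"] conjI allI impI)
      show "h1 * lead_coeff F \<in> S" "h1 * lead_coeff F \<noteq> 0"
        using h1 lS F by (auto intro: subring_mult[OF S])
      fix \<chi> :: "'a \<Rightarrow> complex" assume \<chi>: "hom_on S \<chi>" and nz: "\<chi> (h1 * lead_coeff F) \<noteq> 0"
      let ?T = "{\<tau>. \<exists>\<chi>'. hom_on (adjoin S w) \<chi>' \<and> (\<forall>s\<in>S. \<chi>' s = \<chi> s) \<and> \<chi>' w = \<tau>}"
      have nz': "\<chi> h1 \<noteq> 0" "\<chi> (lead_coeff F) \<noteq> 0"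
        using nz hom_on_mult[OF S \<chi> h1(1) lS] by auto
      have ext_nz: "\<chi>' g \<noteq> 0 \<and> \<chi>' (poly (pderiv F) w) \<noteq> 0"
        if "hom_on (adjoin S w) \<chi>'" "\<forall>s\<in>S. \<chi>' s = \<chi> s" for \<chi>'
      proof -
        have "\<chi>' h1 = \<chi>' g * \<chi>' (poly (pderiv F) w) * \<chi>' v"
          unfolding h1(4) using that(1) g h1(3) F'A by (simp add: hom_on_mult[OF A] subring_mult[OF A])
        then show ?thesis using that(2) h1(1) nz'(1) by auto
      qed
      have T: "?T = {\<tau>. poly (map_poly \<chi> F) \<tau> = 0}"
        using extension_root[OF F F_min \<chi>] root_extension[OF F F_min \<chi> nz'(2)] by blast
      have lc: "poly.coeff (map_poly \<chi> F) (degree F) \<noteq> 0" using nz'(2) by (simp add: coeff_mp[OF \<chi>])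
      then have mF: "map_poly \<chi> F \<noteq> 0" by auto
      have deg: "degree (map_poly \<chi> F) = degree F"
        using le_degree[OF lc] degree_mp[OF \<chi>, of F] by simp
      have "rsquarefree (map_poly \<chi> F)"
        unfolding rsquarefree_roots
      proof (intro allI notI)
        fix \<tau> assume 1: "poly (map_poly \<chi> F) \<tau> = 0 \<and> poly (pderiv (map_poly \<chi> F)) \<tau> = 0"
        then obtain \<chi>' where \<chi>': "hom_on (adjoin S w) \<chi>'" "\<forall>s\<in>S. \<chi>' s = \<chi> s" "\<chi>' w = \<tau>"
          using root_extension[OF F F_min \<chi> nz'(2)] by blast
        have "\<chi>' (poly (pderiv F) w) = 0"
          using hom_on_poly[OF \<chi> \<chi>'(1) _ polys_over_pderiv[OF F(1)]] \<chi>' 1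
          by (simp add: mp_pderiv[OF \<chi> F(1)])
        then show False using ext_nz \<chi>' by blast
      qed
      then show "card ?T = degree F"
        unfolding T using rsquarefree_card_degree[OF mF] deg by simp
      show "finite ?T" unfolding T by (rule poly_roots_finite[OF mF])
      show "\<chi>' g \<noteq> 0" if "hom_on (adjoin S w) \<chi>' \<and> (\<forall>s\<in>S. \<chi>' s = \<chi> s)" for \<chi>'
        using ext_nz that by blast
    qed
  qed
qed

end

inductive_set subring_gen :: "'a::comm_ring_1 set \<Rightarrow> 'a set \<Rightarrow> 'a set" for S Z where
  base: "s \<in> S \<Longrightarrow> s \<in> subring_gen S Z"
| gen: "z \<in> Z \<Longrightarrow> z \<in> subring_gen S Z"
| diff: "x \<in> subring_gen S Z \<Longrightarrow> y \<in> subring_gen S Z \<Longrightarrow> x - y \<in> subring_gen S Z"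
| mult: "x \<in> subring_gen S Z \<Longrightarrow> y \<in> subring_gen S Z \<Longrightarrow> x * y \<in> subring_gen S Z"

lemma subring_gen_subring: "is_subring S \<Longrightarrow> is_subring (subring_gen S Z)"
  by (auto simp: is_subring_def intro: subring_gen.intros)

lemma subring_gen_empty: "is_subring S \<Longrightarrow> subring_gen S {} = S"
proof
  assume S: "is_subring S"
  show "subring_gen S {} \<subseteq> S"
  proof
    fix x assume "x \<in> subring_gen S {}"
    then show "x \<in> S" by induction (auto intro: subring_closed[OF S])
  qed
qed (auto intro: subring_gen.base)

lemma adjoin_subring_gen:
  fixes S :: "'a::{idom,ring_char_0} set"
  assumes S: "is_subring S"
  shows "adjoin (subring_gen S Z) w = subring_gen S (insert w Z)"
proof
  note G = subring_gen_subring[OF S]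
  have sub: "subring_gen S Z \<subseteq> subring_gen S (insert w Z)"
  proof
    fix x assume "x \<in> subring_gen S Z"
    then show "x \<in> subring_gen S (insert w Z)" by induction (auto intro: subring_gen.intros)
  qed
  show "adjoin (subring_gen S Z) w \<subseteq> subring_gen S (insert w Z)"
  proof
    fix x assume "x \<in> adjoin (subring_gen S Z) w"
    then obtain p where p: "\<And>i. poly.coeff p i \<in> subring_gen S (insert w Z)" "x = poly p w"
      using sub unfolding adjoin_def polys_over_def by blast
    have "w \<in> subring_gen S (insert w Z)" by (rule subring_gen.gen) simp
    then show "x \<in> subring_gen S (insert w Z)"
      unfolding p(2) poly_altdef by (intro subring_sum[OF G] subring_mult[OF G] subring_power[OF G] p(1))
  qed
  show "subring_gen S (insert w Z) \<subseteq> adjoin (subring_gen S Z) w"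
  proof
    fix x assume "x \<in> subring_gen S (insert w Z)"
    then show "x \<in> adjoin (subring_gen S Z) w"
      by induction (auto intro: adjoin_gen[OF G] adjoin_base[OF G] subring_gen.base subring_gen.gen
          subring_closed[OF adjoin_subring[OF G]])
  qed
qed

lemma hom_on_subring_gen_eq:
  assumes S: "is_subring S" and h: "hom_on (subring_gen S Z) \<chi>" "hom_on (subring_gen S Z) \<chi>'"
    and eq: "\<And>s. s \<in> S \<Longrightarrow> \<chi> s = \<chi>' s" "\<And>z. z \<in> Z \<Longrightarrow> \<chi> z = \<chi>' z"
    and x: "x \<in> subring_gen S Z"
  shows "\<chi> x = \<chi>' x"
  using x
proof induction
  note G = subring_gen_subring[OF S]
  case (diff x y) then show ?case by (simp add: hom_on_diff[OF G h(1)] hom_on_diff[OF G h(2)])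
next
  note G = subring_gen_subring[OF S]
  case (mult x y) then show ?case by (simp add: hom_on_mult[OF G h(1)] hom_on_mult[OF G h(2)])
qed (use eq in auto)

text \<open>
  The extensions of \<open>\<chi>\<close> to the ring generated by the \<open>z c\<close>, each recorded by its values on
  the generators.
\<close>
definition extension_points ::
    "'a::comm_ring_1 set \<Rightarrow> ('c \<Rightarrow> 'a) \<Rightarrow> 'c set \<Rightarrow> ('a \<Rightarrow> complex) \<Rightarrow> ('c \<Rightarrow> complex) set" where
  "extension_points S z C \<chi> = {a \<in> C \<rightarrow>\<^sub>E UNIV. \<exists>\<chi>'. hom_on (subring_gen S (z ` C)) \<chi>' \<and>
     (\<forall>s\<in>S. \<chi>' s = \<chi> s) \<and> (\<forall>c\<in>C. \<chi>' (z c) = a c)}"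

lemma hom_on_subset: "hom_on S \<chi> \<Longrightarrow> S' \<subseteq> S \<Longrightarrow> hom_on S' \<chi>"
  unfolding hom_on_def by blast

text \<open>
  Extending to one more generator means to extend first to the old generators, and then from
  there; \<open>E a\<close> is the extension recorded by \<open>a\<close>.
\<close>
lemma extension_points_insert:
  fixes S :: "'a::{idom,ring_char_0} set"
  assumes S: "is_subring S" and c: "c \<notin> C"
    and E: "\<And>a. a \<in> extension_points S z C \<chi> \<Longrightarrow> hom_on (subring_gen S (z ` C)) (E a) \<and>
      (\<forall>s\<in>S. E a s = \<chi> s) \<and> (\<forall>c\<in>C. E a (z c) = a c)"
  shows "bij_betw (\<lambda>(a, \<tau>). a(c := \<tau>))
    (SIGMA a:extension_points S z C \<chi>. {\<tau>. \<exists>\<chi>'. hom_on (adjoin (subring_gen S (z ` C)) (z c)) \<chi>' \<and>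
       (\<forall>s\<in>subring_gen S (z ` C). \<chi>' s = E a s) \<and> \<chi>' (z c) = \<tau>})
    (extension_points S z (insert c C) \<chi>)"
proof -
  let ?S1 = "subring_gen S (z ` C)" and ?S2 = "subring_gen S (z ` insert c C)"
  have S2: "adjoin ?S1 (z c) = ?S2" using adjoin_subring_gen[OF S, of "z ` C" "z c"] by simp
  have sub: "?S1 \<subseteq> ?S2" unfolding S2[symmetric] using adjoin_base[OF subring_gen_subring[OF S]] by blast
  show ?thesis unfolding bij_betw_def S2
  proof
    show "inj_on (\<lambda>(a, \<tau>). a(c := \<tau>)) (SIGMA a:extension_points S z C \<chi>. {\<tau>. \<exists>\<chi>'. hom_on ?S2 \<chi>' \<and>
       (\<forall>s\<in>?S1. \<chi>' s = E a s) \<and> \<chi>' (z c) = \<tau>})"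
      (is "inj_on _ ?D")
    proof (rule inj_onI)
      fix p q assume pq: "p \<in> ?D" "q \<in> ?D" and "(\<lambda>(a, \<tau>). a(c := \<tau>)) p = (\<lambda>(a, \<tau>). a(c := \<tau>)) q"
      then have eq: "(fst p)(c := snd p) = (fst q)(c := snd q)" by (simp add: case_prod_beta)
      have "fst p \<in> extension_points S z C \<chi>" by (rule SigmaE[OF pq(1)]) simp
      moreover have "fst q \<in> extension_points S z C \<chi>" by (rule SigmaE[OF pq(2)]) simp
      ultimately have "fst p \<in> C \<rightarrow>\<^sub>E UNIV" "fst q \<in> C \<rightarrow>\<^sub>E UNIV"
        unfolding extension_points_def by blast+
      then have "fst p c = fst q c" using PiE_arb[OF _ c] by metis
      moreover have "fst p x = fst q x" if "x \<noteq> c" for x using fun_cong[OF eq, of x] that by simp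
      ultimately have "fst p = fst q" by (metis ext)
      moreover have "snd p = snd q" using fun_cong[OF eq, of c] by simp
      ultimately show "p = q" by (rule prod_eqI)
    qed
    show "(\<lambda>(a, \<tau>). a(c := \<tau>)) ` (SIGMA a:extension_points S z C \<chi>. {\<tau>. \<exists>\<chi>'. hom_on ?S2 \<chi>' \<and>
       (\<forall>s\<in>?S1. \<chi>' s = E a s) \<and> \<chi>' (z c) = \<tau>}) = extension_points S z (insert c C) \<chi>" (is "_ ` ?D = ?R")
    proof (intro equalityI subsetI)
      fix b assume "b \<in> (\<lambda>(a, \<tau>). a(c := \<tau>)) ` ?D"
      then obtain q where q: "b = (\<lambda>(a, \<tau>). a(c := \<tau>)) q" "q \<in> ?D" by (rule imageE)
      from q(2) obtain a \<tau> where a\<tau>: "a \<in> extension_points S z C \<chi>" "q = (a, \<tau>)"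
        "\<tau> \<in> {\<tau>. \<exists>\<chi>'. hom_on ?S2 \<chi>' \<and> (\<forall>s\<in>?S1. \<chi>' s = E a s) \<and> \<chi>' (z c) = \<tau>}" by (rule SigmaE)
      then obtain \<chi>' where a: "a \<in> extension_points S z C \<chi>" "hom_on ?S2 \<chi>'"
        "\<forall>s\<in>?S1. \<chi>' s = E a s" "b = a(c := \<chi>' (z c))" using q(1) by auto
      have "b \<in> insert c C \<rightarrow>\<^sub>E UNIV"
        using a(1,4) by (auto simp: extension_points_def PiE_def extensional_def)
      moreover have "\<forall>s\<in>S. \<chi>' s = \<chi> s" using a(3) E[OF a(1)] subring_gen.base by metis
      moreover have "\<chi>' (z x) = b x" if "x \<in> insert c C" for x
      proof (cases "x = c")
        case False
        then have "x \<in> C" using that by simp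
        then have "\<chi>' (z x) = E a (z x)" using a(3) by (auto intro: subring_gen.gen)
        then show ?thesis using E[OF a(1)] \<open>x \<in> C\<close> False a(4) by simp
      qed (use a in simp)
      ultimately show "b \<in> ?R" using a(2) unfolding extension_points_def by blast
    next
      fix b assume b: "b \<in> ?R"
      then obtain \<chi>' where \<chi>': "hom_on ?S2 \<chi>'" "\<forall>s\<in>S. \<chi>' s = \<chi> s" "\<forall>x\<in>insert c C. \<chi>' (z x) = b x"
        unfolding extension_points_def by blast
      define a where "a = restrict b C"
      have a: "a \<in> extension_points S z C \<chi>"
        unfolding extension_points_def a_def using \<chi>' hom_on_subset[OF \<chi>'(1) sub]
        by (intro CollectI conjI exI[of _ \<chi>']) auto
      have ac: "x \<in> C \<Longrightarrow> a x = b x" for x by (simp add: a_def)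
      have "\<chi>' s = E a s" if "s \<in> ?S1" for s
        by (rule hom_on_subring_gen_eq[OF S hom_on_subset[OF \<chi>'(1) sub] _ _ _ that])
          (use E[OF a] \<chi>' ac in auto)
      moreover have "b = a(c := \<chi>' (z c))"
        using b \<chi>'(3) by (auto simp: a_def extension_points_def fun_eq_iff PiE_def extensional_def)
      ultimately show "b \<in> (\<lambda>(a, \<tau>). a(c := \<tau>)) ` ?D" using a \<chi>'(1) by (intro image_eqI[of _ _ "(a, \<chi>' (z c))"]) auto
    qed
  qed
qed

text \<open>
  Adjoin the generators one after the other. The element \<open>h\<close> is found downwards: the condition
  on the extension to all generators becomes a condition on the extension to one generator less.
\<close>
lemma extension_points_count:
  fixes S :: "'a::{idom,ring_char_0} set"
  assumes S: "is_subring S" and "finite C" and "\<And>c. c \<in> C \<Longrightarrow> algebraic_over S (z c)"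
  shows "\<exists>d. \<forall>g\<in>subring_gen S (z ` C). g \<noteq> 0 \<longrightarrow> (\<exists>h\<in>S. h \<noteq> 0 \<and>
    (\<forall>\<chi> :: 'a \<Rightarrow> complex. hom_on S \<chi> \<longrightarrow> \<chi> h \<noteq> 0 \<longrightarrow>
      finite (extension_points S z C \<chi>) \<and> card (extension_points S z C \<chi>) = d \<and>
      (\<forall>\<chi>'. hom_on (subring_gen S (z ` C)) \<chi>' \<and> (\<forall>s\<in>S. \<chi>' s = \<chi> s) \<longrightarrow> \<chi>' g \<noteq> 0)))"
  using assms(2,3)
proof (induction C)
  case empty
  show ?case
  proof (intro exI[of _ 1] ballI impI)
    fix g assume g: "g \<in> subring_gen S (z ` {})" "g \<noteq> 0"
    have "extension_points S z {} \<chi> = {\<lambda>_. undefined}" if "hom_on S \<chi>" for \<chi>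
      using that by (auto simp: extension_points_def subring_gen_empty[OF S])
    with g show "\<exists>h\<in>S. h \<noteq> 0 \<and> (\<forall>\<chi> :: 'a \<Rightarrow> complex. hom_on S \<chi> \<longrightarrow> \<chi> h \<noteq> 0 \<longrightarrow>
      finite (extension_points S z {} \<chi>) \<and> card (extension_points S z {} \<chi>) = 1 \<and>
      (\<forall>\<chi>'. hom_on (subring_gen S (z ` {})) \<chi>' \<and> (\<forall>s\<in>S. \<chi>' s = \<chi> s) \<longrightarrow> \<chi>' g \<noteq> 0))"
      by (intro bexI[of _ g]) (auto simp: subring_gen_empty[OF S])
  qed
next
  case (insert c C)
  let ?S1 = "subring_gen S (z ` C)" and ?S2 = "subring_gen S (z ` insert c C)"
  note S1 = subring_gen_subring[OF S, of "z ` C"]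
  have S2: "adjoin ?S1 (z c) = ?S2" using adjoin_subring_gen[OF S, of "z ` C" "z c"] by simp
  have sub: "?S1 \<subseteq> ?S2" unfolding S2[symmetric] using adjoin_base[OF S1] by blast
  have "algebraic_over ?S1 (z c)"
    using insert.prems[of c] subring_gen.base unfolding algebraic_over_def polys_over_def by blast
  from extension_count[OF S1 this] obtain d2 where d2:
    "\<And>g. g \<in> ?S2 \<Longrightarrow> g \<noteq> 0 \<Longrightarrow> \<exists>h\<in>?S1. h \<noteq> 0 \<and> (\<forall>\<chi> :: 'a \<Rightarrow> complex. hom_on ?S1 \<chi> \<longrightarrow> \<chi> h \<noteq> 0 \<longrightarrow>
      finite {\<tau>. \<exists>\<chi>'. hom_on ?S2 \<chi>' \<and> (\<forall>s\<in>?S1. \<chi>' s = \<chi> s) \<and> \<chi>' (z c) = \<tau>} \<and>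
      card {\<tau>. \<exists>\<chi>'. hom_on ?S2 \<chi>' \<and> (\<forall>s\<in>?S1. \<chi>' s = \<chi> s) \<and> \<chi>' (z c) = \<tau>} = d2 \<and>
      (\<forall>\<chi>'. hom_on ?S2 \<chi>' \<and> (\<forall>s\<in>?S1. \<chi>' s = \<chi> s) \<longrightarrow> \<chi>' g \<noteq> 0))"
    unfolding S2 by blast
  obtain d1 where d1: "\<And>g. g \<in> ?S1 \<Longrightarrow> g \<noteq> 0 \<Longrightarrow> \<exists>h\<in>S. h \<noteq> 0 \<and>
    (\<forall>\<chi> :: 'a \<Rightarrow> complex. hom_on S \<chi> \<longrightarrow> \<chi> h \<noteq> 0 \<longrightarrow>
      finite (extension_points S z C \<chi>) \<and> card (extension_points S z C \<chi>) = d1 \<and>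
      (\<forall>\<chi>'. hom_on ?S1 \<chi>' \<and> (\<forall>s\<in>S. \<chi>' s = \<chi> s) \<longrightarrow> \<chi>' g \<noteq> 0))"
    using insert.IH insert.prems by blast
  show ?case
  proof (intro exI[of _ "d1 * d2"] ballI impI)
    fix g assume g: "g \<in> ?S2" "g \<noteq> 0"
    obtain h1 where h1: "h1 \<in> ?S1" "h1 \<noteq> 0" and fib: "\<And>\<chi> :: 'a \<Rightarrow> complex. hom_on ?S1 \<chi> \<Longrightarrow> \<chi> h1 \<noteq> 0 \<Longrightarrow>
      finite {\<tau>. \<exists>\<chi>'. hom_on ?S2 \<chi>' \<and> (\<forall>s\<in>?S1. \<chi>' s = \<chi> s) \<and> \<chi>' (z c) = \<tau>} \<and>
      card {\<tau>. \<exists>\<chi>'. hom_on ?S2 \<chi>' \<and> (\<forall>s\<in>?S1. \<chi>' s = \<chi> s) \<and> \<chi>' (z c) = \<tau>} = d2 \<and>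
      (\<forall>\<chi>'. hom_on ?S2 \<chi>' \<and> (\<forall>s\<in>?S1. \<chi>' s = \<chi> s) \<longrightarrow> \<chi>' g \<noteq> 0)"
      using d2[OF g] by blast
    obtain h where h: "h \<in> S" "h \<noteq> 0" and bas: "\<And>\<chi> :: 'a \<Rightarrow> complex. hom_on S \<chi> \<Longrightarrow> \<chi> h \<noteq> 0 \<Longrightarrow>
      finite (extension_points S z C \<chi>) \<and> card (extension_points S z C \<chi>) = d1 \<and>
      (\<forall>\<chi>'. hom_on ?S1 \<chi>' \<and> (\<forall>s\<in>S. \<chi>' s = \<chi> s) \<longrightarrow> \<chi>' h1 \<noteq> 0)"
      using d1[OF h1] by blast
    show "\<exists>h\<in>S. h \<noteq> 0 \<and> (\<forall>\<chi> :: 'a \<Rightarrow> complex. hom_on S \<chi> \<longrightarrow> \<chi> h \<noteq> 0 \<longrightarrow>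
      finite (extension_points S z (insert c C) \<chi>) \<and> card (extension_points S z (insert c C) \<chi>) = d1 * d2 \<and>
      (\<forall>\<chi>'. hom_on ?S2 \<chi>' \<and> (\<forall>s\<in>S. \<chi>' s = \<chi> s) \<longrightarrow> \<chi>' g \<noteq> 0))"
    proof (intro bexI[of _ h] conjI allI impI h)
      fix \<chi> :: "'a \<Rightarrow> complex" assume \<chi>: "hom_on S \<chi>" "\<chi> h \<noteq> 0"
      note b = bas[OF \<chi>]
      define E where "E a = (SOME \<chi>'. hom_on ?S1 \<chi>' \<and> (\<forall>s\<in>S. \<chi>' s = \<chi> s) \<and> (\<forall>c\<in>C. \<chi>' (z c) = a c))" for a
      have E: "hom_on ?S1 (E a) \<and> (\<forall>s\<in>S. E a s = \<chi> s) \<and> (\<forall>c\<in>C. E a (z c) = a c)"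
        if "a \<in> extension_points S z C \<chi>" for a
      proof -
        have "\<exists>\<chi>'. hom_on ?S1 \<chi>' \<and> (\<forall>s\<in>S. \<chi>' s = \<chi> s) \<and> (\<forall>c\<in>C. \<chi>' (z c) = a c)"
          using that by (simp add: extension_points_def)
        from someI_ex[OF this] show ?thesis unfolding E_def .
      qed
      let ?T = "\<lambda>a. {\<tau>. \<exists>\<chi>'. hom_on ?S2 \<chi>' \<and> (\<forall>s\<in>?S1. \<chi>' s = E a s) \<and> \<chi>' (z c) = \<tau>}"
      have T: "finite (?T a) \<and> card (?T a) = d2" if "a \<in> extension_points S z C \<chi>" for a
        using fib[of "E a"] b E[OF that] by blast
      note bij = extension_points_insert[OF S insert.hyps(2) E, unfolded S2]
      have fin: "finite (Sigma (extension_points S z C \<chi>) ?T)" using T b by (intro finite_SigmaI) auto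
      show "finite (extension_points S z (insert c C) \<chi>)"
        using bij_betw_finite[OF bij] fin by simp
      have "card (extension_points S z (insert c C) \<chi>) = card (Sigma (extension_points S z C \<chi>) ?T)"
        using bij_betw_same_card[OF bij] by simp
      also have "\<dots> = (\<Sum>a\<in>extension_points S z C \<chi>. card (?T a))"
        using b T by (intro card_SigmaI) auto
      also have "\<dots> = d1 * d2" using T b by simp
      finally show "card (extension_points S z (insert c C) \<chi>) = d1 * d2" .
    next
      fix \<chi> \<chi>' :: "'a \<Rightarrow> complex" assume \<chi>: "hom_on S \<chi>" "\<chi> h \<noteq> 0"
        and \<chi>': "hom_on ?S2 \<chi>' \<and> (\<forall>s\<in>S. \<chi>' s = \<chi> s)"
      have 1: "hom_on ?S1 \<chi>'" using hom_on_subset \<chi>' sub by blast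
      then have "\<chi>' h1 \<noteq> 0" using bas[OF \<chi>] \<chi>' by blast
      then show "\<chi>' g \<noteq> 0" using fib[OF 1] \<chi>' by blast
    qed
  qed
qed

section \<open>Algebraic dependence\<close>

text \<open>
  Gaussian elimination: one equation is used to eliminate one unknown \<open>e0\<close>.
\<close>
lemma underdetermined_system:
  fixes a :: "'e \<Rightarrow> 'm \<Rightarrow> 'f::field"
  assumes "finite M" "finite E" "card M < card E"
  shows "\<exists>c. (\<exists>e\<in>E. c e \<noteq> 0) \<and> (\<forall>m\<in>M. (\<Sum>e\<in>E. c e * a e m) = 0)"
  using assms
proof (induction M arbitrary: E a)
  case empty
  then obtain e where "e \<in> E" by fastforce
  then show ?case by (intro exI[of _ "\<lambda>_. 1"]) auto
next
  case (insert m M)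
  show ?case
  proof (cases "\<forall>e\<in>E. a e m = 0")
    case True
    have "card M < card E" using insert by simp
    from insert.IH[OF insert.prems(1) this, of a] True show ?thesis by auto
  next
    case False
    then obtain e0 where e0: "e0 \<in> E" "a e0 m \<noteq> 0" by blast
    let ?E = "E - {e0}"
    have "card M < card ?E" using insert e0 by simp
    from insert.IH[OF _ this, of "\<lambda>e k. a e k - a e m / a e0 m * a e0 k"] insert.prems(1)
    obtain c where c: "\<exists>e\<in>?E. c e \<noteq> 0"
      "\<And>k. k \<in> M \<Longrightarrow> (\<Sum>e\<in>?E. c e * (a e k - a e m / a e0 m * a e0 k)) = 0" by auto
    define c' where "c' = c(e0 := - (\<Sum>e\<in>?E. c e * (a e m / a e0 m)))"
    have split: "(\<Sum>e\<in>E. c' e * a e k) = c' e0 * a e0 k + (\<Sum>e\<in>?E. c e * a e k)" for k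
    proof -
      have "(\<Sum>e\<in>E. c' e * a e k) = c' e0 * a e0 k + (\<Sum>e\<in>?E. c' e * a e k)"
        using insert.prems(1) e0(1) by (rule sum.remove)
      also have "(\<Sum>e\<in>?E. c' e * a e k) = (\<Sum>e\<in>?E. c e * a e k)"
        by (rule sum.cong) (auto simp: c'_def)
      finally show ?thesis .
    qed
    have "(\<Sum>e\<in>E. c' e * a e k) = (\<Sum>e\<in>?E. c e * (a e k - a e m / a e0 m * a e0 k))" for k
      unfolding split by (simp add: c'_def sum_distrib_right sum_distrib_left sum_subtractf algebra_simps)
    moreover have "(\<Sum>e\<in>?E. c e * (a e m - a e m / a e0 m * a e0 m)) = 0" using e0 by simp
    ultimately have "\<forall>k\<in>insert m M. (\<Sum>e\<in>E. c' e * a e k) = 0" using c(2) by auto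
    moreover have "\<exists>e\<in>E. c' e \<noteq> 0" using c(1) by (auto simp: c'_def)
    ultimately show ?thesis by blast
  qed
qed

definition monomials :: "'x set \<Rightarrow> nat \<Rightarrow> ('x \<Rightarrow>\<^sub>0 nat) set" where
  "monomials X N = {m. Poly_Mapping.keys m \<subseteq> X \<and> (\<forall>x. Poly_Mapping.lookup m x \<le> N)}"

lemma bij_betw_monomials:
  assumes "finite X"
  shows "bij_betw (\<lambda>m. restrict (Poly_Mapping.lookup m) X) (monomials X N) (X \<rightarrow>\<^sub>E {..N})"
  unfolding bij_betw_def
proof
  show "inj_on (\<lambda>m. restrict (Poly_Mapping.lookup m) X) (monomials X N)"
  proof (rule inj_onI, rule poly_mapping_eqI)
    fix m m' x assume 1: "m \<in> monomials X N" "m' \<in> monomials X N"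
      and eq: "restrict (Poly_Mapping.lookup m) X = restrict (Poly_Mapping.lookup m') X"
    show "Poly_Mapping.lookup m x = Poly_Mapping.lookup m' x"
    proof (cases "x \<in> X")
      case True then show ?thesis using fun_cong[OF eq, of x] by simp
    next
      case False
      then have "x \<notin> Poly_Mapping.keys m" "x \<notin> Poly_Mapping.keys m'" using 1 by (auto simp: monomials_def)
      then show ?thesis by (simp add: in_keys_iff)
    qed
  qed
  show "(\<lambda>m. restrict (Poly_Mapping.lookup m) X) ` monomials X N = X \<rightarrow>\<^sub>E {..N}"
  proof (intro equalityI subsetI)
    fix g assume g: "g \<in> X \<rightarrow>\<^sub>E {..N}"
    let ?m = "\<Sum>x\<in>X. Poly_Mapping.single x (g x)"
    have l: "Poly_Mapping.lookup ?m y = (if y \<in> X then g y else 0)" for y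
      using assms by (simp add: lookup_sum lookup_single when_def)
    have "Poly_Mapping.keys ?m \<subseteq> X" using l by (metis in_keys_iff subsetI)
    moreover have "Poly_Mapping.lookup ?m y \<le> N" for y unfolding l using g by auto
    ultimately have "?m \<in> monomials X N" by (simp add: monomials_def)
    moreover have "g = restrict (Poly_Mapping.lookup ?m) X"
      using g by (auto simp: l fun_eq_iff PiE_def extensional_def)
    ultimately show "g \<in> (\<lambda>m. restrict (Poly_Mapping.lookup m) X) ` monomials X N" by blast
  qed (auto simp: monomials_def)
qed

lemma finite_monomials: "finite X \<Longrightarrow> finite (monomials X N)"
  and card_monomials: "finite X \<Longrightarrow> card (monomials X N) = Suc N ^ card X"
  using bij_betw_finite[OF bij_betw_monomials, of X N] bij_betw_same_card[OF bij_betw_monomials, of X N]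
  by (auto simp: card_PiE finite_PiE)

lemma keys_mult_monomials:
  assumes "Poly_Mapping.keys f \<subseteq> monomials X N" "Poly_Mapping.keys g \<subseteq> monomials X N'"
  shows "Poly_Mapping.keys (f * g) \<subseteq> monomials X (N + N')"
proof
  fix m assume "m \<in> Poly_Mapping.keys (f * g)"
  then obtain k l where kl: "k \<in> Poly_Mapping.keys f" "l \<in> Poly_Mapping.keys g" "m = k + l"
    using keys_mult[of f g] by blast
  then have "k \<in> monomials X N" "l \<in> monomials X N'" using assms by blast+
  then show "m \<in> monomials X (N + N')"
    using keys_add[of k l] by (auto simp: monomials_def kl(3) lookup_add intro: add_mono)
qed

lemma keys_one_monomials: "Poly_Mapping.keys (1 :: 'x mpoly) \<subseteq> monomials X N"
  by (auto simp: monomials_def)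

lemma keys_power_monomials:
  "Poly_Mapping.keys (f :: 'x mpoly) \<subseteq> monomials X N \<Longrightarrow> Poly_Mapping.keys (f ^ k) \<subseteq> monomials X (k * N)"
  by (induction k) (use keys_one_monomials keys_mult_monomials[of f X N] in auto)

lemma keys_prod_monomials:
  assumes "finite W" "\<And>w. w \<in> W \<Longrightarrow> Poly_Mapping.keys (f w :: 'x mpoly) \<subseteq> monomials X (N w)"
  shows "Poly_Mapping.keys (prod f W) \<subseteq> monomials X (sum N W)"
  using assms
proof (induction W)
  case (insert w W)
  then show ?case using keys_mult_monomials[of "f w" X "N w" "prod f W" "sum N W"] by simp
qed (simp add: keys_one_monomials del: keys_one)

lemma monomials_mono: "N \<le> N' \<Longrightarrow> monomials X N \<subseteq> monomials X N'"
  by (auto simp: monomials_def intro: order_trans)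

lemma poly_ring_monomials:
  assumes "f \<in> poly_ring X" shows "\<exists>N. Poly_Mapping.keys f \<subseteq> monomials X N"
proof -
  let ?S = "\<Union>m\<in>Poly_Mapping.keys f. Poly_Mapping.range m"
  have fin: "finite ?S" by auto
  have "m \<in> monomials X (Max (insert 0 ?S))" if m: "m \<in> Poly_Mapping.keys f" for m
    unfolding monomials_def
  proof (intro CollectI conjI allI)
    show "Poly_Mapping.keys m \<subseteq> X" using assms m by (auto simp: poly_ring_def)
    fix x show "Poly_Mapping.lookup m x \<le> Max (insert 0 ?S)"
    proof (cases "x \<in> Poly_Mapping.keys m")
      case True
      then have "Poly_Mapping.lookup m x \<in> ?S"
        by (intro UN_I[OF m] in_keys_lookup_in_range)
      then show ?thesis
        using fin by (intro Max_ge) (simp_all only: finite_insert insert_iff simp_thms)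
    qed (simp add: in_keys_iff)
  qed
  then show ?thesis by blast
qed

text \<open>
  The number of monomials of bounded degree in more polynomials than variables eventually exceeds the
  number of monomials in the variables that occur in them, so some combination of them is zero.
\<close>
lemma algebraic_dependence:
  fixes f :: "'w \<Rightarrow> 'x mpoly"
  assumes "finite W" "finite X" "card X < card W" and f: "\<And>w. w \<in> W \<Longrightarrow> f w \<in> poly_ring X"
  shows "\<exists>G\<in>poly_ring W. G \<noteq> 0 \<and> psubst PConst f G = 0"
proof -
  have "\<forall>w\<in>W. \<exists>N. Poly_Mapping.keys (f w) \<subseteq> monomials X N" using poly_ring_monomials f by blast
  then obtain D0 where D0: "\<And>w. w \<in> W \<Longrightarrow> Poly_Mapping.keys (f w) \<subseteq> monomials X (D0 w)" by metis
  define D where "D = sum D0 W"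
  have D: "Poly_Mapping.keys (f w) \<subseteq> monomials X D" if "w \<in> W" for w
    using D0[OF that] monomials_mono[of "D0 w" D X] member_le_sum[of w W D0] that assms(1) by (auto simp: D_def)
  define k where "k = card W"
  \<comment> \<open>There are \<open>Suc N ^ k\<close> products with exponents at most \<open>N\<close>, and their monomials have exponents at most
    \<open>k * N * D\<close>; this \<open>N\<close> makes the former outnumber the latter, because \<open>card X < k\<close>.\<close>
  define N where "N = Suc (k * D) ^ card X"
  let ?E = "monomials W N" and ?M = "monomials X (k * (N * D))"
  have prods: "Poly_Mapping.keys (mono_val f e) \<subseteq> ?M" if e: "e \<in> ?E" for e
  proof -
    have "mono_val f e = (\<Prod>w\<in>W. f w ^ Poly_Mapping.lookup e w)"
      by (rule mono_val_superset) (use e assms(1) in \<open>auto simp: monomials_def\<close>)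
    moreover have "Poly_Mapping.keys (f w ^ Poly_Mapping.lookup e w) \<subseteq> monomials X (N * D)" if "w \<in> W" for w
      using keys_power_monomials[OF D[OF that], of "Poly_Mapping.lookup e w"] e
        monomials_mono[of "Poly_Mapping.lookup e w * D" "N * D" X] by (auto simp: monomials_def)
    then have "Poly_Mapping.keys (\<Prod>w\<in>W. f w ^ Poly_Mapping.lookup e w) \<subseteq> monomials X (\<Sum>w\<in>W. N * D)"
      by (intro keys_prod_monomials assms(1))
    ultimately show ?thesis by (simp add: k_def)
  qed
  have "card ?M < card ?E"
  proof -
    have "Suc (k * (N * D)) \<le> Suc (k * D) * Suc N" by (simp add: algebra_simps)
    then have "card ?M \<le> (Suc (k * D) * Suc N) ^ card X"
      unfolding card_monomials[OF assms(2)] by (rule power_mono) simp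
    also have "\<dots> = N * Suc N ^ card X" by (simp only: power_mult_distrib N_def)
    also have "\<dots> < Suc N ^ Suc (card X)" by simp
    also have "\<dots> \<le> Suc N ^ k" using assms(3) by (intro power_increasing) (auto simp: k_def)
    finally show ?thesis by (simp add: card_monomials[OF assms(1)] k_def)
  qed
  from underdetermined_system[OF finite_monomials[OF assms(2)] finite_monomials[OF assms(1)] this,
      of "\<lambda>e m. Poly_Mapping.lookup (mono_val f e) m"]
  obtain c where c: "\<exists>e\<in>?E. c e \<noteq> 0"
    "\<And>m. m \<in> ?M \<Longrightarrow> (\<Sum>e\<in>?E. c e * Poly_Mapping.lookup (mono_val f e) m) = 0" by auto
  define G where "G = (\<Sum>e\<in>?E. Poly_Mapping.single e (c e))"
  interpret H: comm_ring_hom "psubst PConst f" by (rule psubst_hom[OF comm_ring_hom_PConst])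
  have lG: "Poly_Mapping.lookup G e = (if e \<in> ?E then c e else 0)" for e
    using finite_monomials[OF assms(1)] by (simp add: G_def lookup_sum lookup_single when_def)
  have "G \<noteq> 0" using c(1) lG by (metis lookup_zero)
  moreover have "G \<in> poly_ring W"
    unfolding poly_ring_def
  proof (intro CollectI ballI)
    fix e assume "e \<in> Poly_Mapping.keys G"
    then have "e \<in> ?E" using lG[of e] by (auto simp: in_keys_iff split: if_splits)
    then show "Poly_Mapping.keys e \<subseteq> W" by (simp add: monomials_def)
  qed
  moreover have "psubst PConst f G = 0"
  proof (rule poly_mapping_eqI)
    fix m
    have "psubst PConst f G = (\<Sum>e\<in>?E. PConst (c e) * mono_val f e)"
      by (simp add: G_def H.hom_sum psubst_single)
    then have "Poly_Mapping.lookup (psubst PConst f G) m = (\<Sum>e\<in>?E. c e * Poly_Mapping.lookup (mono_val f e) m)"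
      by (simp add: lookup_sum PConst_def flip: mult_map_scale_conv_mult)
        (auto simp add: Poly_Mapping.map.rep_eq when_def intro!: sum.cong)
    also have "\<dots> = 0"
    proof (cases "m \<in> ?M")
      case False
      then have "Poly_Mapping.lookup (mono_val f e) m = 0" if "e \<in> ?E" for e
        using prods[OF that] by (auto simp: in_keys_iff)
      then show ?thesis by simp
    qed (rule c(2))
    finally show "Poly_Mapping.lookup (psubst PConst f G) m = Poly_Mapping.lookup 0 m" by simp
  qed
  ultimately show ?thesis by blast
qed

lemma comm_ring_hom_poly_map:
  assumes "comm_ring_hom \<rho>"
  shows "comm_ring_hom (\<lambda>p. poly (map_poly \<rho> p) x)"
proof -
  interpret \<rho>: comm_ring_hom \<rho> by fact
  interpret m: map_poly_comm_ring_hom \<rho> ..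
  show ?thesis by unfold_locales (auto simp: hom_distribs)
qed

lemma map_poly_const:
  fixes f :: "'a::zero \<Rightarrow> 'b::zero" assumes "f 0 = 0" shows "map_poly f [:c:] = [:f c:]"
  by (rule poly_eqI) (auto simp: coeff_map_poly coeff_pCons assms split: nat.splits)

text \<open>
  A relation between \<open>z\<close> and the \<open>y v\<close>, read as a polynomial in \<open>z\<close>, does not have all coefficients zero, as
  the \<open>y v\<close> are independent. The variable for \<open>z\<close> is \<open>None\<close>.
\<close>
lemma algebraic_over_independent:
  fixes y :: "'r::linorder \<Rightarrow> 't::linorder mpoly"
  assumes fin: "finite R" "finite T" "card T \<le> card R"
    and y: "\<And>v. v \<in> R \<Longrightarrow> y v \<in> poly_ring T" and z: "z \<in> poly_ring T"
    and indep: "\<And>h. h \<in> poly_ring R \<Longrightarrow> psubst PConst y h = 0 \<Longrightarrow> h = 0"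
  shows "algebraic_over (psubst PConst y ` poly_ring R) z"
proof -
  let ?W = "insert None (Some ` R)"
  define f where "f w = (case w of None \<Rightarrow> z | Some v \<Rightarrow> y v)" for w
  have "card ?W = Suc (card R)" using fin by (simp add: card_image)
  then obtain G where G: "G \<in> poly_ring ?W" "G \<noteq> 0" "psubst PConst f G = 0"
  proof -
    have "finite ?W" "card T < card ?W" using fin \<open>card ?W = Suc (card R)\<close> by auto
    moreover have "f w \<in> poly_ring T" if "w \<in> ?W" for w using that y z by (auto simp: f_def)
    ultimately show ?thesis using algebraic_dependence[of ?W T f] fin(2) that by blast
  qed
  define P where "P = psubst (\<lambda>c. [:PConst c:]) (\<lambda>w. case w of None \<Rightarrow> [:0, 1:] | Some v \<Rightarrow> [:PVar v:]) G"
  have PR: "P \<in> polys_over (poly_ring R)"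
    unfolding P_def
    by (rule psubst_in_subring[OF polys_over_subring[OF is_subring_poly_ring] G(1)])
       (auto intro!: polys_over_const[OF is_subring_poly_ring] polys_over_X[OF is_subring_poly_ring])
  have sub: "poly (map_poly \<rho> P) x = psubst (\<lambda>c. \<rho> (PConst c)) (\<lambda>w. case w of None \<Rightarrow> x | Some v \<Rightarrow> \<rho> (PVar v)) G"
    if \<rho>: "comm_ring_hom \<rho>" for \<rho> :: "'r mpoly \<Rightarrow> 'b::comm_ring_1" and x
  proof -
    interpret \<rho>: comm_ring_hom \<rho> by fact
    interpret H: comm_ring_hom "\<lambda>p. poly (map_poly \<rho> p) x" by (rule comm_ring_hom_poly_map[OF \<rho>])
    have "poly (map_poly \<rho> P) x = psubst (\<lambda>c. poly (map_poly \<rho> [:PConst c:]) x)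
      (\<lambda>w. poly (map_poly \<rho> (case w of None \<Rightarrow> [:0, 1:] | Some v \<Rightarrow> [:PVar v:])) x) G"
      unfolding P_def by (rule H.hom_psubst)
    also have "\<dots> = psubst (\<lambda>c. \<rho> (PConst c)) (\<lambda>w. case w of None \<Rightarrow> x | Some v \<Rightarrow> \<rho> (PVar v)) G"
      by (intro arg_cong2[where f = "\<lambda>h x. psubst h x G"] ext) (auto split: option.split simp: map_poly_pCons map_poly_const)
    finally show ?thesis .
  qed
  have "P \<noteq> 0"
  proof
    assume "P = 0"
    let ?\<rho> = "psubst PConst (\<lambda>v. PVar (Some v)) :: 'r mpoly \<Rightarrow> 'r option mpoly"
    have \<rho>: "comm_ring_hom ?\<rho>" by (rule psubst_hom[OF comm_ring_hom_PConst])
    have "0 = poly (map_poly ?\<rho> P) (PVar None)" using \<open>P = 0\<close> by simp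
    also have "\<dots> = psubst PConst PVar G"
      unfolding sub[OF \<rho>]
      by (intro arg_cong2[where f = "\<lambda>h x. psubst h x G"] ext)
        (auto split: option.split simp: psubst_PConst psubst_PVar[OF comm_ring_hom_PConst])
    finally show False using G(2) by (simp add: psubst_ident)
  qed
  let ?\<rho> = "psubst PConst y"
  have \<rho>: "comm_ring_hom ?\<rho>" by (rule psubst_hom[OF comm_ring_hom_PConst])
  interpret \<rho>: comm_ring_hom ?\<rho> by (rule \<rho>)
  define Q where "Q = map_poly ?\<rho> P"
  have cQ: "poly.coeff Q i = ?\<rho> (poly.coeff P i)" for i by (simp add: Q_def coeff_map_poly)
  have "Q \<in> polys_over (?\<rho> ` poly_ring R)" using PR by (auto simp: polys_over_def cQ)
  moreover have "Q \<noteq> 0"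
  proof
    assume "Q = 0"
    then have "poly.coeff P i = 0" for i
      using indep[of "poly.coeff P i"] PR cQ[of i] by (auto simp: polys_over_def)
    then show False using \<open>P \<noteq> 0\<close> by (simp add: poly_eq_iff)
  qed
  moreover have "poly Q z = 0"
    unfolding Q_def sub[OF \<rho>] G(3)[symmetric]
    by (intro arg_cong2[where f = "\<lambda>h x. psubst h x G"] ext)
      (auto split: option.split simp: f_def psubst_PConst psubst_PVar[OF comm_ring_hom_PConst])
  ultimately show ?thesis unfolding algebraic_over_def by blast
qed

section \<open>Generic fibres of a linear projection of a parametrized variety\<close>

lemma PConst_eq_0_iff [simp]: "PConst c = 0 \<longleftrightarrow> c = 0"
  by (metis PConst.hom_zero peval_PConst)

lemma comm_ring_hom_psubst_PConst: "comm_ring_hom (psubst PConst z)"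
  by (rule psubst_hom[OF comm_ring_hom_PConst])

lemma image_subring:
  assumes "comm_ring_hom \<Phi>" shows "is_subring (\<Phi> ` poly_ring X)"
proof -
  interpret \<Phi>: comm_ring_hom \<Phi> by fact
  show ?thesis unfolding is_subring_def
  proof (intro conjI ballI)
    show "1 \<in> \<Phi> ` poly_ring X" by (rule image_eqI[of _ _ 1]) auto
    fix x y assume "x \<in> \<Phi> ` poly_ring X" "y \<in> \<Phi> ` poly_ring X"
    then obtain f g where fg: "f \<in> poly_ring X" "g \<in> poly_ring X" "x = \<Phi> f" "y = \<Phi> g" by blast
    have "x - y = \<Phi> (f - g)" "x * y = \<Phi> (f * g)"
      using fg by (simp_all add: \<Phi>.hom_minus \<Phi>.hom_mult)
    then show "x - y \<in> \<Phi> ` poly_ring X" "x * y \<in> \<Phi> ` poly_ring X"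
      by (simp_all only: imageI poly_ring_diff[OF fg(1,2)] poly_ring_mult[OF fg(1,2)])
  qed
qed

text \<open>
  A point at which the relations between the images under \<open>\<Phi>\<close> vanish is a homomorphism on these images.
\<close>
lemma induced_hom:
  assumes \<Phi>: "comm_ring_hom \<Phi>"
    and ker: "\<And>f. f \<in> poly_ring X \<Longrightarrow> \<Phi> f = 0 \<Longrightarrow> peval f a = 0"
  shows "\<exists>\<chi>. hom_on (\<Phi> ` poly_ring X) \<chi> \<and> (\<forall>f\<in>poly_ring X. \<chi> (\<Phi> f) = peval f a)"
proof -
  interpret \<Phi>: comm_ring_hom \<Phi> by fact
  define \<chi> where "\<chi> s = peval (SOME f. f \<in> poly_ring X \<and> s = \<Phi> f) a" for s
  have \<chi>: "\<chi> (\<Phi> f) = peval f a" if f: "f \<in> poly_ring X" for f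
  proof -
    let ?g = "SOME g. g \<in> poly_ring X \<and> \<Phi> f = \<Phi> g"
    have g: "?g \<in> poly_ring X \<and> \<Phi> f = \<Phi> ?g" by (rule someI[of _ f]) (use f in auto)
    then have "peval (f - ?g) a = 0"
      by (intro ker poly_ring_diff f) (auto simp: \<Phi>.hom_minus)
    then show ?thesis unfolding \<chi>_def by (simp add: peval.hom_minus)
  qed
  have "hom_on (\<Phi> ` poly_ring X) \<chi>"
    unfolding hom_on_def
  proof (intro conjI ballI)
    show "\<chi> 1 = 1" using \<chi>[of 1] by simp
    fix x y assume "x \<in> \<Phi> ` poly_ring X" "y \<in> \<Phi> ` poly_ring X"
    then obtain f g where fg: "f \<in> poly_ring X" "g \<in> poly_ring X" "x = \<Phi> f" "y = \<Phi> g" by blast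
    show "\<chi> (x + y) = \<chi> x + \<chi> y"
      using \<chi>[OF poly_ring_add[OF fg(1,2)]] \<chi>[OF fg(1)] \<chi>[OF fg(2)] fg
      by (simp add: \<Phi>.hom_add peval.hom_add)
    show "\<chi> (x * y) = \<chi> x * \<chi> y"
      using \<chi>[OF poly_ring_mult[OF fg(1,2)]] \<chi>[OF fg(1)] \<chi>[OF fg(2)] fg
      by (simp add: \<Phi>.hom_mult peval.hom_mult)
  qed
  then show ?thesis using \<chi> by blast
qed

text \<open>
  The entries of the vector \<open>A x\<close>, for \<open>x\<close> over any commutative ring.
\<close>
definition row_sums :: "'c set \<Rightarrow> ('r \<Rightarrow> 'c \<Rightarrow> int) \<Rightarrow> ('c \<Rightarrow> 'a::comm_ring_1) \<Rightarrow> 'r \<Rightarrow> 'a" where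
  "row_sums C A x v = (\<Sum>c\<in>C. of_int (A v c) * x c)"

lemma hom_row_sums: "comm_ring_hom H \<Longrightarrow> H (row_sums C A x v) = row_sums C A (\<lambda>c. H (x c)) v"
proof -
  assume "comm_ring_hom H"
  then interpret H: comm_ring_hom H .
  show ?thesis by (simp add: row_sums_def H.hom_sum H.hom_mult H.hom_of_int)
qed

lemma linear_forms_alt:
  "linear_forms R C A u = (\<lambda>v. row_sums C A PVar v - PConst (row_sums C A u v)) ` R"
  by (simp add: linear_forms_def row_sums_def)

text \<open>
  The polynomial relations between the \<open>z c\<close>: the ideal of the closure of the variety parametrized by \<open>z\<close>.
\<close>
definition vanishing_ideal :: "'c set \<Rightarrow> ('c \<Rightarrow> 't mpoly) \<Rightarrow> 'c mpoly set" where
  "vanishing_ideal C z = {f \<in> poly_ring C. psubst PConst z f = 0}"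

text \<open>
  The variety parametrized by \<open>z\<close> and its linear projection \<open>A\<close>; by \<open>dim\<close> the target has at least as
  many dimensions as there are parameters.
\<close>
locale projection =
  fixes R :: "'r::linorder set" and C :: "'c::linorder set" and T :: "'t::linorder set"
    and A :: "'r \<Rightarrow> 'c \<Rightarrow> int" and z :: "'c \<Rightarrow> 't mpoly"
  assumes finR: "finite R" and finC: "finite C" and finT: "finite T"
    and dim: "card T \<le> card R" and z: "c \<in> C \<Longrightarrow> z c \<in> poly_ring T"
begin

definition I where "I = vanishing_ideal C z"

definition eqs where "eqs u = I \<union> linear_forms R C A u"

lemma row_sums_in: "row_sums C A PVar v \<in> poly_ring C"
  unfolding row_sums_def by (auto intro!: poly_ring_closed)

lemma eqs_subset: "eqs u \<subseteq> poly_ring C"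
  unfolding eqs_def I_def vanishing_ideal_def linear_forms_alt
  using row_sums_in by (auto intro!: poly_ring_diff)

lemma fibre_alt: "zero_set C (eqs u) =
  {a \<in> C \<rightarrow>\<^sub>E UNIV. (\<forall>f\<in>I. peval f a = 0) \<and> (\<forall>v\<in>R. row_sums C A a v = row_sums C A u v)}"
  unfolding zero_set_def eqs_def linear_forms_alt
  by (auto simp: peval.hom_minus hom_row_sums[OF comm_ring_hom_peval] ball_Un)

text \<open>
  A relation \<open>k\<close> between the coordinates of the projection holds on the closure of its image.
\<close>
lemma generic_fibre_dependent:
  assumes k: "k \<in> poly_ring R" "psubst PConst (row_sums C A z) k = 0"
    and nz: "peval k (row_sums C A u) \<noteq> 0"
  shows "zero_set C (eqs u) = {}"
proof -
  have False if a: "a \<in> zero_set C (eqs u)" for a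
  proof -
    let ?f = "psubst PConst (row_sums C A PVar) k"
    have "psubst PConst z ?f = psubst PConst (row_sums C A z) k"
      unfolding psubst_psubst[OF comm_ring_hom_PConst] hom_row_sums[OF comm_ring_hom_psubst_PConst]
      by (simp add: psubst_PVar[OF comm_ring_hom_PConst])
    then have "?f \<in> I" unfolding I_def vanishing_ideal_def
      using k poly_ring_psubst[OF k(1)] row_sums_in by auto
    then have "peval ?f a = 0" using a by (auto simp: fibre_alt)
    moreover have "peval ?f a = peval k (row_sums C A a)"
      by (simp add: peval_psubst hom_row_sums[OF comm_ring_hom_peval])
    moreover have "\<dots> = peval k (row_sums C A u)"
      by (rule peval_cong[OF k(1)]) (use a in \<open>auto simp: fibre_alt\<close>)
    ultimately show False using nz by simp
  qed
  then show ?thesis by blast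
qed

abbreviation (input) "S0 \<equiv> psubst PConst (row_sums C A z) ` poly_ring R"

lemma S0: "is_subring S0"
  by (rule image_subring[OF comm_ring_hom_psubst_PConst])

lemma S0_const: "PConst c \<in> S0"
  by (rule image_eqI[of _ _ "PConst c"]) (auto simp: psubst_PConst)

lemma S0_row_sums: "v \<in> R \<Longrightarrow> row_sums C A z v \<in> S0"
  by (rule image_eqI[of _ _ "PVar v"]) (auto simp: psubst_PVar[OF comm_ring_hom_PConst])

definition independent where
  "independent \<longleftrightarrow> (\<forall>h\<in>poly_ring R. psubst PConst (row_sums C A z) h = 0 \<longrightarrow> h = 0)"

lemma z_algebraic: "independent \<Longrightarrow> c \<in> C \<Longrightarrow> algebraic_over S0 (z c)"
  by (rule algebraic_over_independent[OF finR finT dim _ z])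
     (auto simp: independent_def row_sums_def intro!: poly_ring_closed z)

lemma base_hom: "independent \<Longrightarrow> \<exists>\<chi>. hom_on S0 \<chi> \<and> (\<forall>h\<in>poly_ring R. \<chi> (psubst PConst (row_sums C A z) h) = peval h b)"
  by (rule induced_hom[OF comm_ring_hom_psubst_PConst]) (auto simp: independent_def)

lemma psubst_pullback:
  "psubst PConst (row_sums C A z) h = psubst PConst z (psubst PConst (row_sums C A PVar) h)"
  unfolding psubst_psubst[OF comm_ring_hom_PConst] hom_row_sums[OF comm_ring_hom_psubst_PConst]
  by (simp add: psubst_PVar[OF comm_ring_hom_PConst])

lemma gen_subset: "subring_gen S0 (z ` C) \<subseteq> psubst PConst z ` poly_ring C"
proof
  fix x assume "x \<in> subring_gen S0 (z ` C)"
  then show "x \<in> psubst PConst z ` poly_ring C"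
  proof induction
    case (base s)
    then obtain h where h: "h \<in> poly_ring R" "s = psubst PConst (row_sums C A z) h" by blast
    show ?case unfolding h(2) psubst_pullback
      by (intro imageI poly_ring_psubst[OF h(1)] row_sums_in)
  next
    case (gen x)
    then obtain c where "c \<in> C" "x = z c" by blast
    then show ?case by (intro image_eqI[of _ _ "PVar c"]) (auto simp: psubst_PVar[OF comm_ring_hom_PConst])
  qed (auto intro: subring_closed[OF image_subring[OF comm_ring_hom_psubst_PConst]])
qed

lemma gen_psubst: "f \<in> poly_ring C \<Longrightarrow> psubst PConst z f \<in> subring_gen S0 (z ` C)"
  by (rule psubst_in_subring[OF subring_gen_subring[OF S0]])
    (auto intro: subring_gen.base S0_const subring_gen.gen)

lemma hom_gen_psubst:
  assumes \<chi>: "\<forall>h\<in>poly_ring R. \<chi> (psubst PConst (row_sums C A z) h) = peval h b"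
    and \<chi>': "hom_on (subring_gen S0 (z ` C)) \<chi>'" "\<forall>s\<in>S0. \<chi>' s = \<chi> s" and f: "f \<in> poly_ring C"
  shows "\<chi>' (psubst PConst z f) = peval f (\<lambda>c. \<chi>' (z c))"
proof -
  have c: "\<chi>' (PConst k) = k" for k
  proof -
    have "\<chi>' (PConst k) = \<chi> (PConst k)" using \<chi>'(2) S0_const by blast
    also have "\<dots> = k" using bspec[OF \<chi>, of "PConst k"] by (simp add: psubst_PConst)
    finally show ?thesis .
  qed
  have "\<chi>' (psubst PConst z f) = psubst (\<lambda>c. \<chi>' (PConst c)) (\<lambda>c. \<chi>' (z c)) f"
    by (rule hom_on_psubst[OF subring_gen_subring[OF S0] \<chi>'(1) f])
      (auto intro: subring_gen.base S0_const subring_gen.gen)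
  then show ?thesis by (simp add: c peval_def)
qed

text \<open>
  The point \<open>a\<close> of the fibre is the homomorphism that sends each \<open>z c\<close> to \<open>a c\<close>; lying over \<open>A u\<close> means that it
  extends the homomorphism \<open>\<chi>\<close> given by \<open>A u\<close>.
\<close>
lemma fibre_eq_extension_points:
  assumes \<chi>: "hom_on S0 \<chi>" "\<forall>h\<in>poly_ring R. \<chi> (psubst PConst (row_sums C A z) h) = peval h (row_sums C A u)"
  shows "zero_set C (eqs u) = extension_points S0 z C \<chi>"
proof (intro equalityI subsetI)
  fix a assume a: "a \<in> extension_points S0 z C \<chi>"
  then obtain \<chi>' where \<chi>': "hom_on (subring_gen S0 (z ` C)) \<chi>'" "\<forall>s\<in>S0. \<chi>' s = \<chi> s" "\<forall>c\<in>C. \<chi>' (z c) = a c"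
    unfolding extension_points_def by blast
  have ev: "\<chi>' (psubst PConst z f) = peval f a" if "f \<in> poly_ring C" for f
    using hom_gen_psubst[OF \<chi>(2) \<chi>'(1,2) that] peval_cong[OF that, of "\<lambda>c. \<chi>' (z c)" a] \<chi>'(3) by simp
  have "peval f a = 0" if "f \<in> I" for f
    using that ev[of f] hom_on_0[OF subring_gen_subring[OF S0] \<chi>'(1)] by (simp add: I_def vanishing_ideal_def)
  moreover have "row_sums C A a v = row_sums C A u v" if v: "v \<in> R" for v
  proof -
    have "row_sums C A a v = \<chi>' (psubst PConst z (row_sums C A PVar v))"
      using ev[OF row_sums_in, of v] by (simp add: hom_row_sums[OF comm_ring_hom_peval])
    also have "\<dots> = \<chi> (row_sums C A z v)"
      using bspec[OF \<chi>'(2) S0_row_sums[OF v]]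
      by (simp add: hom_row_sums[OF comm_ring_hom_psubst_PConst] psubst_PVar[OF comm_ring_hom_PConst])
    also have "\<dots> = row_sums C A u v"
      using bspec[OF \<chi>(2), of "PVar v"] v by (simp add: psubst_PVar[OF comm_ring_hom_PConst])
    finally show ?thesis .
  qed
  ultimately show "a \<in> zero_set C (eqs u)" using a by (auto simp: fibre_alt extension_points_def)
next
  fix a assume a: "a \<in> zero_set C (eqs u)"
  have "\<exists>\<chi>'. hom_on (psubst PConst z ` poly_ring C) \<chi>' \<and> (\<forall>f\<in>poly_ring C. \<chi>' (psubst PConst z f) = peval f a)"
    by (rule induced_hom[OF comm_ring_hom_psubst_PConst])
      (use a in \<open>auto simp: fibre_alt I_def vanishing_ideal_def\<close>)
  then obtain \<chi>' where \<chi>': "hom_on (psubst PConst z ` poly_ring C) \<chi>'"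
    "\<And>f. f \<in> poly_ring C \<Longrightarrow> \<chi>' (psubst PConst z f) = peval f a" by blast
  have "\<chi>' s = \<chi> s" if "s \<in> S0" for s
  proof -
    obtain h where h: "h \<in> poly_ring R" "s = psubst PConst (row_sums C A z) h" using \<open>s \<in> S0\<close> by blast
    have "\<chi>' s = peval (psubst PConst (row_sums C A PVar) h) a"
      unfolding h(2) psubst_pullback by (intro \<chi>'(2) poly_ring_psubst[OF h(1)] row_sums_in)
    also have "\<dots> = peval h (row_sums C A a)"
      by (simp add: peval_psubst hom_row_sums[OF comm_ring_hom_peval])
    also have "\<dots> = peval h (row_sums C A u)"
      by (rule peval_cong[OF h(1)]) (use a in \<open>auto simp: fibre_alt\<close>)
    also have "\<dots> = \<chi> s" using \<chi>(2) h by simp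
    finally show ?thesis .
  qed
  moreover have "\<chi>' (z c) = a c" if "c \<in> C" for c
    using \<chi>'(2)[of "PVar c"] that by (simp add: psubst_PVar[OF comm_ring_hom_PConst])
  ultimately show "a \<in> extension_points S0 z C \<chi>"
    using a hom_on_subset[OF \<chi>'(1) gen_subset] unfolding extension_points_def fibre_alt by blast
qed

text \<open>
  A separable equation of \<open>z c\<close> over the polynomials in the row sums becomes, on the fibre of
  \<open>u\<close>, a polynomial in one variable of which \<open>a c\<close> is a simple root.
\<close>
lemma fibre_certificate:
  assumes F: "F \<in> polys_over S0" "poly F (z c) = 0" and c: "c \<in> C"
    and \<chi>: "hom_on S0 \<chi>" "\<forall>h\<in>poly_ring R. \<chi> (psubst PConst (row_sums C A z) h) = peval h (row_sums C A u)"
    and \<chi>': "hom_on (subring_gen S0 (z ` C)) \<chi>'" "\<forall>s\<in>S0. \<chi>' s = \<chi> s" "\<chi>' (z c) = a c"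
    and simp: "\<chi>' (poly (pderiv F) (z c)) \<noteq> 0"
  shows "\<exists>w\<in>poly_ring C. peval w a \<noteq> 0 \<and> w * (PVar c - PConst (a c)) \<in> ideal_gen_in (poly_ring C) (eqs u)"
proof -
  let ?J = "ideal_gen_in (poly_ring C) (eqs u)"
  note O = is_subring_poly_ring[of C]
  have "\<forall>i. \<exists>k\<in>poly_ring R. poly.coeff F i = psubst PConst (row_sums C A z) k"
    using F(1) by (auto simp: polys_over_def)
  then obtain k where k: "\<And>i. k i \<in> poly_ring R" "\<And>i. poly.coeff F i = psubst PConst (row_sums C A z) (k i)"
    by metis
  let ?K = "\<lambda>i. psubst PConst (row_sums C A PVar) (k i)"
  have K: "?K i \<in> poly_ring C" for i by (rule poly_ring_psubst[OF k(1) row_sums_in])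
  interpret Z: comm_ring_hom "psubst PConst z" by (rule comm_ring_hom_psubst_PConst)
  define f where "f = (\<Sum>i\<le>degree F. ?K i * PVar c ^ i)"
  have "f \<in> poly_ring C" unfolding f_def using K c by (auto intro!: poly_ring_closed)
  moreover have "psubst PConst z f = poly F (z c)"
    by (simp add: f_def poly_altdef Z.hom_sum Z.hom_mult Z.hom_power k(2) psubst_pullback
        psubst_PVar[OF comm_ring_hom_PConst])
  ultimately have "f \<in> I" using F(2) by (simp add: I_def vanishing_ideal_def)
  then have fJ: "f \<in> ?J" by (intro ideal_gen_gen[OF O]) (simp add: eqs_def)
  have KJ: "psubst PConst (row_sums C A PVar) h - PConst (peval h (row_sums C A u)) \<in> ?J" if "h \<in> poly_ring R" for h
    using that
  proof (induction rule: poly_ring_induct)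
    case (const c) then show ?case by (simp add: psubst_PConst ideal_gen_0[OF O])
  next
    case (var v)
    then have "row_sums C A PVar v - PConst (row_sums C A u v) \<in> eqs u" by (simp add: eqs_def linear_forms_alt)
    then show ?case by (simp add: psubst_PVar[OF comm_ring_hom_PConst] ideal_gen_gen[OF O])
  next
    case (add f g)
    interpret P: comm_ring_hom "psubst PConst (row_sums C A PVar)" by (rule comm_ring_hom_psubst_PConst)
    from ideal_gen_add[OF O add.IH] show ?case
      by (simp add: P.hom_add peval.hom_add PConst.hom_add algebra_simps)
  next
    case (mult f g)
    interpret P: comm_ring_hom "psubst PConst (row_sums C A PVar)" by (rule comm_ring_hom_psubst_PConst)
    let ?p = "psubst PConst (row_sums C A PVar)" and ?e = "\<lambda>h. PConst (peval h (row_sums C A u))"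
    have "?p (f * g) - ?e (f * g) = ?p g * (?p f - ?e f) + ?e f * (?p g - ?e g)"
      by (simp add: P.hom_mult peval.hom_mult PConst.hom_mult algebra_simps)
    moreover have "?p g \<in> poly_ring C" by (rule poly_ring_psubst[OF mult.hyps(2) row_sums_in])
    ultimately show ?case using mult.IH ideal_gen_add[OF O] ideal_gen_mult[OF O] by simp
  qed
  define \<phi> where "\<phi> = map_poly \<chi> F"
  have c\<phi>: "poly.coeff \<phi> i = peval (k i) (row_sums C A u)" for i
    using coeff_mp[OF S0 \<chi>(1), of F i] \<chi>(2) k by (simp add: \<phi>_def)
  have d\<phi>: "degree \<phi> \<le> degree F" unfolding \<phi>_def by (rule degree_mp[OF S0 \<chi>(1)])
  interpret \<theta>: comm_ring_hom "\<lambda>p. poly (map_poly PConst p) (PVar c)"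
    by (rule comm_ring_hom_poly_map[OF comm_ring_hom_PConst])
  let ?\<theta> = "\<lambda>p. poly (map_poly PConst p) (PVar c)"
  have \<theta>: "?\<theta> p = (\<Sum>i\<le>degree p. PConst (poly.coeff p i) * PVar c ^ i)" for p
    by (simp add: poly_altdef coeff_map_poly degree_map_poly)
  have "?\<theta> \<phi> = (\<Sum>i\<le>degree F. PConst (peval (k i) (row_sums C A u)) * PVar c ^ i)"
    unfolding \<theta> c\<phi>[symmetric] using d\<phi> by (intro sum.mono_neutral_left) (auto simp: coeff_eq_0)
  then have "?\<theta> \<phi> = f - (\<Sum>i\<le>degree F. PVar c ^ i * (?K i - PConst (peval (k i) (row_sums C A u))))"
    by (simp add: f_def algebra_simps sum_subtractf)
  also have "\<dots> \<in> ?J"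
    by (intro ideal_gen_diff[OF O] fJ ideal_gen_sum[OF O] ideal_gen_mult[OF O] KJ k poly_ring_power) (simp add: c)
  finally have \<phi>J: "?\<theta> \<phi> \<in> ?J" .
  have sub: "adjoin S0 (z c) \<subseteq> subring_gen S0 (z ` C)"
  proof -
    have "adjoin S0 (z c) = subring_gen S0 {z c}"
      using adjoin_subring_gen[OF S0, of "{}" "z c"] by (simp add: subring_gen_empty[OF S0])
    also have "\<dots> \<subseteq> subring_gen S0 (z ` C)"
    proof
      fix x assume "x \<in> subring_gen S0 {z c}"
      then show "x \<in> subring_gen S0 (z ` C)" by induction (use c in \<open>auto intro: subring_gen.intros\<close>)
    qed
    finally show ?thesis .
  qed
  note ev = hom_on_poly[OF S0 \<chi>(1) hom_on_subset[OF \<chi>'(1) sub]]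
  have "poly \<phi> (a c) = 0"
    using ev[OF _ F(1)] \<chi>'(2,3) F(2) hom_on_0[OF subring_gen_subring[OF S0] \<chi>'(1)] by (simp add: \<phi>_def)
  then obtain \<psi> where \<psi>: "\<phi> = [:- a c, 1:] * \<psi>" using poly_eq_0_iff_dvd by (metis dvdE)
  have "poly (pderiv \<phi>) (a c) \<noteq> 0"
    using ev[OF _ polys_over_pderiv[OF S0 F(1)]] \<chi>'(2,3) simp
    by (simp add: \<phi>_def mp_pderiv[OF S0 \<chi>(1) F(1), symmetric])
  then have "poly \<psi> (a c) \<noteq> 0"
    unfolding \<psi> pderiv_mult by (simp add: pderiv_pCons del: mult_pCons_left)
  moreover have "peval (?\<theta> \<psi>) a = poly \<psi> (a c)"
    unfolding \<theta> by (simp add: peval.hom_sum peval.hom_mult peval.hom_power poly_altdef)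
  moreover have "?\<theta> \<psi> \<in> poly_ring C" unfolding \<theta> using c by (auto intro!: poly_ring_closed)
  moreover have "?\<theta> \<phi> = ?\<theta> \<psi> * (PVar c - PConst (a c))"
    unfolding \<psi> \<theta>.hom_mult by (simp add: map_poly_pCons PConst.hom_uminus algebra_simps)
  ultimately show ?thesis using \<phi>J by (intro bexI[of _ "?\<theta> \<psi>"] conjI) simp_all
qed

text \<open>
  The number \<open>d\<close> is the same for all functions \<open>g\<close>; only the condition \<open>h\<close> that keeps \<open>g\<close> from vanishing on the fibre
  depends on \<open>g\<close>. The last clause says that the equations of the fibre generate the maximal ideal of the local ring at each
  of its points, in the form of a polynomial identity that can be substituted into.
\<close>
theorem generic_fibre:
  "\<exists>d. \<forall>g\<in>poly_ring C. g \<notin> I \<longrightarrow> (\<exists>h\<in>poly_ring R. h \<noteq> 0 \<and>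
    (\<forall>u. peval h (row_sums C A u) \<noteq> 0 \<longrightarrow>
      finite (zero_set C (eqs u)) \<and> card (zero_set C (eqs u)) = d \<and>
      (\<forall>a\<in>zero_set C (eqs u). peval g a \<noteq> 0 \<and>
        (\<forall>c\<in>C. \<exists>w\<in>poly_ring C. peval w a \<noteq> 0 \<and>
          w * (PVar c - PConst (a c)) \<in> ideal_gen_in (poly_ring C) (eqs u)))))"
proof (cases "\<exists>k\<in>poly_ring R. k \<noteq> 0 \<and> psubst PConst (row_sums C A z) k = 0")
  case True
  then obtain k where "k \<in> poly_ring R" "k \<noteq> 0" "psubst PConst (row_sums C A z) k = 0" by blast
  with generic_fibre_dependent[of k] show ?thesis
    by (intro exI[of _ 0] ballI impI bexI[of _ k] conjI allI) auto
next
  case False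
  then have indep: independent by (auto simp: independent_def)
  let ?S0 = "psubst PConst (row_sums C A z) ` poly_ring R"
  let ?G = "subring_gen ?S0 (z ` C)"
  note G = subring_gen_subring[OF S0, of "z ` C"]
  obtain d where d: "\<forall>g\<in>?G. g \<noteq> 0 \<longrightarrow> (\<exists>h\<in>?S0. h \<noteq> 0 \<and>
      (\<forall>\<chi> :: _ \<Rightarrow> complex. hom_on ?S0 \<chi> \<longrightarrow> \<chi> h \<noteq> 0 \<longrightarrow>
      finite (extension_points ?S0 z C \<chi>) \<and> card (extension_points ?S0 z C \<chi>) = d \<and>
      (\<forall>\<chi>'. hom_on ?G \<chi>' \<and> (\<forall>s\<in>?S0. \<chi>' s = \<chi> s) \<longrightarrow> \<chi>' g \<noteq> 0)))"
    using extension_points_count[OF S0 finC z_algebraic[OF indep]] by (rule exE)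
  have "\<forall>c\<in>C. \<exists>F\<in>polys_over ?S0. poly F (z c) = 0 \<and> poly (pderiv F) (z c) \<noteq> 0"
    using minimal_relation[OF S0 z_algebraic[OF indep]] by metis
  then obtain F where F: "\<And>c. c \<in> C \<Longrightarrow> F c \<in> polys_over ?S0 \<and> poly (F c) (z c) = 0 \<and> poly (pderiv (F c)) (z c) \<noteq> 0"
    by metis
  let ?D = "\<lambda>c. poly (pderiv (F c)) (z c)"
  have D: "?D c \<in> ?G" if "c \<in> C" for c
  proof -
    have "poly.coeff (pderiv (F c)) i \<in> ?G" for i
      using polys_over_pderiv[OF S0, of "F c"] F[OF that] by (auto simp: polys_over_def intro: subring_gen.base)
    moreover have "z c \<in> ?G" using that by (intro subring_gen.gen imageI)
    ultimately show ?thesis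
      unfolding poly_altdef by (intro subring_sum[OF G] subring_mult[OF G] subring_power[OF G])
  qed
  show ?thesis
  proof (intro exI[of _ d] ballI impI)
    fix g assume g: "g \<in> poly_ring C" "g \<notin> I"
    \<comment> \<open>The derivatives are included so that each coordinate of a point of the fibre is a simple root.\<close>
    let ?g = "psubst PConst z g * (\<Prod>c\<in>C. ?D c)"
    have gG: "psubst PConst z g \<in> ?G" by (rule gen_psubst[OF g(1)])
    have "?g \<in> ?G" by (intro subring_mult[OF G] subring_prod[OF G] gG D)
    moreover have "?g \<noteq> 0" using g F finC by (simp add: I_def vanishing_ideal_def)
    ultimately obtain h0 where h0S: "h0 \<in> ?S0" and h0: "h0 \<noteq> 0 \<and>
      (\<forall>\<chi> :: _ \<Rightarrow> complex. hom_on ?S0 \<chi> \<longrightarrow> \<chi> h0 \<noteq> 0 \<longrightarrow>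
      finite (extension_points ?S0 z C \<chi>) \<and> card (extension_points ?S0 z C \<chi>) = d \<and>
      (\<forall>\<chi>'. hom_on ?G \<chi>' \<and> (\<forall>s\<in>?S0. \<chi>' s = \<chi> s) \<longrightarrow> \<chi>' ?g \<noteq> 0))"
      by (rule bexE[OF mp[OF bspec[OF d]]])
    obtain h where h: "h \<in> poly_ring R" "h0 = psubst PConst (row_sums C A z) h" using h0S by blast
    interpret Y: comm_ring_hom "psubst PConst (row_sums C A z)" by (rule comm_ring_hom_psubst_PConst)
    have "h \<noteq> 0" using conjunct1[OF h0] h(2) by auto
    show "\<exists>h\<in>poly_ring R. h \<noteq> 0 \<and>
    (\<forall>u. peval h (row_sums C A u) \<noteq> 0 \<longrightarrow>
      finite (zero_set C (eqs u)) \<and> card (zero_set C (eqs u)) = d \<and>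
      (\<forall>a\<in>zero_set C (eqs u). peval g a \<noteq> 0 \<and>
        (\<forall>c\<in>C. \<exists>w\<in>poly_ring C. peval w a \<noteq> 0 \<and>
          w * (PVar c - PConst (a c)) \<in> ideal_gen_in (poly_ring C) (eqs u))))"
    proof (rule bexI[OF _ h(1)], intro conjI allI impI \<open>h \<noteq> 0\<close>)
      fix u assume nz: "peval h (row_sums C A u) \<noteq> 0"
      obtain \<chi> where \<chi>: "hom_on ?S0 \<chi>"
        "\<forall>h\<in>poly_ring R. \<chi> (psubst PConst (row_sums C A z) h) = peval h (row_sums C A u)"
        using base_hom[OF indep] by blast
      have "\<chi> h0 \<noteq> 0" using nz \<chi>(2) h by simp
      note fib = mp[OF mp[OF spec[OF conjunct2[OF h0]] \<chi>(1)] this]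
      note eq = fibre_eq_extension_points[OF \<chi>]
      show "finite (zero_set C (eqs u))" "card (zero_set C (eqs u)) = d" unfolding eq using conjunct1[OF fib] conjunct1[OF conjunct2[OF fib]] by this+
      show "\<forall>a\<in>zero_set C (eqs u). peval g a \<noteq> 0 \<and>
        (\<forall>c\<in>C. \<exists>w\<in>poly_ring C. peval w a \<noteq> 0 \<and>
          w * (PVar c - PConst (a c)) \<in> ideal_gen_in (poly_ring C) (eqs u))"
      proof
        fix a assume "a \<in> zero_set C (eqs u)"
        then obtain \<chi>' where \<chi>': "hom_on ?G \<chi>'" "\<forall>s\<in>?S0. \<chi>' s = \<chi> s" "\<forall>c\<in>C. \<chi>' (z c) = a c"
          unfolding eq extension_points_def by blast
        have "\<chi>' ?g \<noteq> 0"
          by (rule mp[OF spec[OF conjunct2[OF conjunct2[OF fib]]]], rule conjI[OF \<chi>'(1,2)])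
        then have "\<chi>' (psubst PConst z g) * (\<Prod>c\<in>C. \<chi>' (?D c)) \<noteq> 0"
          using hom_on_mult[OF G \<chi>'(1) gG subring_prod[OF G D], of C "\<lambda>c. c"]
            hom_on_prod[OF G \<chi>'(1) D, of C "\<lambda>c. c"] by simp
        then have n1: "\<chi>' (psubst PConst z g) \<noteq> 0" and n2: "\<And>c. c \<in> C \<Longrightarrow> \<chi>' (?D c) \<noteq> 0"
          using finC by auto
        have "peval g a \<noteq> 0"
          using n1 hom_gen_psubst[OF \<chi>(2) \<chi>'(1,2) g(1)] peval_cong[OF g(1), of "\<lambda>c. \<chi>' (z c)" a] \<chi>'(3)
          by simp
        moreover have "\<exists>w\<in>poly_ring C. peval w a \<noteq> 0 \<and>
          w * (PVar c - PConst (a c)) \<in> ideal_gen_in (poly_ring C) (eqs u)" if c: "c \<in> C" for c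
          using fibre_certificate[OF _ _ c \<chi> \<chi>'(1,2) _ n2[OF c]] F[OF c] \<chi>'(3) c by blast
        ultimately show "peval g a \<noteq> 0 \<and>
        (\<forall>c\<in>C. \<exists>w\<in>poly_ring C. peval w a \<noteq> 0 \<and>
          w * (PVar c - PConst (a c)) \<in> ideal_gen_in (poly_ring C) (eqs u))" by blast
      qed
    qed
  qed
qed

end

section \<open>Lowest common ancestors\<close>

locale leaf_tree =
  fixes n :: nat and T :: "(nat, 'e) pre_digraph"
  assumes T: "leaf_rooted_tree n T"

sublocale leaf_tree \<subseteq> fin_digraph T
  using T by (simp add: leaf_rooted_tree_def rooted_tree_def)

context leaf_tree
begin

definition below (infix \<open>\<leadsto>\<close> 50) where "u \<leadsto> v \<longleftrightarrow> u \<rightarrow>\<^sup>*\<^bsub>T\<^esub> v"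

lemma below_walk: "u \<leadsto> v \<longleftrightarrow> (\<exists>p. awalk u p v)"
  unfolding below_def by (rule reachable_awalk)

lemma below_trans: "u \<leadsto> v \<Longrightarrow> v \<leadsto> w \<Longrightarrow> u \<leadsto> w"
  unfolding below_def by (rule reachable_trans)

lemma below_refl: "v \<in> verts T \<Longrightarrow> v \<leadsto> v"
  unfolding below_def by (rule reachable_refl)

lemma below_verts: "u \<leadsto> v \<Longrightarrow> u \<in> verts T" "u \<leadsto> v \<Longrightarrow> v \<in> verts T"
  unfolding below_def by (erule reachable_in_verts)+

lemma common_ancestor_below: "common_ancestor T i j v \<longleftrightarrow> v \<leadsto> i \<and> v \<leadsto> j"
  by (simp add: common_ancestor_def below_def)

lemma lca_below: "lca T i j = (THE v. (v \<leadsto> i \<and> v \<leadsto> j) \<and> (\<forall>w. w \<leadsto> i \<and> w \<leadsto> j \<longrightarrow> w \<leadsto> v))"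
  by (simp add: lca_def common_ancestor_def below_def)

lemma root: "0 \<in> verts T"
  and walk_ex: "v \<in> verts T \<Longrightarrow> \<exists>p. awalk 0 p v"
  and walk_unique: "awalk 0 p v \<Longrightarrow> awalk 0 q v \<Longrightarrow> p = q"
proof -
  have 1: "0 \<in> verts T" "\<forall>v\<in>verts T. \<exists>!p. awalk 0 p v"
    using T by (auto simp: leaf_rooted_tree_def rooted_tree_def)
  show "0 \<in> verts T" by fact
  show "v \<in> verts T \<Longrightarrow> \<exists>p. awalk 0 p v" using 1(2) by blast
  show "awalk 0 p v \<Longrightarrow> awalk 0 q v \<Longrightarrow> p = q" using 1(2) awalk_last_in_verts by blast
qed

lemma leaves: "{v \<in> verts T. vdeg T v = 1} = {0..n}" and vdeg_neq_2: "v \<in> verts T \<Longrightarrow> vdeg T v \<noteq> 2"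
  using T by (auto simp: leaf_rooted_tree_def)

lemma leaf_vert: "i \<le> n \<Longrightarrow> i \<in> verts T" and leaf_vdeg: "i \<le> n \<Longrightarrow> vdeg T i = 1"
proof -
  assume "i \<le> n"
  then have "i \<in> {v \<in> verts T. vdeg T v = 1}" by (simp only: leaves atLeastAtMost_iff zero_le simp_thms)
  then show "i \<in> verts T" "vdeg T i = 1" by simp_all
qed

lemma reach_root: "v \<in> verts T \<Longrightarrow> 0 \<leadsto> v"
  using walk_ex below_walk by blast

lemma reach_antisym:
  assumes "v \<leadsto> w" "w \<leadsto> v" shows "v = w"
proof -
  obtain p where p: "awalk 0 p v" using walk_ex below_verts(1)[OF assms(1)] by blast
  obtain q where q: "awalk v q w" using assms(1) unfolding below_walk by (rule exE)
  obtain r where r: "awalk w r v" using assms(2) unfolding below_walk by (rule exE)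
  have "awalk 0 (p @ q @ r) v" by (rule awalk_appendI[OF p awalk_appendI[OF q r]])
  from walk_unique[OF this p] have "q = []" by simp
  then show ?thesis using q by (simp add: awalk_Nil_iff)
qed

text \<open>
  The walks from the root to \<open>x\<close> through \<open>u\<close> and through \<open>v\<close> are equal, so one of \<open>u\<close> and \<open>v\<close> is met first.
\<close>
lemma ancestors_comparable:
  assumes "u \<leadsto> x" "v \<leadsto> x" shows "u \<leadsto> v \<or> v \<leadsto> u"
proof -
  have *: "u \<leadsto> v" if "awalk 0 p u" "awalk 0 (p @ s) v" for u v p s
  proof -
    have "awlast 0 p = u" by (rule awalkE'[OF that(1)])
    moreover have "awalk (awlast 0 p) s v" using that(2) unfolding awalk_append_iff by (rule conjunct2)
    ultimately have "awalk u s v" by simp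
    then show ?thesis unfolding below_walk by (rule exI)
  qed
  obtain p where p: "awalk 0 p u" using walk_ex[OF below_verts(1)[OF assms(1)]] by (rule exE)
  obtain p' where p': "awalk 0 p' v" using walk_ex[OF below_verts(1)[OF assms(2)]] by (rule exE)
  obtain q where q: "awalk u q x" using assms(1) unfolding below_walk by (rule exE)
  obtain q' where q': "awalk v q' x" using assms(2) unfolding below_walk by (rule exE)
  have "p @ q = p' @ q'" by (rule walk_unique[OF awalk_appendI[OF p q] awalk_appendI[OF p' q']])
  then obtain s where "p = p' @ s \<or> p @ s = p'" by (auto simp: append_eq_append_conv2)
  then show ?thesis using *[of p' v s u] *[of p u s v] p p' by blast
qed

lemma first_arc_unique:
  assumes "e \<in> arcs T" "e' \<in> arcs T" "tail T e = tail T e'" "head T e \<leadsto> x" "head T e' \<leadsto> x"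
  shows "e = e'"
proof -
  obtain p where p: "awalk 0 p (tail T e)" using walk_ex tail_in_verts[OF assms(1)] by blast
  obtain q where q: "awalk (head T e) q x" using assms(4) unfolding below_walk by (rule exE)
  obtain q' where q': "awalk (head T e') q' x" using assms(5) unfolding below_walk by (rule exE)
  have "awalk (tail T e) (e # q) x" "awalk (tail T e) (e' # q') x"
    using q q' assms(1-3) by (simp_all add: awalk_Cons_iff)
  from walk_unique[OF awalk_appendI[OF p this(1)] awalk_appendI[OF p this(2)]]
  show ?thesis by simp
qed

lemma last_arc_unique:
  assumes "e \<in> arcs T" "e' \<in> arcs T" "head T e = head T e'" shows "e = e'"
proof -
  obtain p where p: "awalk 0 p (tail T e)" using walk_ex[OF tail_in_verts[OF assms(1)]] by (rule exE)
  obtain p' where p': "awalk 0 p' (tail T e')" using walk_ex[OF tail_in_verts[OF assms(2)]] by (rule exE)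
  have "awalk 0 (p @ [e]) (head T e)" by (rule awalk_appendI[OF p arc_implies_awalk[OF assms(1)]])
  moreover have "awalk 0 (p' @ [e']) (head T e)"
    unfolding assms(3) by (rule awalk_appendI[OF p' arc_implies_awalk[OF assms(2)]])
  ultimately have "p @ [e] = p' @ [e']" by (rule walk_unique)
  then show ?thesis by simp
qed

lemma no_arc_into_root: "e \<in> arcs T \<Longrightarrow> head T e \<noteq> 0"
proof
  assume e: "e \<in> arcs T" "head T e = 0"
  obtain p where p: "awalk 0 p (tail T e)" using walk_ex tail_in_verts e by metis
  have "awalk 0 (p @ [e]) 0" using p e arc_implies_awalk[OF e(1)] awalk_appendI by metis
  moreover have "awalk 0 [] 0" using root by (simp add: awalk_Nil_iff)
  ultimately show False using walk_unique by blast
qed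

lemma in_arc_ex:
  assumes "v \<in> verts T" "v \<noteq> 0" shows "\<exists>e\<in>arcs T. head T e = v"
proof -
  obtain p where p: "awalk 0 p v" using walk_ex assms by blast
  then have "p \<noteq> []" using assms by (auto simp: awalk_Nil_iff)
  then obtain q e where "p = q @ [e]" by (metis rev_exhaust)
  then have "awalk (awlast 0 q) [e] v" using p by (simp add: awalk_append_iff)
  then show ?thesis by (auto simp: awalk_Cons_iff awalk_Nil_iff)
qed

lemma in_degree_1: "v \<in> verts T \<Longrightarrow> v \<noteq> 0 \<Longrightarrow> in_degree T v = 1"
proof -
  assume "v \<in> verts T" "v \<noteq> 0"
  then obtain e where e: "e \<in> arcs T" "head T e = v" using in_arc_ex by blast
  then have "in_arcs T v = {e}" using last_arc_unique by (auto simp: in_arcs_def)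
  then show ?thesis by (simp add: in_degree_def)
qed

lemma in_degree_root: "in_degree T 0 = 0"
  using no_arc_into_root by (auto simp: in_degree_def in_arcs_def)

lemma reach_cases:
  assumes "v \<leadsto> w" "v \<noteq> w"
  shows "\<exists>e\<in>arcs T. tail T e = v \<and> head T e \<leadsto> w"
proof -
  obtain p where p: "awalk v p w" using assms by (auto simp: below_walk)
  then obtain e q where "p = e # q" using assms(2) by (cases p) (auto simp: awalk_Nil_iff)
  then show ?thesis using p by (auto simp: awalk_Cons_iff below_walk)
qed

lemma reach_arc: "e \<in> arcs T \<Longrightarrow> tail T e \<leadsto> head T e"
  by (metis arc_implies_awalk below_walk)

lemma out_degree_0_iff: "out_degree T v = 0 \<longleftrightarrow> (\<forall>e\<in>arcs T. tail T e \<noteq> v)"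
  using finite_arcs by (auto simp: out_degree_def out_arcs_def)

lemma below_leaf:
  assumes "1 \<le> i" "i \<le> n" "i \<leadsto> w" shows "w = i"
proof -
  have "vdeg T i = 1" "in_degree T i = 1" using assms leaf_vdeg leaf_vert in_degree_1 by auto
  then have "out_degree T i = 0" by (simp add: vdeg_def)
  then show ?thesis using reach_cases[OF assms(3)] out_degree_0_iff by blast
qed

lemma above_root: "v \<leadsto> 0 \<Longrightarrow> v = 0"
  using reach_antisym reach_root below_verts(1) by blast

definition anc :: "nat \<Rightarrow> nat set" where "anc v = {w. w \<leadsto> v}"

lemma finite_anc: "finite (anc v)"
  by (rule finite_subset[OF _ finite_verts]) (auto simp: anc_def below_verts(1))

lemma anc_mono: "v \<leadsto> w \<Longrightarrow> anc v \<subseteq> anc w"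
  by (auto simp: anc_def intro: below_trans)

lemma anc_card_less: "v \<leadsto> w \<Longrightarrow> v \<noteq> w \<Longrightarrow> card (anc v) < card (anc w)"
proof (rule psubset_card_mono[OF finite_anc])
  assume 1: "v \<leadsto> w" "v \<noteq> w"
  then have "w \<in> anc w" "w \<notin> anc v" using reach_antisym below_refl[OF below_verts(2)[OF 1(1)]] by (auto simp: anc_def)
  then show "anc v \<subset> anc w" using anc_mono[OF 1(1)] by blast
qed

text \<open>
  The number of ancestors serves as depth.
\<close>
lemma deepest:
  assumes "v0 \<in> V" "V \<subseteq> verts T"
  shows "\<exists>v\<in>V. \<forall>w\<in>V. card (anc w) \<le> card (anc v)"
proof -
  have "finite V" using assms(2) finite_verts finite_subset by blast
  then have "Max ((\<lambda>v. card (anc v)) ` V) \<in> (\<lambda>v. card (anc v)) ` V" using assms(1) by (intro Max_in) auto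
  then obtain v where "v \<in> V" "card (anc v) = Max ((\<lambda>v. card (anc v)) ` V)" by auto
  then show ?thesis using \<open>finite V\<close> by (intro bexI[of _ v]) auto
qed

lemma lca_ex:
  assumes "i \<in> verts T" "j \<in> verts T"
  shows "\<exists>v. common_ancestor T i j v \<and> (\<forall>w. common_ancestor T i j w \<longrightarrow> w \<leadsto> v)"
proof -
  let ?V = "{v. common_ancestor T i j v}"
  have "0 \<in> ?V" "?V \<subseteq> verts T"
    using assms reach_root by (auto simp: common_ancestor_below dest: below_verts(1))
  from deepest[OF this] obtain v where v: "v \<in> ?V" "\<forall>w\<in>?V. card (anc w) \<le> card (anc v)" by (rule bexE)
  have "w \<leadsto> v" if w: "w \<in> ?V" for w
  proof -
    have "w \<leadsto> v \<or> v \<leadsto> w" using ancestors_comparable[of w i v] v w by (auto simp: common_ancestor_below)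
    moreover have "w = v" if "v \<leadsto> w" using anc_card_less[OF that] bspec[OF v(2) w] by (metis not_le)
    ultimately show ?thesis by blast
  qed
  then show ?thesis using v by blast
qed

lemma lca_eqI:
  assumes "v \<leadsto> i" "v \<leadsto> j" "\<And>w. w \<leadsto> i \<Longrightarrow> w \<leadsto> j \<Longrightarrow> w \<leadsto> v"
  shows "lca T i j = v"
  unfolding lca_below
  by (rule the_equality) (use assms reach_antisym in \<open>auto simp: common_ancestor_def\<close>)

lemma lca_reach:
  assumes "i \<in> verts T" "j \<in> verts T"
  shows "lca T i j \<leadsto> i" "lca T i j \<leadsto> j" "w \<leadsto> i \<Longrightarrow> w \<leadsto> j \<Longrightarrow> w \<leadsto> lca T i j"
proof -
  obtain v where v: "common_ancestor T i j v \<and> (\<forall>w. common_ancestor T i j w \<longrightarrow> w \<leadsto> v)"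
    using lca_ex[OF assms] by blast
  then have "lca T i j = v" by (intro lca_eqI) (auto simp: common_ancestor_below)
  then show "lca T i j \<leadsto> i" "lca T i j \<leadsto> j" "w \<leadsto> i \<Longrightarrow> w \<leadsto> j \<Longrightarrow> w \<leadsto> lca T i j"
    using v by (auto simp: common_ancestor_below)
qed

lemma lca_commute: "lca T i j = lca T j i"
  by (simp add: lca_def common_ancestor_def conj_commute)

lemma lca_self: "i \<in> verts T \<Longrightarrow> lca T i i = i"
  by (rule lca_eqI) (auto intro: below_refl)

lemma lca_root: "i \<in> verts T \<Longrightarrow> lca T 0 i = 0"
  by (rule lca_eqI) (use root reach_root above_root below_refl in auto)

lemma lca_vert: "i \<in> verts T \<Longrightarrow> j \<in> verts T \<Longrightarrow> lca T i j \<in> verts T"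
  using lca_reach(1) below_verts(1) by blast

text \<open>
  A non-root leaf has no descendants other than itself. The root has only one child, which is an ancestor of all other vertices, so
  that the root is no lowest common ancestor of non-root leaves.
\<close>
lemma lca_not_leaf:
  assumes "i \<noteq> j" "1 \<le> i" "i \<le> n" "1 \<le> j" "j \<le> n"
  shows "lca T i j > n"
proof (rule ccontr)
  assume "\<not> lca T i j > n"
  then have le: "lca T i j \<le> n" by simp
  have v: "i \<in> verts T" "j \<in> verts T" using assms leaf_vert by auto
  show False
  proof (cases "lca T i j = 0")
    case False
    then have ge: "1 \<le> lca T i j" by simp
    show False
      using below_leaf[OF ge le lca_reach(1)[OF v]] below_leaf[OF ge le lca_reach(2)[OF v]] assms(1) by simp
  next
    case True
    have "vdeg T 0 = 1" using leaf_vdeg by simp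
    then have "card (out_arcs T 0) = 1" using in_degree_root by (simp add: vdeg_def out_degree_def)
    then obtain e where e: "out_arcs T 0 = {e}" using card_1_singletonE by blast
    then have e': "e \<in> arcs T" "tail T e = 0" by (auto simp: out_arcs_def)
    have "head T e \<leadsto> x" if x: "x \<in> verts T" "x \<noteq> 0" for x
    proof -
      obtain e1 where "e1 \<in> arcs T" "tail T e1 = 0" "head T e1 \<leadsto> x"
        using reach_cases[OF reach_root[OF x(1)] x(2)[symmetric]] by blast
      moreover then have "e1 = e" using e by (auto simp: out_arcs_def)
      ultimately show ?thesis by simp
    qed
    then have "head T e \<leadsto> i" "head T e \<leadsto> j" using v assms by simp_all
    then have "head T e \<leadsto> lca T i j" by (rule lca_reach(3)[OF v])
    then have "head T e \<leadsto> 0" unfolding True .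
    from notE[OF no_arc_into_root[OF e'(1)] above_root[OF this]] show False .
  qed
qed

text \<open>
  The two given lowest common ancestors are ancestors of \<open>j\<close> and hence comparable. At the upper one the path
  to \<open>j\<close> separates from the path to one of \<open>x\<close> and \<open>m\<close> but not from the path to the other.
\<close>
lemma lca_third:
  assumes v: "x \<in> verts T" "j \<in> verts T" "m \<in> verts T" and ne: "lca T x j \<noteq> lca T m j"
  shows "lca T x m = (if lca T x j \<leadsto> lca T m j then lca T x j else lca T m j)"
proof (cases "lca T x j \<leadsto> lca T m j")
  case True
  let ?v = "lca T x j" and ?u = "lca T m j"
  have "lca T x m = ?v"
  proof (rule lca_eqI)
    show "?v \<leadsto> x" using lca_reach v by blast
    show "?v \<leadsto> m" using True lca_reach(1)[OF v(3,2)] below_trans by blast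
    fix w assume w: "w \<leadsto> x" "w \<leadsto> m"
    have "\<not> ?u \<leadsto> w"
    proof
      assume "?u \<leadsto> w"
      then have "?u \<leadsto> x" using w below_trans by blast
      then have "?u \<leadsto> ?v" using lca_reach v by blast
      then show False using True reach_antisym ne by blast
    qed
    then have "w \<leadsto> ?u" using ancestors_comparable[OF w(2) lca_reach(1)[OF v(3,2)]] by blast
    then have "w \<leadsto> j" using lca_reach(2)[OF v(3,2)] below_trans by blast
    then show "w \<leadsto> ?v" using lca_reach(3)[OF v(1,2)] w by blast
  qed
  then show ?thesis using True by simp
next
  case False
  let ?v = "lca T x j" and ?u = "lca T m j"
  have uv: "?u \<leadsto> ?v"
    using ancestors_comparable[OF lca_reach(2)[OF v(1,2)] lca_reach(2)[OF v(3,2)]] False by blast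
  have "lca T x m = ?u"
  proof (rule lca_eqI)
    show "?u \<leadsto> m" using lca_reach v by blast
    show "?u \<leadsto> x" using uv lca_reach(1)[OF v(1,2)] below_trans by blast
    fix w assume w: "w \<leadsto> x" "w \<leadsto> m"
    have "\<not> ?v \<leadsto> w"
    proof
      assume "?v \<leadsto> w"
      then have "?v \<leadsto> m" using w below_trans by blast
      then have "?v \<leadsto> ?u" using lca_reach v by blast
      then show False using uv reach_antisym ne by blast
    qed
    then have "w \<leadsto> ?v" using ancestors_comparable[OF w(1) lca_reach(1)[OF v(1,2)]] by blast
    then have "w \<leadsto> j" using lca_reach(2)[OF v(1,2)] below_trans by blast
    then show "w \<leadsto> ?u" using lca_reach(3)[OF v(3,2)] w by blast
  qed
  then show ?thesis using False by simp
qed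

text \<open>
  By \<open>lca_third\<close> the lowest common ancestor of \<open>x\<close> and \<open>m\<close> is determined by those of \<open>x\<close> and \<open>m\<close> with \<open>j\<close>. The vertices
  \<open>x\<close> with the same lowest common ancestor with \<open>j\<close> form the blocks to which \<open>module_parallel\<close> is applied.
\<close>
lemma lca_module:
  assumes "x \<in> verts T" "x' \<in> verts T" "j \<in> verts T" "m \<in> verts T"
    and "lca T x j = v" "lca T x' j = v" "lca T m j \<noteq> v"
  shows "lca T x m = lca T x' m"
  using lca_third[of x j m] lca_third[of x' j m] assms by simp

text \<open>
  At most one of \<open>k\<close> and \<open>l\<close> lies below the same child of their lowest common ancestor as \<open>j\<close>.
\<close>
lemma lca_exchange:
  assumes v: "i \<in> verts T" "j \<in> verts T" "k \<in> verts T" "l \<in> verts T" and eq: "lca T i j = lca T k l"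
  shows "lca T k j = lca T k l \<or> lca T l j = lca T k l"
proof -
  let ?v = "lca T k l" and ?a = "lca T k j" and ?b = "lca T l j"
  have vj: "?v \<leadsto> j" using lca_reach(2)[OF v(1,2)] eq by simp
  have va: "?v \<leadsto> ?a" using lca_reach v vj by blast
  have vb: "?v \<leadsto> ?b" using lca_reach v vj by blast
  consider "?a \<leadsto> ?b" | "?b \<leadsto> ?a"
    using ancestors_comparable[OF lca_reach(2)[OF v(3,2)] lca_reach(2)[OF v(4,2)]] by blast
  then show ?thesis
  proof cases
    case 1
    then have "?a \<leadsto> l" using lca_reach(1)[OF v(4,2)] below_trans by blast
    then have "?a \<leadsto> ?v" using lca_reach(3)[OF v(3,4)] lca_reach(1)[OF v(3,2)] by blast
    then show ?thesis using va reach_antisym by blast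
  next
    case 2
    then have "?b \<leadsto> k" using lca_reach(1)[OF v(3,2)] below_trans by blast
    then have "?b \<leadsto> ?v" using lca_reach(3)[OF v(3,4)] lca_reach(1)[OF v(4,2)] by blast
    then show ?thesis using vb reach_antisym by blast
  qed
qed

text \<open>
  A deepest descendant has no outgoing arc.
\<close>
lemma leaf_below:
  assumes "v \<in> verts T" "v \<noteq> 0" shows "\<exists>l. 1 \<le> l \<and> l \<le> n \<and> v \<leadsto> l"
proof -
  have "v \<in> {w. v \<leadsto> w}" "{w. v \<leadsto> w} \<subseteq> verts T" using assms below_refl below_verts(2) by auto
  from deepest[OF this] obtain w where "w \<in> {w. v \<leadsto> w}"
    and "\<forall>x\<in>{w. v \<leadsto> w}. card (anc x) \<le> card (anc w)" by (rule bexE)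
  then have w: "v \<leadsto> w" "\<And>x. v \<leadsto> x \<Longrightarrow> card (anc x) \<le> card (anc w)" by simp_all
  have "w \<noteq> 0" using w(1) above_root[of v] assms(2) by metis
  have "tail T e \<noteq> w" if e: "e \<in> arcs T" for e
  proof
    assume t: "tail T e = w"
    have wr: "w \<leadsto> head T e" using reach_arc[OF e] t by simp
    have "w \<noteq> head T e"
    proof
      assume h: "w = head T e"
      obtain p where p: "awalk 0 p w" using walk_ex w(1) below_verts(2) by blast
      then have "awalk 0 (p @ [e]) w" using arc_implies_awalk[OF e] t h awalk_appendI by metis
      from walk_unique[OF p this] show False by simp
    qed
    then have "card (anc w) < card (anc (head T e))" using anc_card_less wr by blast
    moreover have "v \<leadsto> head T e" using w(1) wr below_trans by blast
    ultimately show False using w(2)[of "head T e"] by simp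
  qed
  then have "out_degree T w = 0" by (simp add: out_degree_0_iff)
  moreover have "w \<in> verts T" using w(1) below_verts(2) by blast
  ultimately have "vdeg T w = 1" using in_degree_1 \<open>w \<noteq> 0\<close> by (simp add: vdeg_def)
  then have "w \<in> {v \<in> verts T. vdeg T v = 1}" using \<open>w \<in> verts T\<close> by simp
  then have "w \<in> {0..n}" unfolding leaves .
  then show ?thesis using w(1) \<open>w \<noteq> 0\<close> by (intro exI[of _ w]) auto
qed

text \<open>
  An internal vertex does not have degree two and so has two children; take a leaf below each.
\<close>
lemma internal_is_lca:
  assumes v: "v \<in> verts T" "v \<noteq> 0" "v > n"
  shows "\<exists>i j. 1 \<le> i \<and> i < j \<and> j \<le> n \<and> lca T i j = v"
proof -
  have "vdeg T v \<noteq> 1"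
  proof
    assume "vdeg T v = 1"
    then have "v \<in> {v \<in> verts T. vdeg T v = 1}" using v(1) by simp
    then show False unfolding leaves using v(3) by simp
  qed
  then have "out_degree T v \<noteq> 0" "out_degree T v \<noteq> 1"
    using in_degree_1[OF v(1,2)] vdeg_neq_2[OF v(1)] by (auto simp: vdeg_def)
  then have "\<not> card (out_arcs T v) \<le> Suc 0" by (simp add: out_degree_def)
  then obtain e e' where e: "e \<in> arcs T" "tail T e = v" "e' \<in> arcs T" "tail T e' = v" "e \<noteq> e'"
    by (auto simp: card_le_Suc0_iff_eq out_arcs_def)
  obtain l l' where l: "1 \<le> l" "l \<le> n" "head T e \<leadsto> l" "1 \<le> l'" "l' \<le> n" "head T e' \<leadsto> l'"
    using leaf_below head_in_verts e no_arc_into_root by metis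
  have vl: "v \<leadsto> l" "v \<leadsto> l'" using e l reach_arc below_trans by metis+
  have "l \<noteq> l'" using first_arc_unique[of e e' l] e l by auto
  have "lca T l l' = v"
  proof (rule lca_eqI[OF vl])
    fix w assume w: "w \<leadsto> l" "w \<leadsto> l'"
    have "w = v" if vw: "v \<leadsto> w"
    proof (rule ccontr)
      assume "w \<noteq> v"
      then obtain f where f: "f \<in> arcs T" "tail T f = v" "head T f \<leadsto> w"
        using reach_cases[OF vw] by metis
      have "head T f \<leadsto> l" "head T f \<leadsto> l'" using f w below_trans by blast+
      then have "f = e" "f = e'" using first_arc_unique[of f e l] first_arc_unique[of f e' l'] f e l by auto
      then show False using e by simp
    qed
    then show "w \<leadsto> v" using ancestors_comparable[OF w(1) vl(1)] below_refl[OF v(1)] by auto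
  qed
  then show ?thesis
  proof (cases "l < l'")
    case False
    then have "l' < l" using \<open>l \<noteq> l'\<close> by simp
    then show ?thesis using l \<open>lca T l l' = v\<close> lca_commute by metis
  qed (use l in blast)
qed

end

section \<open>Inverses of matrices in the model\<close>

lemma mat_mult_index:
  assumes "X \<in> carrier_mat n n" "Y \<in> carrier_mat n n" "i < n" "j < n"
  shows "(X * Y) $$ (i, j) = (\<Sum>k<n. X $$ (i, k) * Y $$ (k, j))"
  using assms by (auto simp: scalar_prod_def atLeast0LessThan intro!: sum.cong)

lemma parallel_cross:
  fixes x y :: "'i \<Rightarrow> 'f::field"
  assumes "\<And>c. c \<in> B \<Longrightarrow> a * x c = b * y c" "a \<noteq> 0 \<or> b \<noteq> 0" "i \<in> B" "k \<in> B"
  shows "x i * y k = x k * y i"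
proof -
  have i: "a * x i = b * y i" and k: "a * x k = b * y k" using assms by auto
  have "a * (x i * y k) = (a * x i) * y k" by (simp only: mult.assoc)
  also have "\<dots> = (b * y k) * y i" by (simp only: i mult_ac)
  also have "\<dots> = a * (x k * y i)" by (simp only: k[symmetric] mult_ac)
  finally have 1: "a * (x i * y k) = a * (x k * y i)" .
  have "b * (x i * y k) = (b * y k) * x i" by (simp only: mult_ac)
  also have "\<dots> = (a * x i) * x k" by (simp only: k[symmetric] mult_ac)
  also have "\<dots> = b * (x k * y i)" by (simp only: i mult_ac)
  finally show ?thesis using 1 assms(2) by auto
qed

text \<open>
  The rows of \<open>M\<close> in \<open>B\<close> agree outside of \<open>B\<close>. Hence the block of \<open>M\<close> on \<open>B\<close> maps both the column
  \<open>j\<close> of the inverse and the row sums of the inverse, restricted to \<open>B\<close>, to constant vectors.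
  Invertibility of \<open>M\<close> allows only one such vector up to scaling.
\<close>
lemma module_parallel:
  fixes M K :: "nat \<Rightarrow> nat \<Rightarrow> 'f::field"
  assumes sym: "\<And>i j. i < n \<Longrightarrow> j < n \<Longrightarrow> M i j = M j i"
    and MK: "\<And>i j. i < n \<Longrightarrow> j < n \<Longrightarrow> (\<Sum>k<n. M i k * K k j) = (if i = j then 1 else 0)"
    and KM: "\<And>i j. i < n \<Longrightarrow> j < n \<Longrightarrow> (\<Sum>k<n. K i k * M k j) = (if i = j then 1 else 0)"
    and B: "B \<subseteq> {..<n}" and mod: "\<And>i k m. i \<in> B \<Longrightarrow> k \<in> B \<Longrightarrow> m < n \<Longrightarrow> m \<notin> B \<Longrightarrow> M i m = M k m"
    and ijk: "i \<in> B" "k \<in> B" "j < n" "j \<notin> B"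
  defines "q \<equiv> \<lambda>i. \<Sum>m<n. K i m"
  shows "K i j * q k = K k j * q i"
proof -
  have finB: "finite B" using B finite_subset by blast
  have split: "(\<Sum>c<n. F c) = (\<Sum>c\<in>B. F c) + (\<Sum>c\<in>{..<n}-B. F c)" for F :: "nat \<Rightarrow> 'f"
    using sum.subset_diff[OF B, of F] by (simp add: add.commute)
  have zero: "z c = 0" if z: "\<And>b. b \<in> B \<Longrightarrow> (\<Sum>c\<in>B. M b c * z c) = 0" "(\<Sum>c\<in>B. z c) = 0" and c: "c \<in> B" for z c
  proof -
    have Mz: "(\<Sum>c\<in>B. M m c * z c) = 0" if m: "m < n" for m
    proof (cases "m \<in> B")
      case False
      have "M m c' = M m c" if "c' \<in> B" for c'
        using mod[OF that c m False] sym m that c B by (metis lessThan_iff subsetD)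
      then have "(\<Sum>c\<in>B. M m c * z c) = M m c * (\<Sum>c\<in>B. z c)" by (simp add: sum_distrib_left)
      then show ?thesis using z(2) by simp
    qed (rule z(1))
    have "(\<Sum>d\<in>B. (if c = d then 1 else 0) * z d) = (\<Sum>d\<in>B. if d = c then z d else 0)"
      by (intro sum.cong) auto
    then have "z c = (\<Sum>d\<in>B. (if c = d then 1 else 0) * z d)" using c finB by simp
    also have "\<dots> = (\<Sum>d\<in>B. (\<Sum>m<n. K c m * M m d) * z d)"
    proof (intro sum.cong refl)
      fix d assume "d \<in> B"
      then have "c < n" "d < n" using c B by auto
      then show "(if c = d then 1 else 0) * z d = (\<Sum>m<n. K c m * M m d) * z d" by (simp only: KM)
    qed
    also have "\<dots> = (\<Sum>m<n. K c m * (\<Sum>d\<in>B. M m d * z d))"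
      by (simp add: sum_distrib_right sum_distrib_left mult.assoc) (rule sum.swap)
    finally show ?thesis using Mz by simp
  qed
  define x where "x c = K c j" for c
  have Mq: "(\<Sum>c<n. M b c * q c) = 1" if b: "b < n" for b
  proof -
    have "(\<Sum>c<n. M b c * q c) = (\<Sum>m<n. \<Sum>c<n. M b c * K c m)"
      unfolding q_def by (simp add: sum_distrib_left) (rule sum.swap)
    also have "\<dots> = (\<Sum>m<n. if b = m then 1 else 0)" using MK b by simp
    finally show ?thesis using b by simp
  qed
  \<comment> \<open>The two constants to which the block of \<open>M\<close> on \<open>B\<close> maps \<open>x\<close> and \<open>q\<close>.\<close>
  define \<alpha> where "\<alpha> = - (\<Sum>m\<in>{..<n}-B. M i m * x m)"
  define \<beta> where "\<beta> = 1 - (\<Sum>m\<in>{..<n}-B. M i m * q m)"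
  have out: "(\<Sum>m\<in>{..<n}-B. M b m * v m) = (\<Sum>m\<in>{..<n}-B. M i m * v m)" if "b \<in> B" for b and v :: "nat \<Rightarrow> 'f"
    using mod[OF that ijk(1)] by (intro sum.cong) auto
  have Mx: "(\<Sum>c\<in>B. M b c * x c) = \<alpha>" if b: "b \<in> B" for b
  proof -
    have "b < n" "b \<noteq> j" using b B ijk by auto
    then have "(\<Sum>c<n. M b c * x c) = 0" using MK[of b j] ijk by (simp add: x_def)
    then show ?thesis unfolding split \<alpha>_def out[OF b] by (rule add_eq_0_iff2[THEN iffD1])
  qed
  have My: "(\<Sum>c\<in>B. M b c * q c) = \<beta>" if b: "b \<in> B" for b
  proof -
    have "b < n" using b B by auto
    then show ?thesis using Mq[of b] unfolding split \<beta>_def out[OF b] by (simp add: eq_diff_eq)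
  qed
  have "\<alpha> * (\<Sum>c\<in>B. q c) = \<beta> * (\<Sum>c\<in>B. x c)"
  proof -
    have "\<alpha> * (\<Sum>c\<in>B. q c) = (\<Sum>b\<in>B. \<Sum>c\<in>B. M b c * x c * q b)"
      using Mx by (simp add: sum_distrib_left flip: sum_distrib_right)
    also have "\<dots> = (\<Sum>c\<in>B. \<Sum>b\<in>B. M c b * q b * x c)"
      by (subst sum.swap, intro sum.cong refl) (use sym B in \<open>auto simp: mult_ac subset_iff\<close>)
    also have "\<dots> = \<beta> * (\<Sum>c\<in>B. x c)"
      using My by (simp add: sum_distrib_left flip: sum_distrib_right)
    finally show ?thesis .
  qed
  have lin: "(\<Sum>c\<in>B. M b c * (a * x c - a' * q c)) = a * \<alpha> - a' * \<beta>" if "b \<in> B" for a a' b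
  proof -
    have "(\<Sum>c\<in>B. M b c * (a * x c - a' * q c)) = a * (\<Sum>c\<in>B. M b c * x c) - a' * (\<Sum>c\<in>B. M b c * q c)"
      by (simp add: sum_distrib_left sum_subtractf algebra_simps)
    then show ?thesis by (simp add: Mx[OF that] My[OF that])
  qed
  have s: "(\<Sum>c\<in>B. a * x c - a' * q c) = a * (\<Sum>c\<in>B. x c) - a' * (\<Sum>c\<in>B. q c)" for a a'
    by (simp add: sum_distrib_left sum_subtractf)
  have "x i * q k = x k * q i"
  proof (cases "\<alpha> = 0 \<and> \<beta> = 0")
    case False
    have "\<beta> * x c = \<alpha> * q c" if "c \<in> B" for c
      using zero[of "\<lambda>c. \<beta> * x c - \<alpha> * q c", OF _ _ that] lin[of _ \<beta> \<alpha>] s[of \<beta> \<alpha>]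
        \<open>\<alpha> * (\<Sum>c\<in>B. q c) = \<beta> * (\<Sum>c\<in>B. x c)\<close> by simp
    then show ?thesis by (rule parallel_cross) (use False ijk in auto)
  next
    case True
    let ?X = "\<Sum>c\<in>B. x c" and ?Q = "\<Sum>c\<in>B. q c"
    show ?thesis
    proof (cases "?X = 0 \<and> ?Q = 0")
      case False
      have "?Q * x c = ?X * q c" if "c \<in> B" for c
        using zero[of "\<lambda>c. ?Q * x c - ?X * q c", OF _ _ that] lin[of _ ?Q ?X] s[of ?Q ?X] True by simp
      then show ?thesis by (rule parallel_cross) (use False ijk in auto)
    next
      case X: True
      have "x c = 0" if "c \<in> B" for c
        by (rule zero[OF _ _ that]) (use Mx True X in auto)
      then show ?thesis using ijk by simp
    qed
  qed
  then show ?thesis by (simp add: x_def)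
qed

lemma symmetric_inverse:
  fixes M K :: "'f::field mat"
  assumes M: "M \<in> carrier_mat n n" "transpose_mat M = M" and K: "K \<in> carrier_mat n n"
    and MK: "M * K = 1\<^sub>m n"
  shows "transpose_mat K = K"
proof -
  have KT: "transpose_mat K \<in> carrier_mat n n" using K by simp
  have "transpose_mat (M * K) = transpose_mat K * transpose_mat M"
    by (rule transpose_mult[OF M(1) K])
  then have KM: "transpose_mat K * M = 1\<^sub>m n" using MK M(2) by (simp add: transpose_one)
  have "transpose_mat K = transpose_mat K * (M * K)" using MK KT by simp
  also have "\<dots> = (transpose_mat K * M) * K" using KT M(1) K by (simp add: assoc_mult_mat)
  also have "\<dots> = K" using KM K by simp
  finally show ?thesis .
qed

context leaf_tree
begin

text \<open>
  Row and column \<open>i\<close> of a matrix belong to the leaf \<open>Suc i\<close>.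
\<close>
abbreviation lc :: "nat \<Rightarrow> nat \<Rightarrow> nat" where "lc i j \<equiv> lca T (Suc i) (Suc j)"

lemma vert_Suc: "i < n \<Longrightarrow> Suc i \<in> verts T"
  by (rule leaf_vert) simp

lemma lc_self: "i < n \<Longrightarrow> lc i i = Suc i"
  by (rule lca_self[OF vert_Suc])

lemma lc_gt: "i < n \<Longrightarrow> j < n \<Longrightarrow> i \<noteq> j \<Longrightarrow> lc i j > n"
  by (rule lca_not_leaf) auto

lemma lc_leaf: "i < n \<Longrightarrow> j < n \<Longrightarrow> k < n \<Longrightarrow> lc i j = Suc k \<longleftrightarrow> i = k \<and> j = k"
  using lc_gt[of i j] lc_self[of i] by (cases "i = j") auto

lemma bmt_space_sym:
  assumes "M \<in> bmt_space n T" "i < n" "j < n" shows "M $$ (i, j) = M $$ (j, i)"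
  using assms lca_commute[of "Suc i" "Suc j"] unfolding bmt_space_def by blast

lemma bmt_spaceI:
  assumes "M \<in> carrier_mat n n"
    "\<And>i j k l. i < n \<Longrightarrow> j < n \<Longrightarrow> k < n \<Longrightarrow> l < n \<Longrightarrow> lc i j = lc k l \<Longrightarrow> M $$ (i, j) = M $$ (k, l)"
  shows "M \<in> bmt_space n T"
proof -
  have "transpose_mat M = M"
  proof (rule eq_matI)
    fix i j assume "i < dim_row M" "j < dim_col M"
    then have ij: "i < n" "j < n" using assms(1) by auto
    have "M $$ (j, i) = M $$ (i, j)" by (rule assms(2)[OF ij(2,1) ij lca_commute])
    then show "transpose_mat M $$ (i, j) = M $$ (i, j)" using ij assms(1) by simp
  qed (use assms(1) in auto)
  then show ?thesis using assms unfolding bmt_space_def by blast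
qed

lemma bmt_space_eq:
  "M \<in> bmt_space n T \<Longrightarrow> i < n \<Longrightarrow> j < n \<Longrightarrow> k < n \<Longrightarrow> l < n \<Longrightarrow> lc i j = lc k l \<Longrightarrow> M $$ (i, j) = M $$ (k, l)"
  unfolding bmt_space_def by blast

lemma bmt_space_carrier: "M \<in> bmt_space n T \<Longrightarrow> M \<in> carrier_mat n n"
  and bmt_space_transpose: "M \<in> bmt_space n T \<Longrightarrow> transpose_mat M = M"
  unfolding bmt_space_def by blast+

text \<open>
  Let \<open>B\<close> be the set of the leaves whose lowest common ancestor with the leaf of \<open>c\<close> is the same as for \<open>a\<close>. By
  \<open>lca_module\<close> the rows of \<open>M\<close> in \<open>B\<close> agree outside of \<open>B\<close>, so in column \<open>c\<close> of the inverse the entries of \<open>B\<close> are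
  proportional to the row sums. Two such exchanges lead from \<open>(i, j)\<close> to \<open>(k, l)\<close>, and \<open>lca_exchange\<close>
  provides the entry between them.
\<close>
lemma inverse_binomial:
  fixes M K :: "'f::field mat"
  assumes M: "M \<in> bmt_space n T" and K: "K \<in> carrier_mat n n" "M * K = 1\<^sub>m n" "K * M = 1\<^sub>m n"
    and ijkl: "i < n" "j < n" "k < n" "l < n" "i \<noteq> j" "k \<noteq> l" "lc i j = lc k l"
  defines "q \<equiv> \<lambda>i. \<Sum>m<n. K $$ (i, m)"
  shows "K $$ (i, j) * q k * q l = K $$ (k, l) * q i * q j"
proof -
  note Mc = bmt_space_carrier[OF M]
  have Ksym: "K $$ (a, b) = K $$ (b, a)" if "a < n" "b < n" for a b
    using symmetric_inverse[OF Mc bmt_space_transpose[OF M] K(1,2)] that K(1)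
    by (metis carrier_matD index_transpose_mat(1))
  have step: "K $$ (a, c) * q b = K $$ (b, c) * q a"
    if abc: "a < n" "b < n" "c < n" "a \<noteq> c" "lc a c = lc b c" for a b c
  proof -
    let ?B = "{x. x < n \<and> lc x c = lc a c}"
    have "K $$ (a, c) * (\<Sum>m<n. K $$ (b, m)) = K $$ (b, c) * (\<Sum>m<n. K $$ (a, m))"
    proof (rule module_parallel[of n "\<lambda>i j. M $$ (i, j)" "\<lambda>i j. K $$ (i, j)" ?B])
      show "(\<Sum>k<n. M $$ (i, k) * K $$ (k, j)) = (if i = j then 1 else 0)" if "i < n" "j < n" for i j
        using mat_mult_index[OF Mc K(1) that] K(2) that by simp
      show "(\<Sum>k<n. K $$ (i, k) * M $$ (k, j)) = (if i = j then 1 else 0)" if "i < n" "j < n" for i j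
        using mat_mult_index[OF K(1) Mc that] K(3) that by simp
      show "M $$ (i, m) = M $$ (k, m)" if "i \<in> ?B" "k \<in> ?B" "m < n" "m \<notin> ?B" for i k m
      proof (rule bmt_space_eq[OF M])
        show "lc i m = lc k m"
          by (rule lca_module[OF vert_Suc vert_Suc vert_Suc[OF abc(3)] vert_Suc]) (use that in auto)
      qed (use that in auto)
      show "c \<notin> ?B" using lc_self[OF abc(3)] lc_gt[of a c] abc by auto
    qed (use abc bmt_space_sym[OF M] in auto)
    then show ?thesis by (simp add: q_def)
  qed
  have main: "K $$ (i, j) * q k * q l = K $$ (k, l) * q i * q j"
    if a: "k < n" "l < n" "k \<noteq> l" "lc i j = lc k l" "lc k j = lc k l" for k l
  proof -
    have "lc l k = lc k l" "lc j k = lc k l" using a lca_commute by metis+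
    moreover have "k \<noteq> j" using a lc_gt[of k l] lc_self[of j] ijkl by auto
    ultimately have "K $$ (i, j) * q k = K $$ (k, j) * q i" "K $$ (j, k) * q l = K $$ (l, k) * q j"
      using step[of i k j] step[of j l k] a ijkl by auto
    then have "K $$ (i, j) * q k * q l = (K $$ (k, j) * q i) * q l" "K $$ (k, j) * q l = K $$ (k, l) * q j"
      using Ksym a ijkl by auto
    then have "K $$ (i, j) * q k * q l = (K $$ (k, j) * q l) * q i" by (simp only: mult_ac)
    also have "\<dots> = K $$ (k, l) * q i * q j"
      using \<open>K $$ (k, j) * q l = K $$ (k, l) * q j\<close> by (simp only: mult_ac)
    finally show ?thesis .
  qed
  have "lc k j = lc k l \<or> lc l j = lc k l"
    by (rule lca_exchange) (use ijkl vert_Suc in auto)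
  then show ?thesis
  proof
    assume "lc k j = lc k l" then show ?thesis using main[of k l] ijkl by blast
  next
    assume 1: "lc l j = lc k l"
    have 2: "lc l k = lc k l" using lca_commute by metis
    have "K $$ (i, j) * q l * q k = K $$ (l, k) * q i * q j"
      by (rule main) (use 1 2 ijkl in auto)
    then show ?thesis using Ksym[of l k] ijkl by (simp add: mult_ac)
  qed
qed

text \<open>
  The coordinate of an unordered pair of leaves.
\<close>
definition pr :: "nat \<Rightarrow> nat \<Rightarrow> idx" where "pr i j = Idx (min i j) (max i j)"

lemma pr_commute: "pr i j = pr j i" by (simp add: pr_def min.commute max.commute)

text \<open>
  A symmetric matrix \<open>K\<close> has the coordinates \<open>p\<^sub>i\<^sub>j = - K\<^sub>i\<^sub>j\<close> and \<open>p\<^sub>0\<^sub>i\<close>, the sum of row \<open>i\<close>, as if \<open>K\<close> were the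
  weighted Laplacian of the complete graph on all leaves, with row and column of the root removed. The
  two functions are inverse to each other (\<open>p_of_K_of\<close>, \<open>K_of_p_of\<close>).
\<close>
definition K_of :: "(idx \<Rightarrow> 'a::comm_ring_1) \<Rightarrow> 'a mat" where
  "K_of p = mat n n (\<lambda>(i, j). if i = j then \<Sum>m\<in>{..n} - {Suc i}. p (pr (Suc i) m) else - p (pr (Suc i) (Suc j)))"

definition p_of :: "'a::comm_ring_1 mat \<Rightarrow> idx \<Rightarrow> 'a" where
  "p_of K c = (case c of Idx i j \<Rightarrow> if i = 0 then \<Sum>m<n. K $$ (j - 1, m) else - K $$ (i - 1, j - 1))"

lemma K_of_carrier [simp]: "K_of p \<in> carrier_mat n n" by (simp add: K_of_def)

lemma K_of_index:
  "i < n \<Longrightarrow> j < n \<Longrightarrow> i \<noteq> j \<Longrightarrow> K_of p $$ (i, j) = - p (pr (Suc i) (Suc j))"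
  "i < n \<Longrightarrow> K_of p $$ (i, i) = (\<Sum>m\<in>{..n} - {Suc i}. p (pr (Suc i) m))"
  by (simp_all add: K_of_def)

lemma sum_leaves_but:
  assumes "i < n"
  shows "(\<Sum>m\<in>{..n} - {Suc i}. F m) = F 0 + (\<Sum>m\<in>{..<n} - {i}. F (Suc m))"
proof -
  have "{..n} - {Suc i} = insert 0 (Suc ` ({..<n} - {i}))"
    unfolding lessThan_Suc_atMost[symmetric] lessThan_Suc_eq_insert_0
    by (simp add: insert_Diff_if image_set_diff)
  then show ?thesis by (simp add: sum.reindex)
qed

lemma K_of_row_sum:
  assumes "i < n" shows "(\<Sum>m<n. K_of p $$ (i, m)) = p (Idx 0 (Suc i))"
proof -
  have "(\<Sum>m<n. K_of p $$ (i, m)) = K_of p $$ (i, i) + (\<Sum>m\<in>{..<n} - {i}. K_of p $$ (i, m))"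
    using assms by (intro sum.remove) auto
  also have "(\<Sum>m\<in>{..<n} - {i}. K_of p $$ (i, m)) = (\<Sum>m\<in>{..<n} - {i}. - p (pr (Suc i) (Suc m)))"
    using assms by (intro sum.cong) (auto simp: K_of_index)
  finally show ?thesis
    using assms by (simp add: K_of_index sum_leaves_but sum_negf pr_def)
qed

lemma K_of_symmetric: "transpose_mat (K_of p) = K_of p"
  by (rule eq_matI) (auto simp: K_of_def pr_commute)

lemma p_of_K_of: "c \<in> leaf_pairs n \<Longrightarrow> p_of (K_of p) c = p c"
proof -
  assume "c \<in> leaf_pairs n"
  then obtain i j where c: "c = Idx i j" "i < j" "j \<le> n" by (auto simp: leaf_pairs_def)
  show ?thesis
  proof (cases "i = 0")
    case True
    then show ?thesis using c K_of_row_sum[of "j - 1" p] by (simp add: p_of_def)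
  next
    case False
    then show ?thesis using c K_of_index(1)[of "i - 1" "j - 1" p] by (simp add: p_of_def pr_def)
  qed
qed

lemma p_of_pr:
  assumes "transpose_mat K = K" "K \<in> carrier_mat n n" "i < n" "j < n" "i \<noteq> j"
  shows "p_of K (pr (Suc i) (Suc j)) = - K $$ (i, j)"
proof -
  have "K $$ (i, j) = K $$ (j, i)" using assms by (metis carrier_matD index_transpose_mat(1))
  then show ?thesis by (auto simp: p_of_def pr_def min_def max_def)
qed

lemma K_of_p_of:
  fixes K :: "'f::comm_ring_1 mat"
  assumes K: "transpose_mat K = K" "K \<in> carrier_mat n n"
  shows "K_of (p_of K) = K"
proof (rule eq_matI)
  fix i j assume "i < dim_row K" "j < dim_col K"
  then have ij: "i < n" "j < n" using K by auto
  show "K_of (p_of K) $$ (i, j) = K $$ (i, j)"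
  proof (cases "i = j")
    case True
    have "(\<Sum>m\<in>{..<n} - {i}. p_of K (pr (Suc i) (Suc m))) = (\<Sum>m\<in>{..<n} - {i}. - K $$ (i, m))"
      using ij by (intro sum.cong p_of_pr[OF K]) auto
    moreover have "(\<Sum>m<n. K $$ (i, m)) = K $$ (i, i) + (\<Sum>m\<in>{..<n} - {i}. K $$ (i, m))"
      using ij by (intro sum.remove) auto
    ultimately show ?thesis
      using True ij by (simp add: K_of_index sum_leaves_but sum_negf) (simp add: p_of_def pr_def)
  qed (use ij p_of_pr[OF K] in \<open>simp add: K_of_index\<close>)
qed (use K in \<open>auto simp: K_of_def\<close>)

text \<open>
  Dividing the entry \<open>(i, j)\<close> of \<open>K_of p\<close> by \<open>p\<^sub>0\<^sub>i p\<^sub>0\<^sub>j\<close> gives a matrix \<open>M\<close> in the model, by the binomial equations.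
  Its inverse \<open>N\<close> has the row sums \<open>p\<^sub>0\<^sub>i\<close>, so \<open>inverse_binomial\<close> for \<open>M\<close> says that undoing the scaling of \<open>N\<close> gives a matrix
  in the model. Each leaf is a class of its own, which leaves only off-diagonal entries to compare.
\<close>
lemma inverse_in_space:
  fixes p :: "idx \<Rightarrow> 'f::field"
  assumes L: "L \<in> carrier_mat n n" "K_of p * L = 1\<^sub>m n" "L * K_of p = 1\<^sub>m n"
    and nz: "\<And>i. i < n \<Longrightarrow> p (Idx 0 (Suc i)) \<noteq> 0"
    and bin: "\<And>i j k l. i < n \<Longrightarrow> j < n \<Longrightarrow> k < n \<Longrightarrow> l < n \<Longrightarrow> i \<noteq> j \<Longrightarrow> k \<noteq> l \<Longrightarrow> lc i j = lc k l \<Longrightarrow>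
      p (pr (Suc i) (Suc j)) * p (Idx 0 (Suc k)) * p (Idx 0 (Suc l)) =
      p (pr (Suc k) (Suc l)) * p (Idx 0 (Suc i)) * p (Idx 0 (Suc j))"
  shows "L \<in> bmt_space n T"
proof (rule bmt_spaceI[OF L(1)])
  let ?q = "\<lambda>i. p (Idx 0 (Suc i))" and ?K = "K_of p"
  define M where "M = mat n n (\<lambda>(i, j). ?K $$ (i, j) / (?q i * ?q j))"
  define N where "N = mat n n (\<lambda>(i, j). ?q i * L $$ (i, j) * ?q j)"
  have Mc: "M \<in> carrier_mat n n" and Nc: "N \<in> carrier_mat n n" by (simp_all add: M_def N_def)
  have MN: "M * N = 1\<^sub>m n"
  proof (rule eq_matI)
    fix i j assume "i < dim_row (1\<^sub>m n :: 'f mat)" "j < dim_col (1\<^sub>m n :: 'f mat)"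
    then have ij: "i < n" "j < n" by auto
    have "(M * N) $$ (i, j) = (\<Sum>k<n. ?K $$ (i, k) / (?q i * ?q k) * (?q k * L $$ (k, j) * ?q j))"
      unfolding mat_mult_index[OF Mc Nc ij] using ij by (intro sum.cong) (auto simp: M_def N_def)
    also have "\<dots> = (\<Sum>k<n. ?q j / ?q i * (?K $$ (i, k) * L $$ (k, j)))"
      using nz ij by (intro sum.cong) (auto simp: field_simps)
    also have "\<dots> = ?q j / ?q i * (?K * L) $$ (i, j)"
      unfolding mat_mult_index[OF K_of_carrier L(1) ij] by (simp add: sum_distrib_left)
    also have "\<dots> = 1\<^sub>m n $$ (i, j)" using L(2) ij nz by simp
    finally show "(M * N) $$ (i, j) = 1\<^sub>m n $$ (i, j)" .
  qed (use Mc Nc in auto)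
  have NM: "N * M = 1\<^sub>m n" by (rule mat_mult_left_right_inverse[OF Mc Nc MN])
  have Mij: "M $$ (i, j) = - (p (pr (Suc i) (Suc j)) / (?q i * ?q j))" if "i < n" "j < n" "i \<noteq> j" for i j
    using that by (simp add: M_def K_of_index)
  have M: "M \<in> bmt_space n T"
  proof (rule bmt_spaceI[OF Mc])
    fix i j k l assume a: "i < n" "j < n" "k < n" "l < n" "lc i j = lc k l"
    show "M $$ (i, j) = M $$ (k, l)"
    proof (cases "i = j")
      case True
      then have "k = i" "l = i" using a lc_self[of i] lc_leaf[of k l i] by auto
      then show ?thesis using True by simp
    next
      case False
      then have "k \<noteq> l" using a lc_leaf[of i j k] lc_self[of k] by auto
      then show ?thesis
        using Mij[OF a(1,2) False] Mij[OF a(3,4)] bin[OF a(1-4) False _ a(5)] nz a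
        by (simp add: frac_eq_eq mult_ac)
    qed
  qed
  have row: "(\<Sum>m<n. N $$ (i, m)) = ?q i" if i: "i < n" for i
  proof -
    have "(\<Sum>m<n. N $$ (i, m)) = (\<Sum>m<n. ?q i * L $$ (i, m) * (\<Sum>k<n. ?K $$ (m, k)))"
      using i by (intro sum.cong refl) (auto simp: N_def K_of_row_sum)
    also have "\<dots> = ?q i * (\<Sum>k<n. \<Sum>m<n. L $$ (i, m) * ?K $$ (m, k))"
      by (subst sum.swap) (simp add: sum_distrib_left mult.assoc)
    also have "\<dots> = ?q i * (\<Sum>k<n. (L * ?K) $$ (i, k))"
      using i by (auto intro!: arg_cong2[where f = times] sum.cong mat_mult_index[OF L(1) K_of_carrier, symmetric])
    also have "\<dots> = ?q i" using i by (simp add: L(3))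
    finally show ?thesis .
  qed
  fix i j k l assume a: "i < n" "j < n" "k < n" "l < n" "lc i j = lc k l"
  show "L $$ (i, j) = L $$ (k, l)"
  proof (cases "i = j")
    case True
    then have "k = i" "l = i" using a lc_self[of i] lc_leaf[of k l i] by auto
    then show ?thesis using True by simp
  next
    case False
    then have "k \<noteq> l" using a lc_leaf[of i j k] lc_self[of k] by auto
    from inverse_binomial[OF M Nc MN NM a(1-4) False this a(5)]
    have "N $$ (i, j) * ?q k * ?q l = N $$ (k, l) * ?q i * ?q j" using row a by simp
    then show ?thesis using a nz by (simp add: N_def)
  qed
qed

end

section \<open>The toric ideal as a vanishing ideal\<close>

text \<open>
  Compare the coefficients of each monomial.
\<close>
lemma grouped_sum_zero:
  fixes f :: "'m \<Rightarrow> 'b::comm_monoid_add"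
  assumes "finite M"
  shows "(\<Sum>m\<in>M. Poly_Mapping.single (S m) (f m)) = 0 \<longleftrightarrow> (\<forall>m0\<in>M. (\<Sum>m\<in>{m\<in>M. S m = S m0}. f m) = 0)"
proof -
  have l: "Poly_Mapping.lookup (\<Sum>m\<in>M. Poly_Mapping.single (S m) (f m)) e = (\<Sum>m\<in>{m\<in>M. S m = e}. f m)" for e
    using assms by (simp add: lookup_sum lookup_single when_def sum.inter_filter)
  show ?thesis
  proof
    assume "(\<Sum>m\<in>M. Poly_Mapping.single (S m) (f m)) = 0"
    then show "\<forall>m0\<in>M. (\<Sum>m\<in>{m\<in>M. S m = S m0}. f m) = 0" using l by (metis lookup_zero)
  next
    assume r: "\<forall>m0\<in>M. (\<Sum>m\<in>{m\<in>M. S m = S m0}. f m) = 0"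
    show "(\<Sum>m\<in>M. Poly_Mapping.single (S m) (f m)) = 0"
    proof (rule poly_mapping_eqI)
      fix e
      show "Poly_Mapping.lookup (\<Sum>m\<in>M. Poly_Mapping.single (S m) (f m)) e = Poly_Mapping.lookup 0 e"
      proof (cases "e \<in> S ` M")
        case True then show ?thesis unfolding l using r by auto
      next
        case False
        then have "{m \<in> M. S m = e} = {}" by auto
        then show ?thesis unfolding l by (simp only: sum.empty lookup_zero)
      qed
    qed
  qed
qed

lemma psubst_monomials:
  fixes E :: "'c \<Rightarrow> 'm::comm_monoid_add"
  shows "psubst (Poly_Mapping.single 0) (\<lambda>c. Poly_Mapping.single (E c) 1) f =
    (\<Sum>m\<in>Poly_Mapping.keys f. Poly_Mapping.single
       (\<Sum>c\<in>Poly_Mapping.keys m. \<Sum>i<Poly_Mapping.lookup m c. E c) (Poly_Mapping.lookup f m))"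
proof -
  have pow: "Poly_Mapping.single e (1::complex) ^ k = Poly_Mapping.single (\<Sum>i<k. e) 1" for e :: 'm and k
    by (induction k) (auto simp: mult_single add.commute)
  have prd: "(\<Prod>c\<in>F. Poly_Mapping.single (G c) (1::complex)) = Poly_Mapping.single (\<Sum>c\<in>F. G c) 1"
    for F and G :: "'c \<Rightarrow> 'm"
    by (induction F rule: infinite_finite_induct) (auto simp: mult_single)
  show ?thesis
    by (simp add: psubst_def pow prd mult_single)
qed

text \<open>
  For given coefficients, membership in the toric ideal depends only on which monomials have the same
  image, and the images are equal as Laurent monomials if and only if they are equal as monomials.
\<close>
lemma toric_ideal_eq_vanishing_ideal:
  assumes "\<And>v c. v \<in> R \<Longrightarrow> c \<in> C \<Longrightarrow> A v c \<ge> 0"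
    and z: "\<And>c. c \<in> C \<Longrightarrow> z c = Poly_Mapping.single (\<Sum>v\<in>R. Poly_Mapping.single v (nat (A v c))) 1"
  shows "toric_ideal R C A = vanishing_ideal C z"
proof -
  have PC: "PConst = Poly_Mapping.single 0" by (simp add: PConst_def fun_eq_iff)
  have "psubst (Poly_Mapping.single 0) (toric_monomial R A) f = 0 \<longleftrightarrow> psubst PConst z f = 0"
    if f: "f \<in> poly_ring C" for f
  proof -
    define E where "E c = (\<Sum>v\<in>R. Poly_Mapping.single v (A v c))" for c
    define E' where "E' c = (\<Sum>v\<in>R. Poly_Mapping.single v (nat (A v c)))" for c
    let ?S = "\<lambda>m. \<Sum>c\<in>Poly_Mapping.keys m. \<Sum>i<Poly_Mapping.lookup m c. E c"
    let ?S' = "\<lambda>m. \<Sum>c\<in>Poly_Mapping.keys m. \<Sum>i<Poly_Mapping.lookup m c. E' c"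
    have l: "Poly_Mapping.lookup (E c) v = int (Poly_Mapping.lookup (E' c) v)" if "c \<in> C" for c v
      using assms(1)[OF _ that] unfolding E_def E'_def
      by (auto simp: lookup_sum lookup_single when_def intro!: sum.cong)
    have L: "Poly_Mapping.lookup (?S m) v = int (Poly_Mapping.lookup (?S' m) v)"
      if "m \<in> Poly_Mapping.keys f" for m v
    proof -
      have "c \<in> C" if "c \<in> Poly_Mapping.keys m" for c
        using f that \<open>m \<in> Poly_Mapping.keys f\<close> by (auto simp: poly_ring_def)
      then show ?thesis by (simp add: lookup_sum l)
    qed
    have S: "?S m = ?S m' \<longleftrightarrow> ?S' m = ?S' m'" if "m \<in> Poly_Mapping.keys f" "m' \<in> Poly_Mapping.keys f" for m m'
      using L[OF that(1)] L[OF that(2)] unfolding poly_mapping_eq_iff fun_eq_iff by simp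
    have 1: "psubst PConst z f = psubst (Poly_Mapping.single 0) (\<lambda>c. Poly_Mapping.single (E' c) 1) f"
      unfolding PC E'_def by (rule psubst_cong[OF f z])
    have 2: "toric_monomial R A = (\<lambda>c. Poly_Mapping.single (E c) 1)"
      by (simp add: toric_monomial_def fun_eq_iff E_def)
    have "{m \<in> Poly_Mapping.keys f. ?S m = ?S m0} = {m \<in> Poly_Mapping.keys f. ?S' m = ?S' m0}"
      if "m0 \<in> Poly_Mapping.keys f" for m0 using S that by blast
    then show ?thesis
      unfolding 1 2 psubst_monomials grouped_sum_zero[OF finite_keys] by simp
  qed
  then show ?thesis unfolding toric_ideal_def vanishing_ideal_def by blast
qed

section \<open>The toric model of a tree\<close>

lemma det_poly_ring:
  assumes "M \<in> carrier_mat n n" "\<And>i j. i < n \<Longrightarrow> j < n \<Longrightarrow> M $$ (i, j) \<in> poly_ring X"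
  shows "det M \<in> poly_ring X"
  unfolding det_def'[OF assms(1)]
proof (intro poly_ring_sum poly_ring_mult poly_ring_prod)
  fix p i assume "p \<in> {p. p permutes {0..<n}}" "i \<in> {0..<n}"
  then have "p i < n" "i < n" using permutes_in_image[of p "{0..<n}" i] by auto
  then show "M $$ (i, p i) \<in> poly_ring X" using assms(2) by blast
qed simp

lemma finite_leaf_pairs: "finite (leaf_pairs n)"
proof -
  have "leaf_pairs n \<subseteq> (\<lambda>(i, j). Idx i j) ` ({..n} \<times> {..n})" by (auto simp: leaf_pairs_def)
  then show ?thesis by (rule finite_subset) simp
qed

context leaf_tree
begin

abbreviation "R \<equiv> tree_rows T"
abbreviation "C \<equiv> leaf_pairs n"
abbreviation "A \<equiv> tree_matrix T"

text \<open>
  The parametrization of the toric variety: for a pair with the root the lowest common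
  ancestor is the root, which has no row and no parameter.
\<close>
fun zt :: "idx \<Rightarrow> nat mpoly" where
  "zt (Idx i j) = (if i = 0 then PVar j else PVar i * PVar j * PVar (lca T i j))"

lemma finite_R: "finite R"
  using finite_verts by (simp add: tree_rows_def)

lemma leaf_row: "1 \<le> i \<Longrightarrow> i \<le> n \<Longrightarrow> i \<in> R"
  using leaf_vert by (simp add: tree_rows_def)

lemma lca_row: "1 \<le> i \<Longrightarrow> i < j \<Longrightarrow> j \<le> n \<Longrightarrow> lca T i j \<in> R"
  using lca_vert[of i j] leaf_vert lca_not_leaf[of i j] by (simp add: tree_rows_def)

lemma row_cases:
  assumes "v \<in> R"
  obtains (leaf) i where "i < n" "v = Suc i" | (internal) i j where "i < j" "j < n" "v = lc i j" "v > n"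
proof -
  have v: "v \<in> verts T" "v \<noteq> 0" using assms by (auto simp: tree_rows_def)
  show ?thesis
  proof (cases "v \<le> n")
    case True
    then show ?thesis using leaf[of "v - 1"] v by simp
  next
    case False
    then obtain i j where "1 \<le> i" "i < j" "j \<le> n" "lca T i j = v" using internal_is_lca[OF v] by auto
    then show ?thesis using internal[of "i - 1" "j - 1"] False by simp
  qed
qed

lemma zt_toric:
  assumes "c \<in> C"
  shows "zt c = Poly_Mapping.single (\<Sum>v\<in>R. Poly_Mapping.single v (nat (A v c))) 1"
proof -
  obtain i j where c: "c = Idx i j" "i < j" "j \<le> n" using assms by (auto simp: leaf_pairs_def)
  have j: "j \<in> R" using c leaf_row by simp
  have l: "Poly_Mapping.lookup (\<Sum>v\<in>R. Poly_Mapping.single v (nat (A v c))) x = (if x \<in> R then nat (A x c) else 0)" for x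
    using finite_R by (simp add: lookup_sum lookup_single when_def)
  show ?thesis
  proof (cases "i = 0")
    case True
    have "lca T 0 j = 0" using lca_root leaf_vert c by simp
    then have "(\<Sum>v\<in>R. Poly_Mapping.single v (nat (A v c))) = Poly_Mapping.single j 1"
      by (intro poly_mapping_eqI, unfold l) (use j c True in \<open>auto simp: lookup_single when_def tree_rows_def\<close>)
    then show ?thesis using True c by (simp add: PVar_def)
  next
    case False
    have i: "i \<in> R" and m: "lca T i j \<in> R" and g: "lca T i j > n"
      using c False leaf_row lca_row lca_not_leaf[of i j] by auto
    have "(\<Sum>v\<in>R. Poly_Mapping.single v (nat (A v c))) =
      Poly_Mapping.single i 1 + Poly_Mapping.single j 1 + Poly_Mapping.single (lca T i j) 1"
      by (intro poly_mapping_eqI, unfold l) (use i j m g c in \<open>auto simp: lookup_add lookup_single when_def\<close>)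
    then show ?thesis using False c by (simp add: PVar_def mult_single)
  qed
qed

lemma toric_ideal_zt: "toric_ideal R C A = vanishing_ideal C zt"
proof (rule toric_ideal_eq_vanishing_ideal[OF _ zt_toric])
  show "A v c \<ge> 0" for v c by (cases c) simp
qed

lemma zt_poly_ring: "c \<in> C \<Longrightarrow> zt c \<in> poly_ring R"
proof -
  assume "c \<in> C"
  then obtain i j where c: "c = Idx i j" "i < j" "j \<le> n" by (auto simp: leaf_pairs_def)
  then show ?thesis using leaf_row[of i] leaf_row[of j] lca_row[of i j] by (auto intro!: poly_ring_mult)
qed

sublocale P: projection R C R A zt
  by unfold_locales (auto simp: finite_R finite_leaf_pairs zt_poly_ring)

lemma I_eq: "P.I = toric_ideal R C A"
  by (simp add: P.I_def toric_ideal_zt)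

lemma eqs_eq: "P.eqs u = toric_ideal R C A \<union> linear_forms R C A u"
  by (simp add: P.eqs_def I_eq)

lemma pr_in: "i \<le> n \<Longrightarrow> j \<le> n \<Longrightarrow> i \<noteq> j \<Longrightarrow> pr i j \<in> C"
  by (auto simp: pr_def leaf_pairs_def min_def max_def)

lemma leaf_row_sum:
  fixes p :: "idx \<Rightarrow> 'a::comm_ring_1"
  assumes "i < n" shows "row_sums C A p (Suc i) = (\<Sum>m\<in>{..n} - {Suc i}. p (pr (Suc i) m))"
proof -
  let ?D = "pr (Suc i) ` ({..n} - {Suc i})"
  have sub: "?D \<subseteq> C" by (intro image_subsetI pr_in) (use assms in auto)
  have inj: "inj_on (pr (Suc i)) ({..n} - {Suc i})"
    by (rule inj_onI) (auto simp: pr_def min_def max_def split: if_splits)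
  have A: "A (Suc i) c = (if c \<in> ?D then 1 else 0)" if cC: "c \<in> C" for c
  proof -
    obtain k l where c: "c = Idx k l" "k < l" "l \<le> n" using cC by (auto simp: leaf_pairs_def)
    have "lca T k l \<noteq> Suc i"
      using lca_root[of l] leaf_vert[of l] lca_not_leaf[of k l] c assms by (cases "k = 0") auto
    moreover have "c \<in> ?D \<longleftrightarrow> Suc i = k \<or> Suc i = l"
    proof
      assume "c \<in> ?D" then show "Suc i = k \<or> Suc i = l" using c by (auto simp: pr_def min_def max_def split: if_splits)
    next
      assume "Suc i = k \<or> Suc i = l"
      then show "c \<in> ?D"
      proof
        assume "Suc i = k"
        then show ?thesis using c by (intro image_eqI[of _ _ l]) (auto simp: pr_def)
      next
        assume "Suc i = l"
        then show ?thesis using c by (intro image_eqI[of _ _ k]) (auto simp: pr_def)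
      qed
    qed
    ultimately show ?thesis using c by auto
  qed
  have "row_sums C A p (Suc i) = (\<Sum>c\<in>C. if c \<in> ?D then p c else 0)"
    unfolding row_sums_def using A by (intro sum.cong) auto
  also have "\<dots> = (\<Sum>c\<in>?D. p c)"
    using sub finite_leaf_pairs[of n] by (simp add: sum.inter_restrict[symmetric] Int_absorb1)
  also have "\<dots> = (\<Sum>m\<in>{..n} - {Suc i}. p (pr (Suc i) m))"
    using sum.reindex[OF inj, of p] by simp
  finally show ?thesis .
qed

lemma internal_row_sum:
  fixes p :: "idx \<Rightarrow> 'a::comm_ring_1"
  assumes "v > n"
  shows "row_sums C A p v = (\<Sum>(i, j)\<in>{(i, j). i < j \<and> j < n \<and> lc i j = v}. p (Idx (Suc i) (Suc j)))"
proof -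
  let ?S = "{(i, j). i < j \<and> j < n \<and> lc i j = v}" and ?f = "\<lambda>(i, j). Idx (Suc i) (Suc j)"
  have sub: "?f ` ?S \<subseteq> C" by (auto simp: leaf_pairs_def)
  have inj: "inj_on ?f ?S" by (rule inj_onI) auto
  have A: "A v c = (if c \<in> ?f ` ?S then 1 else 0)" if cC: "c \<in> C" for c
  proof -
    obtain k l where c: "c = Idx k l" "k < l" "l \<le> n" using cC by (auto simp: leaf_pairs_def)
    have "c \<in> ?f ` ?S \<longleftrightarrow> v = lca T k l"
    proof
      assume "v = lca T k l"
      moreover have "k \<noteq> 0"
      proof
        assume "k = 0"
        then show False using \<open>v = lca T k l\<close> lca_root[OF leaf_vert[OF c(3)]] assms by simp
      qed
      ultimately show "c \<in> ?f ` ?S" using c by (intro image_eqI[of _ _ "(k - 1, l - 1)"]) auto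
    qed (use c in auto)
    then show ?thesis using c assms by auto
  qed
  have "row_sums C A p v = (\<Sum>c\<in>C. if c \<in> ?f ` ?S then p c else 0)"
    unfolding row_sums_def using A by (intro sum.cong) auto
  also have "\<dots> = (\<Sum>c\<in>?f ` ?S. p c)"
    using sub finite_leaf_pairs[of n] by (simp add: sum.inter_restrict[symmetric] Int_absorb1)
  also have "\<dots> = (\<Sum>x\<in>?S. p (?f x))" using sum.reindex[OF inj, of p] by simp
  finally show ?thesis by (simp add: case_prod_beta)
qed

text \<open>
  Each internal vertex \<open>v\<close> has a pair \<open>rep v\<close> of leaves for which it is the lowest common ancestor; put \<open>b v\<close> there. The
  coordinates of the pairs with the root then correct the values at the leaves.
\<close>
lemma row_sums_surj:
  fixes b :: "nat \<Rightarrow> 'a::comm_ring_1"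
  shows "\<exists>u \<in> C \<rightarrow>\<^sub>E UNIV. \<forall>v\<in>R. row_sums C A u v = b v"
proof -
  define rep where "rep v = (SOME x. case x of (i, j) \<Rightarrow> i < j \<and> j < n \<and> lc i j = v)" for v
  have rep: "rep v \<in> {(i, j). i < j \<and> j < n \<and> lc i j = v}" if ij: "i < j" "j < n" "v = lc i j" for v i j
  proof -
    have "case rep v of (i, j) \<Rightarrow> i < j \<and> j < n \<and> lc i j = v"
      unfolding rep_def by (rule someI[of _ "(i, j)"]) (use ij in simp)
    then show ?thesis by simp
  qed
  define w :: "idx \<Rightarrow> 'a" where
    "w c = (case c of Idx i j \<Rightarrow> if rep (lca T i j) = (i - 1, j - 1) then b (lca T i j) else 0)" for c
  define u :: "idx \<Rightarrow> 'a" where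
    "u = (\<lambda>c\<in>C. case c of Idx i j \<Rightarrow> if i = 0 then b j - (\<Sum>m\<in>{..<n} - {j - 1}. w (pr j (Suc m))) else w c)"
  have u0: "u (Idx 0 (Suc i)) = b (Suc i) - (\<Sum>m\<in>{..<n} - {i}. w (pr (Suc i) (Suc m)))" if "i < n" for i
    using that by (simp add: u_def leaf_pairs_def)
  have u1: "u (Idx (Suc i) (Suc j)) = w (Idx (Suc i) (Suc j))" if "i < j" "j < n" for i j
    using that by (simp add: u_def leaf_pairs_def)
  have "row_sums C A u v = b v" if v: "v \<in> R" for v
    using v
  proof (cases rule: row_cases)
    case (leaf i)
    have "(\<Sum>m\<in>{..<n} - {i}. u (pr (Suc i) (Suc m))) = (\<Sum>m\<in>{..<n} - {i}. w (pr (Suc i) (Suc m)))"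
      using leaf u1 by (intro sum.cong) (auto simp: pr_def min_def max_def)
    then show ?thesis
      using leaf u0[of i] leaf_row_sum[of i u] by (simp add: sum_leaves_but) (simp add: pr_def)
  next
    case (internal i j)
    let ?S = "{(i, j). i < j \<and> j < n \<and> lc i j = v}"
    have fin: "finite ?S" by (rule finite_subset[of _ "{..<n} \<times> {..<n}"]) auto
    have "row_sums C A u v = (\<Sum>x\<in>?S. if x = rep v then b v else 0)"
      unfolding internal_row_sum[OF internal(4)]
    proof (intro sum.cong refl)
      fix x assume "x \<in> ?S"
      then obtain k l where x: "x = (k, l)" "k < l" "l < n" "lc k l = v" by auto
      have "u (Idx (Suc k) (Suc l)) = (if rep v = (k, l) then b v else 0)" using x by (simp add: u1 w_def)
      then show "(case x of (i, j) \<Rightarrow> u (Idx (Suc i) (Suc j))) = (if x = rep v then b v else 0)"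
        by (simp add: x eq_commute[of "(k, l)"])
    qed
    also have "\<dots> = b v" using rep[OF internal(1,2,3)] fin by simp
    finally show ?thesis .
  qed
  moreover have "u \<in> C \<rightarrow>\<^sub>E UNIV" by (simp add: u_def)
  ultimately show ?thesis by blast
qed

lemma n_pos: "n > 0"
proof -
  have "vdeg T 0 = 1" using leaf_vdeg by simp
  then have "out_degree T 0 \<noteq> 0" using in_degree_root by (simp add: vdeg_def)
  then obtain e where e: "e \<in> arcs T" unfolding out_degree_0_iff by blast
  obtain l where "1 \<le> l" "l \<le> n"
    using leaf_below[OF head_in_verts[OF e] no_arc_into_root[OF e]] by metis
  then show ?thesis by simp
qed

lemma map_K_of: "comm_ring_hom H \<Longrightarrow> map_mat H (K_of p) = K_of (\<lambda>c. H (p c))"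
proof -
  assume "comm_ring_hom H"
  then interpret H: comm_ring_hom H .
  show ?thesis by (rule eq_matI) (auto simp: K_of_def H.hom_sum H.hom_uminus)
qed

lemma det_K_of: "comm_ring_hom H \<Longrightarrow> H (det (K_of p)) = det (K_of (\<lambda>c. H (p c)))"
  using comm_ring_hom.hom_det[of H "K_of p"] map_K_of[of H p] by simp

lemma K_of_cong:
  assumes "\<And>c. c \<in> C \<Longrightarrow> p c = p' c" shows "K_of p = K_of p'"
proof -
  have "p (pr i j) = p' (pr i j)" if "i \<le> n" "j \<le> n" "i \<noteq> j" for i j by (rule assms[OF pr_in[OF that]])
  then show ?thesis unfolding K_of_def by (intro cong_mat) (auto intro!: sum.cong)
qed

lemma det_K_of_poly_ring: "det (K_of PVar) \<in> poly_ring C"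
proof -
  have "K_of PVar $$ (i, j) \<in> poly_ring C" if "i < n" "j < n" for i j
    using that by (auto simp: K_of_def intro!: poly_ring_closed pr_in)
  then show ?thesis by (rule det_poly_ring[OF K_of_carrier])
qed

lemma lca_min_max: "lca T (min i j) (max i j) = lca T i j"
  using lca_commute[of i j] by (cases "i \<le> j") (simp_all add: min_def max_def)

lemma zt_pr: "zt (pr (Suc i) (Suc j)) = PVar (Suc i) * PVar (Suc j) * PVar (lc i j)"
proof -
  have "PVar (min (Suc i) (Suc j)) * PVar (max (Suc i) (Suc j)) = (PVar (Suc i) * PVar (Suc j) :: nat mpoly)"
    by (cases "i \<le> j") (simp_all add: min_def max_def mult.commute)
  then show ?thesis by (simp add: pr_def lca_min_max del: min_Suc_Suc max_Suc_Suc)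
qed

text \<open>
  The function that must not vanish on the fibres: outside its zeros the coordinates and their sum are
  nonzero, as the critical points of the toric model require, and \<open>K_of p\<close> is invertible.
\<close>
definition boundary_poly :: "idx mpoly" where
  "boundary_poly = (\<Prod>c\<in>C. PVar c) * det (K_of PVar) * (\<Sum>c\<in>C. PVar c)"

lemma boundary_poly_in: "boundary_poly \<in> poly_ring C"
  unfolding boundary_poly_def by (intro poly_ring_closed det_K_of_poly_ring) auto

text \<open>
  For the determinant set the parameters of the leaves to 1 and those of the internal vertices to 0; then \<open>K_of\<close> is the
  identity matrix.
\<close>
lemma boundary_poly_notin: "boundary_poly \<notin> P.I"
proof -
  interpret Z: comm_ring_hom "psubst PConst zt" by (rule comm_ring_hom_psubst_PConst)
  have PV: "(PVar i :: nat mpoly) \<noteq> 0" for i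
  proof
    assume "(PVar i :: nat mpoly) = 0"
    then have "peval (PVar i) (\<lambda>_. 1) = 0" by (simp only: peval.hom_zero)
    then show False by simp
  qed
  have zv: "psubst PConst zt (PVar c) = zt c" for c by (rule psubst_PVar[OF comm_ring_hom_PConst])
  have 1: "zt c \<noteq> 0" for c by (cases c) (simp add: PV)
  have 2: "det (K_of zt) \<noteq> 0"
  proof
    assume "det (K_of zt) = 0"
    define \<tau> :: "nat \<Rightarrow> complex" where "\<tau> v = (if v \<le> n then 1 else 0)" for v
    have ev: "peval (zt (pr (Suc i) (Suc j))) \<tau> = 0" if "i < n" "j < n" "i \<noteq> j" for i j
      using lc_gt[OF that] unfolding zt_pr by (simp add: peval.hom_mult \<tau>_def)
    have ev0: "peval (zt (pr (Suc i) 0)) \<tau> = 1" if "i < n" for i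
      using that by (simp add: pr_def \<tau>_def)
    have "K_of (\<lambda>c. peval (zt c) \<tau>) = 1\<^sub>m n"
      by (rule eq_matI) (auto simp: K_of_def sum_leaves_but ev ev0 intro!: sum.neutral)
    then have "peval (det (K_of zt)) \<tau> = 1" by (simp add: det_K_of[OF comm_ring_hom_peval])
    then show False using \<open>det (K_of zt) = 0\<close> by simp
  qed
  have 3: "(\<Sum>c\<in>C. zt c) \<noteq> 0"
  proof
    assume 0: "(\<Sum>c\<in>C. zt c) = 0"
    have "peval (zt c) (\<lambda>_. 1) = 1" for c by (cases c) (simp add: peval.hom_mult)
    then have "peval (\<Sum>c\<in>C. zt c) (\<lambda>_. 1) = of_nat (card C)" by (simp add: peval.hom_sum)
    moreover have "card C \<noteq> 0" using finite_leaf_pairs[of n] n_pos by (auto simp: leaf_pairs_def)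
    ultimately show False using 0 by simp
  qed
  have "psubst PConst zt boundary_poly = (\<Prod>c\<in>C. zt c) * det (K_of zt) * (\<Sum>c\<in>C. zt c)"
    unfolding boundary_poly_def
    by (simp add: Z.hom_mult Z.hom_prod Z.hom_sum zv det_K_of[OF comm_ring_hom_psubst_PConst])
  then have "psubst PConst zt boundary_poly \<noteq> 0" using 1 2 3 finite_leaf_pairs[of n] by simp
  then show ?thesis by (simp add: P.I_def vanishing_ideal_def)
qed

text \<open>
  One number \<open>d\<close> and one polynomial \<open>h\<close> serve all three statements: \<open>A u\<close> is generic if \<open>h\<close> does not vanish there.
\<close>
definition good_data :: "nat \<Rightarrow> nat mpoly \<Rightarrow> bool" where
  "good_data d h \<longleftrightarrow> h \<in> poly_ring R \<and> h \<noteq> 0 \<and> (\<forall>u. peval h (row_sums C A u) \<noteq> 0 \<longrightarrow>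
      finite (zero_set C (P.eqs u)) \<and> card (zero_set C (P.eqs u)) = d \<and>
      (\<forall>a\<in>zero_set C (P.eqs u). peval boundary_poly a \<noteq> 0 \<and>
        (\<forall>c\<in>C. \<exists>w\<in>poly_ring C. peval w a \<noteq> 0 \<and>
          w * (PVar c - PConst (a c)) \<in> ideal_gen_in (poly_ring C) (P.eqs u))))"

lemma good_ex: "\<exists>d h. good_data d h"
proof -
  obtain d where d: "\<forall>g\<in>poly_ring C. g \<notin> P.I \<longrightarrow> (\<exists>h\<in>poly_ring R. h \<noteq> 0 \<and>
    (\<forall>u. peval h (row_sums C A u) \<noteq> 0 \<longrightarrow>
      finite (zero_set C (P.eqs u)) \<and> card (zero_set C (P.eqs u)) = d \<and>
      (\<forall>a\<in>zero_set C (P.eqs u). peval g a \<noteq> 0 \<and>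
        (\<forall>c\<in>C. \<exists>w\<in>poly_ring C. peval w a \<noteq> 0 \<and>
          w * (PVar c - PConst (a c)) \<in> ideal_gen_in (poly_ring C) (P.eqs u)))))"
    using P.generic_fibre by (rule exE)
  from mp[OF bspec[OF d boundary_poly_in] boundary_poly_notin] show ?thesis
    unfolding good_data_def by (elim bexE conjE) (intro exI conjI)
qed

context
  fixes d h
  assumes good: "good_data d h"
begin

lemma h_in: "h \<in> poly_ring R" and h_nz: "h \<noteq> 0"
  using good unfolding good_data_def by simp_all

context
  fixes u assumes nz: "peval h (row_sums C A u) \<noteq> 0"
begin

lemma fibre_finite: "finite (zero_set C (P.eqs u))"
  and fibre_card: "card (zero_set C (P.eqs u)) = d"
  and fibre_boundary_poly: "a \<in> zero_set C (P.eqs u) \<Longrightarrow> peval boundary_poly a \<noteq> 0"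
  and fibre_cert: "a \<in> zero_set C (P.eqs u) \<Longrightarrow> c \<in> C \<Longrightarrow> \<exists>w\<in>poly_ring C. peval w a \<noteq> 0 \<and>
          w * (PVar c - PConst (a c)) \<in> ideal_gen_in (poly_ring C) (P.eqs u)"
  using good nz unfolding good_data_def by simp_all

lemma fibre_coords:
  assumes "a \<in> zero_set C (P.eqs u)"
  shows "c \<in> C \<Longrightarrow> a c \<noteq> 0" "det (K_of a) \<noteq> 0" "(\<Sum>c\<in>C. a c) \<noteq> 0"
proof -
  have "peval boundary_poly a = (\<Prod>c\<in>C. a c) * det (K_of a) * (\<Sum>c\<in>C. a c)"
    by (simp add: boundary_poly_def peval.hom_mult peval.hom_prod peval.hom_sum det_K_of[OF comm_ring_hom_peval])
  then show "c \<in> C \<Longrightarrow> a c \<noteq> 0" "det (K_of a) \<noteq> 0" "(\<Sum>c\<in>C. a c) \<noteq> 0"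
    using fibre_boundary_poly[OF assms] finite_leaf_pairs[of n] by auto
qed

lemma toric_mult:
  assumes a: "a \<in> zero_set C (P.eqs u)"
  shows "has_mult C (of_poly ` P.eqs u) a 1"
proof (rule has_mult_1)
  show "of_poly ` P.eqs u \<subseteq> local_ring C a"
    using P.eqs_subset local_ring_of_poly by blast
  show "ev_at a g = 0" if "g \<in> of_poly ` P.eqs u" for g
    using that a by (auto simp: zero_set_def)
  fix c assume c: "c \<in> C"
  obtain w where w: "w \<in> poly_ring C" "peval w a \<noteq> 0"
    "w * (PVar c - PConst (a c)) \<in> ideal_gen_in (poly_ring C) (P.eqs u)" using fibre_cert[OF a c] by blast
  have "w \<noteq> 0" using w(2) by auto
  note O = local_ring_subring[of C a]
  have "of_poly (w * (PVar c - PConst (a c))) \<in> ideal_gen_in (local_ring C a) (of_poly ` P.eqs u)"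
    by (rule hom_on_ideal_gen[OF is_subring_poly_ring O hom_on_ring_hom[OF comm_ring_hom_of_poly] P.eqs_subset _ _ w(3)])
      (auto intro: local_ring_of_poly ideal_gen_gen[OF O])
  from ideal_gen_mult[OF O this local_ring_inverse_poly[OF w(1,2)]]
  show "of_poly (PVar c - PConst (a c)) \<in> ideal_gen_in (local_ring C a) (of_poly ` P.eqs u)"
    using \<open>w \<noteq> 0\<close> by (simp add: of_poly.hom_mult mult.assoc[symmetric])
qed

lemma toric_count: "has_count C (of_poly ` P.eqs u) (zero_set C (P.eqs u)) d"
  unfolding has_count_def
  using fibre_finite fibre_card toric_mult by (intro conjI exI[of _ "\<lambda>_. 1"]) auto

lemma toric_critical: "toric_critical_points R C A u = zero_set C (P.eqs u)"
  unfolding toric_critical_points_def toric_fibre_equations_def eqs_eq[symmetric]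
  using fibre_coords by blast

end

text \<open>
  By \<open>row_sums_surj\<close> the condition on \<open>A u\<close> is a nontrivial condition on \<open>u\<close>, and it is compatible with any other
  nontrivial condition \<open>k\<close>, since polynomials have no zero divisors.
\<close>
lemma nonvanishing_ex:
  assumes "k \<in> poly_ring C" "k \<noteq> 0"
  shows "\<exists>u\<in>C \<rightarrow>\<^sub>E UNIV. peval k u \<noteq> 0 \<and> peval h (row_sums C A u) \<noteq> 0"
    and "psubst PConst (row_sums C A PVar) h \<in> poly_ring C" "psubst PConst (row_sums C A PVar) h \<noteq> 0"
    and "peval (psubst PConst (row_sums C A PVar) h) u = peval h (row_sums C A u)"
proof -
  let ?f = "psubst PConst (row_sums C A PVar) h"
  show f: "?f \<in> poly_ring C" by (rule poly_ring_psubst[OF h_in P.row_sums_in])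
  have ev: "peval ?f u = peval h (row_sums C A u)" for u
    by (simp add: peval_psubst hom_row_sums[OF comm_ring_hom_peval])
  show "peval ?f u = peval h (row_sums C A u)" by (rule ev)
  obtain b where b: "peval h b \<noteq> 0" using nonzero_poly_nonvanishing[OF h_in h_nz] by blast
  obtain u where "\<forall>v\<in>R. row_sums C A u v = b v" using row_sums_surj[of b] by blast
  then have "peval h (row_sums C A u) = peval h b" by (intro peval_cong[OF h_in]) auto
  then show f0: "?f \<noteq> 0" using b ev[of u] by auto
  have "k * ?f \<in> poly_ring C" "k * ?f \<noteq> 0" using assms f f0 by (auto intro: poly_ring_mult)
  from nonzero_poly_nonvanishing[OF this]
  show "\<exists>u\<in>C \<rightarrow>\<^sub>E UNIV. peval k u \<noteq> 0 \<and> peval h (row_sums C A u) \<noteq> 0"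
    by (auto simp: peval.hom_mult ev)
qed

lemma generic_fibre_data:
  assumes "\<And>u. peval h (row_sums C A u) \<noteq> 0 \<Longrightarrow> Q u"
  shows "generic C Q"
  unfolding generic_def
  using nonvanishing_ex(2,3,4)[of 1] assms
  by (intro bexI[of _ "psubst PConst (row_sums C A PVar) h"]) auto

lemma toric_degree: "generic C (\<lambda>u. has_degree C (toric_ideal R C A \<union> linear_forms R C A u) d)"
  by (rule generic_fibre_data) (simp add: has_degree_def toric_count flip: eqs_eq)

lemma toric_ML_degree: "has_ML_degree R C A d"
  unfolding has_ML_degree_def toric_fibre_equations_def eqs_eq[symmetric]
  by (rule generic_fibre_data) (simp add: toric_critical toric_count)

end

end

section \<open>Inverses of matrices of polynomials\<close>

lemma mat_inv_eq:
  fixes M N :: "'f::field mat"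
  assumes M: "M \<in> carrier_mat n n" and N: "N \<in> carrier_mat n n" and MN: "M * N = 1\<^sub>m n"
  shows "mat_inv M = N"
proof -
  have NM: "N * M = 1\<^sub>m n" by (rule mat_mult_left_right_inverse[OF M N MN])
  have "M \<in> Units (ring_mat TYPE('f) n ())"
    unfolding Units_def using M N MN NM by (auto simp: ring_mat_def)
  then have "mat_inverse M \<noteq> None" using mat_inverse(1)[OF M, of "()"] by metis
  then obtain B where B: "mat_inverse M = Some B" by auto
  then have "B * M = 1\<^sub>m n" "B \<in> carrier_mat n n" using mat_inverse(2)[OF M] by auto
  note B' = this
  have "B = B * (M * N)" using MN B'(2) by simp
  also have "\<dots> = (B * M) * N" by (rule assoc_mult_mat[OF B'(2) M N, symmetric])
  also have "\<dots> = N" using B'(1) N by simp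
  finally have "B = N" .
  then show ?thesis using B by (simp add: mat_inv_def)
qed

lemma invertible_mat_iff:
  assumes "M \<in> carrier_mat n n"
  shows "invertible_mat M \<longleftrightarrow> (\<exists>N\<in>carrier_mat n n. M * N = 1\<^sub>m n \<and> N * M = 1\<^sub>m n)"
proof
  assume "invertible_mat M"
  then obtain N where N: "M * N = 1\<^sub>m (dim_row M)" "N * M = 1\<^sub>m (dim_row N)"
    unfolding invertible_mat_def inverts_mat_def by blast
  have "dim_col N = n" using arg_cong[OF N(1), of dim_col] assms by simp
  moreover have "dim_row N = n" using arg_cong[OF N(2), of dim_col] assms by simp
  ultimately show "\<exists>N\<in>carrier_mat n n. M * N = 1\<^sub>m n \<and> N * M = 1\<^sub>m n" using N assms by (intro bexI[of _ N]) auto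
next
  assume "\<exists>N\<in>carrier_mat n n. M * N = 1\<^sub>m n \<and> N * M = 1\<^sub>m n"
  then show "invertible_mat M" using assms unfolding invertible_mat_def inverts_mat_def by auto
qed

lemma det_nonzero_inverse:
  fixes M :: "'f::field mat"
  assumes M: "M \<in> carrier_mat n n" and d: "det M \<noteq> 0"
  shows "\<exists>N\<in>carrier_mat n n. M * N = 1\<^sub>m n \<and> N * M = 1\<^sub>m n"
proof -
  let ?N = "inverse (det M) \<cdot>\<^sub>m adj_mat M"
  note adj = adj_mat[OF M]
  have "inverse (det M) \<cdot>\<^sub>m (det M \<cdot>\<^sub>m 1\<^sub>m n) = 1\<^sub>m n"
    by (rule eq_matI) (use d in auto)
  then have "M * ?N = 1\<^sub>m n" "?N * M = 1\<^sub>m n"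
    using mult_smult_distrib[OF M adj(1)] mult_smult_assoc_mat[OF adj(1) M] adj(2,3) by simp_all
  then show ?thesis using adj(1) by (intro bexI[of _ ?N]) auto
qed

lemma inverse_det_nonzero:
  fixes M :: "'f::field mat"
  assumes "M \<in> carrier_mat n n" "N \<in> carrier_mat n n" "M * N = 1\<^sub>m n"
  shows "det M \<noteq> 0"
  using det_mult[OF assms(1,2)] assms(3) by auto

text \<open>
  The matrix whose entries are the \<open>n\<^sup>2\<close> variables, and the image of its inverse under a homomorphism \<open>\<phi>\<close>
  that does not kill the determinant. Writing the inverse as adjugate over determinant makes its
  entries elements of the local rings.
\<close>
definition generic_mat :: "nat \<Rightarrow> idx mpoly mat" where
  "generic_mat n = coord_mat n PVar"

definition inv_of :: "nat \<Rightarrow> (idx mpoly \<Rightarrow> 'f::field) \<Rightarrow> 'f mat" where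
  "inv_of n \<phi> = mat n n (\<lambda>ij. \<phi> (adj_mat (generic_mat n) $$ ij) / \<phi> (det (generic_mat n)))"

lemma generic_mat_carrier [simp]: "generic_mat n \<in> carrier_mat n n"
  by (simp add: generic_mat_def coord_mat_def)

lemma coord_mat_carrier [simp]: "coord_mat n a \<in> carrier_mat n n"
  by (simp add: coord_mat_def)

lemma inv_of_carrier [simp]: "inv_of n \<phi> \<in> carrier_mat n n"
  by (simp add: inv_of_def)

lemma map_generic_mat: "map_mat \<phi> (generic_mat n) = coord_mat n (\<lambda>x. \<phi> (PVar x))"
  by (rule eq_matI) (auto simp: generic_mat_def coord_mat_def)

lemma inv_of_inverse:
  assumes \<phi>: "comm_ring_hom \<phi>" and d: "\<phi> (det (generic_mat n)) \<noteq> 0"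
  shows "coord_mat n (\<lambda>x. \<phi> (PVar x)) * inv_of n \<phi> = 1\<^sub>m n" (is "?M * _ = _")
    and "inv_of n \<phi> * coord_mat n (\<lambda>x. \<phi> (PVar x)) = 1\<^sub>m n"
proof -
  interpret \<phi>: comm_ring_hom \<phi> by fact
  let ?G = "generic_mat n"
  note adj = adj_mat[OF generic_mat_carrier[of n]]
  show 1: "?M * inv_of n \<phi> = 1\<^sub>m n"
  proof (rule eq_matI)
    fix i j assume "i < dim_row (1\<^sub>m n :: 'a mat)" "j < dim_col (1\<^sub>m n :: 'a mat)"
    then have ij: "i < n" "j < n" by auto
    have "(?M * inv_of n \<phi>) $$ (i, j) = (\<Sum>k<n. \<phi> (?G $$ (i, k)) * (\<phi> (adj_mat ?G $$ (k, j)) / \<phi> (det ?G)))"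
      unfolding mat_mult_index[OF coord_mat_carrier inv_of_carrier ij]
      using ij by (intro sum.cong) (auto simp: inv_of_def generic_mat_def coord_mat_def)
    also have "\<dots> = \<phi> (\<Sum>k<n. ?G $$ (i, k) * adj_mat ?G $$ (k, j)) / \<phi> (det ?G)"
      by (simp add: \<phi>.hom_sum \<phi>.hom_mult sum_divide_distrib)
    also have "(\<Sum>k<n. ?G $$ (i, k) * adj_mat ?G $$ (k, j)) = (?G * adj_mat ?G) $$ (i, j)"
      by (rule mat_mult_index[OF generic_mat_carrier adj(1) ij, symmetric])
    also have "\<phi> \<dots> / \<phi> (det ?G) = 1\<^sub>m n $$ (i, j)"
      unfolding adj(2) using ij d by simp
    finally show "(?M * inv_of n \<phi>) $$ (i, j) = 1\<^sub>m n $$ (i, j)" .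
  qed (simp_all add: coord_mat_def inv_of_def)
  show "inv_of n \<phi> * ?M = 1\<^sub>m n"
    by (rule mat_mult_left_right_inverse[OF coord_mat_carrier inv_of_carrier 1])
qed

lemma det_generic_mat: "comm_ring_hom \<phi> \<Longrightarrow> \<phi> (det (generic_mat n)) = det (coord_mat n (\<lambda>x. \<phi> (PVar x)))"
  using comm_ring_hom.hom_det[of \<phi> "generic_mat n"] by (simp add: map_generic_mat)

lemma mat_coordsI [simp]: "Idx i j \<in> mat_coords n \<longleftrightarrow> i < n \<and> j < n"
  by (simp add: mat_coords_def)

lemma det_generic_in: "det (generic_mat n) \<in> poly_ring (mat_coords n)"
  by (rule det_poly_ring[OF generic_mat_carrier]) (simp add: generic_mat_def coord_mat_def)

lemma adj_generic_in:
  assumes "i < n" "j < n" shows "adj_mat (generic_mat n) $$ (i, j) \<in> poly_ring (mat_coords n)"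
proof -
  have c: "mat_delete (generic_mat n) j i \<in> carrier_mat (n - 1) (n - 1)"
    by (simp add: mat_delete_def generic_mat_def coord_mat_def)
  have "det (mat_delete (generic_mat n) j i) \<in> poly_ring (mat_coords n)"
    by (rule det_poly_ring[OF c]) (auto simp: mat_delete_def generic_mat_def coord_mat_def)
  moreover have "(- 1) ^ (j + i) \<in> poly_ring (mat_coords n)"
    by (intro poly_ring_power poly_ring_uminus poly_ring_1)
  ultimately show ?thesis
    using assms by (simp add: adj_mat_def cofactor_def generic_mat_def coord_mat_def poly_ring_mult)
qed

lemma mat_trace_mult:
  assumes "X \<in> carrier_mat n n" "E \<in> carrier_mat n n"
  shows "mat_trace (X * map_mat H E) = (\<Sum>i<n. \<Sum>k<n. X $$ (i, k) * H (E $$ (k, i)))"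
proof -
  have "mat_trace (X * map_mat H E) = (\<Sum>i<n. (X * map_mat H E) $$ (i, i))" using assms by (simp add: mat_trace_def)
  also have "\<dots> = (\<Sum>i<n. \<Sum>k<n. X $$ (i, k) * map_mat H E $$ (k, i))"
    by (intro sum.cong refl mat_mult_index) (use assms in auto)
  also have "\<dots> = (\<Sum>i<n. \<Sum>k<n. X $$ (i, k) * H (E $$ (k, i)))"
    using assms by (intro sum.cong refl) auto
  finally show ?thesis .
qed

abbreviation const :: "complex \<Rightarrow> idx ratfun" where "const c \<equiv> of_poly (PConst c)"

lemma comm_ring_hom_comp: "comm_ring_hom f \<Longrightarrow> comm_ring_hom g \<Longrightarrow> comm_ring_hom (\<lambda>x. f (g x))"
proof -
  assume "comm_ring_hom f" "comm_ring_hom g"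
  then interpret f: comm_ring_hom f + g: comm_ring_hom g .
  show ?thesis by unfold_locales (auto simp: f.hom_add f.hom_mult g.hom_add g.hom_mult)
qed

lemma comm_ring_hom_const: "comm_ring_hom const"
  by (rule comm_ring_hom_comp[OF comm_ring_hom_of_poly comm_ring_hom_PConst])

interpretation const: comm_ring_hom const by (rule comm_ring_hom_const)

lemma local_ring_inverse:
  assumes "r \<in> local_ring X a" "ev_at a r \<noteq> 0"
  shows "inverse r \<in> local_ring X a"
proof -
  obtain f g where fg: "r = of_poly f / of_poly g" "f \<in> poly_ring X" "g \<in> poly_ring X" "peval g a \<noteq> 0"
    using assms(1) unfolding local_ring_alt by blast
  then have "peval f a \<noteq> 0" using assms(2) by (simp add: ev_div[OF comm_ring_hom_peval])
  then have "of_poly g / of_poly f \<in> local_ring X a" using fg by (intro local_ringI)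
  then show ?thesis using fg by simp
qed

context leaf_tree
begin

lemma p_of_in_subring:
  assumes S: "is_subring S" and K: "\<And>i j. i < n \<Longrightarrow> j < n \<Longrightarrow> K $$ (i, j) \<in> S" and c: "c \<in> C"
  shows "p_of K c \<in> S"
proof -
  obtain i j where "c = Idx i j" "i < j" "j \<le> n" using c by (auto simp: leaf_pairs_def)
  then show ?thesis using K by (auto simp: p_of_def intro!: subring_sum[OF S] subring_uminus[OF S])
qed

lemma hom_on_p_of:
  assumes S: "is_subring S" and \<chi>: "hom_on S \<chi>" and K: "\<And>i j. i < n \<Longrightarrow> j < n \<Longrightarrow> K $$ (i, j) \<in> S"
    and K': "\<And>i j. i < n \<Longrightarrow> j < n \<Longrightarrow> \<chi> (K $$ (i, j)) = K' $$ (i, j)" and c: "c \<in> C"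
  shows "\<chi> (p_of K c) = p_of K' c"
proof -
  obtain i j where c: "c = Idx i j" "i < j" "j \<le> n" using c by (auto simp: leaf_pairs_def)
  have "\<chi> (\<Sum>m<n. K $$ (j - 1, m)) = (\<Sum>m<n. K' $$ (j - 1, m))"
    using hom_on_sum[OF S \<chi>, of "{..<n}" "\<lambda>m. K $$ (j - 1, m)"] K K' c by simp
  moreover have "\<chi> (- K $$ (i - 1, j - 1)) = - K' $$ (i - 1, j - 1)"
    using hom_on_uminus[OF S \<chi> K, of "i - 1" "j - 1"] K'[of "i - 1" "j - 1"] c by simp
  ultimately show ?thesis using c by (simp add: p_of_def)
qed

section \<open>The likelihood equations in terms of the toric coordinates\<close>

text \<open>
  The sum of the entries of \<open>K\<close> over one class of positions: the directional derivatives of the likelihood are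
  combinations of these (\<open>trace_tr\<close>).
\<close>
definition tr :: "nat \<Rightarrow> 'a::comm_ring_1 mat \<Rightarrow> 'a" where
  "tr v K = (\<Sum>i<n. \<Sum>j<n. if lc i j = v then K $$ (i, j) else 0)"

definition trace_factor :: "nat \<Rightarrow> int" where "trace_factor v = (if v \<le> n then 1 else - 2)"

text \<open>
  The class of a leaf \<open>i\<close> is one diagonal entry, which is the sum of all \<open>p\<close>-coordinates of pairs containing \<open>i\<close>. The
  class of an internal vertex contains each pair twice, with \<open>p\<^sub>i\<^sub>j = - K\<^sub>i\<^sub>j\<close>; hence the factor \<open>-2\<close>.
\<close>
lemma tr_row_sums:
  fixes K :: "'a::comm_ring_1 mat"
  assumes v: "v \<in> R" and K: "transpose_mat K = K" "K \<in> carrier_mat n n"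
  shows "of_int (trace_factor v) * row_sums C A (p_of K) v = tr v K"
  using v
proof (cases rule: row_cases)
  case (leaf i)
  have "row_sums C A (p_of K) v = K_of (p_of K) $$ (i, i)"
    using leaf by (simp add: leaf_row_sum K_of_index)
  then have 1: "row_sums C A (p_of K) v = K $$ (i, i)" by (simp add: K_of_p_of[OF K])
  have "tr v K = (\<Sum>a<n. if a = i then (\<Sum>b<n. if b = i then K $$ (i, i) else 0) else 0)"
    unfolding tr_def using leaf lc_leaf by (intro sum.cong refl) (auto intro!: sum.cong sum.neutral)
  also have "\<dots> = K $$ (i, i)" using leaf by simp
  finally show ?thesis using 1 leaf by (simp add: trace_factor_def)
next
  case (internal i0 j0)
  let ?P = "{..<n} \<times> {..<n}"
  let ?S = "{(i, j). i < j \<and> j < n \<and> lc i j = v}" and ?S' = "{(i, j). j < i \<and> i < n \<and> lc i j = v}"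
  have fin: "finite ?S" "finite ?S'" by (rule finite_subset[of _ ?P]; auto)+
  have "tr v K = (\<Sum>(i, j)\<in>?P. if lc i j = v then K $$ (i, j) else 0)"
    unfolding tr_def by (simp add: sum.cartesian_product)
  also have "\<dots> = (\<Sum>(i, j)\<in>?S \<union> ?S'. K $$ (i, j))"
  proof (rule sum.mono_neutral_cong_right)
    show "\<forall>x\<in>?P - (?S \<union> ?S'). (case x of (i, j) \<Rightarrow> if lc i j = v then K $$ (i, j) else 0) = 0"
    proof
      fix x assume x: "x \<in> ?P - (?S \<union> ?S')"
      obtain i j where ij: "x = (i, j)" by (cases x)
      have "lc i j \<noteq> v"
      proof
        assume "lc i j = v"
        then have "i = j" using x ij by auto
        then show False using \<open>lc i j = v\<close> lc_self[of i] x ij internal(4) by auto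
      qed
      then show "(case x of (i, j) \<Rightarrow> if lc i j = v then K $$ (i, j) else 0) = 0" using ij by simp
    qed
  qed auto
  also have "\<dots> = (\<Sum>(i, j)\<in>?S. K $$ (i, j)) + (\<Sum>(i, j)\<in>?S'. K $$ (i, j))"
    by (rule sum.union_disjoint[OF fin]) auto
  also have "(\<Sum>(i, j)\<in>?S'. K $$ (i, j)) = (\<Sum>(i, j)\<in>?S. K $$ (i, j))"
  proof (rule sum.reindex_bij_witness[of _ "\<lambda>(i, j). (j, i)" "\<lambda>(i, j). (j, i)"])
    have s: "K $$ (i, j) = K $$ (j, i)" if "i < n" "j < n" for i j
      using K that by (metis carrier_matD index_transpose_mat(1))
    show "(case (case x of (i, j) \<Rightarrow> (j, i)) of (i, j) \<Rightarrow> K $$ (i, j)) = (case x of (i, j) \<Rightarrow> K $$ (i, j))"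
      if "x \<in> ?S'" for x using that s by auto
    show "(case x of (i, j) \<Rightarrow> (j, i)) \<in> ?S" if "x \<in> ?S'" for x
      using that by (auto split: prod.splits) (metis lca_commute)
    show "(case x of (i, j) \<Rightarrow> (j, i)) \<in> ?S'" if "x \<in> ?S" for x
      using that by (auto split: prod.splits) (metis lca_commute)
  qed auto
  finally have tr: "tr v K = 2 * (\<Sum>(i, j)\<in>?S. K $$ (i, j))" by simp
  have "row_sums C A (p_of K) v = (\<Sum>(i, j)\<in>?S. - K $$ (i, j))"
    unfolding internal_row_sum[OF internal(4)] by (intro sum.cong refl) (auto simp: p_of_def)
  also have "\<dots> = - (\<Sum>(i, j)\<in>?S. K $$ (i, j))" by (simp add: case_prod_beta sum_negf)
  finally show ?thesis using tr internal(4) by (simp add: trace_factor_def)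
qed

definition class_indicator :: "nat \<Rightarrow> real mat" where
  "class_indicator v = mat n n (\<lambda>(i, j). if lc i j = v then 1 else 0)"

lemma class_indicator_in: "class_indicator v \<in> bmt_space n T"
  by (rule bmt_spaceI) (auto simp: class_indicator_def)

lemma trace_class_indicator:
  assumes "K \<in> carrier_mat n n" "H 0 = 0" "H 1 = (1::'a::comm_ring_1)"
  shows "mat_trace (K * map_mat H (class_indicator v)) = tr v K"
proof -
  have "K $$ (i, k) * H (class_indicator v $$ (k, i)) = (if lc i k = v then K $$ (i, k) else 0)" if "i < n" "k < n" for i k
    using that assms(2,3) lca_commute[of "Suc k" "Suc i"] by (simp add: class_indicator_def)
  then show ?thesis
    unfolding mat_trace_mult[OF assms(1) bmt_space_carrier[OF class_indicator_in]] tr_def by (intro sum.cong refl) auto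
qed

lemma trace_tr:
  fixes H :: "real \<Rightarrow> 'a::comm_ring_1"
  assumes E: "E \<in> bmt_space n T"
  shows "\<exists>e. \<forall>K\<in>carrier_mat n n. mat_trace (K * map_mat H E) = (\<Sum>v\<in>R. e v * tr v K)"
proof -
  define ent where "ent v = E $$ (SOME x. x \<in> {..<n} \<times> {..<n} \<and> lc (fst x) (snd x) = v)" for v
  have ent: "E $$ (k, i) = ent (lc i k)" if ik: "i < n" "k < n" for i k
  proof -
    let ?x = "SOME x. x \<in> {..<n} \<times> {..<n} \<and> lc (fst x) (snd x) = lc i k"
    have x: "?x \<in> {..<n} \<times> {..<n} \<and> lc (fst ?x) (snd ?x) = lc i k"
      by (rule someI[of _ "(i, k)"]) (use ik in simp)
    have "E $$ (k, i) = E $$ (fst ?x, snd ?x)"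
      by (rule bmt_space_eq[OF E]) (use x ik lca_commute[of "Suc k" "Suc i"] in \<open>auto simp: mem_Times_iff\<close>)
    then show ?thesis by (simp add: ent_def)
  qed
  have lcR: "lc i k \<in> R" if "i < n" "k < n" for i k
    using lca_vert[OF vert_Suc[OF that(1)] vert_Suc[OF that(2)]] lc_gt[OF that] lc_self[OF that(1)]
    by (cases "i = k") (auto simp: tree_rows_def)
  have "mat_trace (K * map_mat H E) = (\<Sum>v\<in>R. H (ent v) * tr v K)" if K: "K \<in> carrier_mat n n" for K :: "'a mat"
  proof -
    have "mat_trace (K * map_mat H E) = (\<Sum>i<n. \<Sum>k<n. K $$ (i, k) * H (ent (lc i k)))"
      unfolding mat_trace_mult[OF K bmt_space_carrier[OF E]] by (intro sum.cong refl) (simp add: ent)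
    also have "\<dots> = (\<Sum>i<n. \<Sum>k<n. \<Sum>v\<in>R. H (ent v) * (if lc i k = v then K $$ (i, k) else 0))"
    proof (intro sum.cong refl)
      fix i k assume "i \<in> {..<n}" "k \<in> {..<n}"
      then have "lc i k \<in> R" using lcR by simp
      have "(\<Sum>v\<in>R. H (ent v) * (if lc i k = v then K $$ (i, k) else 0)) =
        (\<Sum>v\<in>R. if lc i k = v then H (ent v) * K $$ (i, k) else 0)" by (intro sum.cong) auto
      also have "\<dots> = H (ent (lc i k)) * K $$ (i, k)" using \<open>lc i k \<in> R\<close> finite_R by simp
      finally show "K $$ (i, k) * H (ent (lc i k)) =
        (\<Sum>v\<in>R. H (ent v) * (if lc i k = v then K $$ (i, k) else 0))" by (simp add: mult.commute)
    qed
    also have "\<dots> = (\<Sum>i<n. \<Sum>v\<in>R. \<Sum>k<n. H (ent v) * (if lc i k = v then K $$ (i, k) else 0))"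
      by (intro sum.cong refl sum.swap)
    also have "\<dots> = (\<Sum>v\<in>R. \<Sum>i<n. \<Sum>k<n. H (ent v) * (if lc i k = v then K $$ (i, k) else 0))"
      by (rule sum.swap)
    also have "\<dots> = (\<Sum>v\<in>R. H (ent v) * tr v K)"
      by (simp add: tr_def sum_distrib_left)
    finally show ?thesis .
  qed
  then show ?thesis by (intro exI[of _ "\<lambda>v. H (ent v)"] ballI)
qed

text \<open>
  The inverse of a matrix in the model is parametrized by the monomials of the toric model: take the
  row sums of the inverse as parameters of the leaves and the quotients in \<open>inverse_binomial\<close> as parameters
  of the internal vertices. Values in any field are needed because the lemma is
  applied to the generic matrix of the model.
\<close>
lemma toric_ideal_vanishes_on_inverse:
  fixes M K :: "'f::field mat"
  assumes M: "M \<in> bmt_space n T" and K: "K \<in> carrier_mat n n" "M * K = 1\<^sub>m n"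
    and nz: "\<And>i. i < n \<Longrightarrow> (\<Sum>m<n. K $$ (i, m)) \<noteq> 0"
    and \<eta>: "comm_ring_hom \<eta>" and f: "f \<in> P.I"
  shows "psubst \<eta> (p_of K) f = 0"
proof -
  note Mc = bmt_space_carrier[OF M]
  have KM: "K * M = 1\<^sub>m n" by (rule mat_mult_left_right_inverse[OF Mc K])
  let ?q = "\<lambda>i. \<Sum>m<n. K $$ (i, m)"
  define rp where "rp v = (SOME x. x \<in> {..<n} \<times> {..<n} \<and> fst x \<noteq> snd x \<and> lc (fst x) (snd x) = v)" for v
  define t where "t v = (if v \<le> n then ?q (v - 1) else - K $$ rp v / (?q (fst (rp v)) * ?q (snd (rp v))))" for v
  have "psubst \<eta> t (zt c) = p_of K c" if c: "c \<in> C" for c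
  proof -
    interpret H: comm_ring_hom "psubst \<eta> t" by (rule psubst_hom[OF \<eta>])
    obtain i j where ij: "c = Idx i j" "i < j" "j \<le> n" using c by (auto simp: leaf_pairs_def)
    show ?thesis
    proof (cases "i = 0")
      case True
      then show ?thesis using ij by (simp add: psubst_PVar[OF \<eta>] t_def p_of_def)
    next
      case False
      let ?i = "i - 1" and ?j = "j - 1"
      have a: "?i < n" "?j < n" "?i \<noteq> ?j" "Suc ?i = i" "Suc ?j = j" using ij False by auto
      let ?x = "rp (lca T i j)"
      have x: "?x \<in> {..<n} \<times> {..<n} \<and> fst ?x \<noteq> snd ?x \<and> lc (fst ?x) (snd ?x) = lca T i j"
        unfolding rp_def by (rule someI[of _ "(?i, ?j)"]) (use a in simp)
      have g: "lca T i j > n" using lc_gt[OF a(1-3)] a by simp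
      have "K $$ (?i, ?j) * ?q (fst ?x) * ?q (snd ?x) = K $$ (fst ?x, snd ?x) * ?q ?i * ?q ?j"
        by (rule inverse_binomial[OF M K KM]) (use x a in \<open>auto simp: mem_Times_iff\<close>)
      moreover have "?q (fst ?x) \<noteq> 0" "?q (snd ?x) \<noteq> 0" using x nz by (auto simp: mem_Times_iff)
      ultimately have "?q ?i * ?q ?j * (- K $$ ?x / (?q (fst ?x) * ?q (snd ?x))) = - K $$ (?i, ?j)"
        by (simp add: field_simps)
      then show ?thesis
        using ij False g by (simp add: H.hom_mult psubst_PVar[OF \<eta>] t_def p_of_def)
    qed
  qed
  then have "psubst \<eta> (p_of K) f = psubst \<eta> (\<lambda>c. psubst \<eta> t (zt c)) f"
    using f by (intro psubst_cong[of f C]) (auto simp: P.I_def vanishing_ideal_def)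
  also have "\<dots> = psubst \<eta> t (psubst PConst zt f)" by (rule psubst_psubst[OF \<eta>, symmetric])
  also have "\<dots> = 0" using f
    by (simp add: P.I_def vanishing_ideal_def psubst_def)
  finally show ?thesis .
qed

end

section \<open>The model inside the space of matrices\<close>

lemma ev_inv_of:
  assumes \<phi>: "comm_ring_hom \<phi>" and nz: "\<phi> (\<rho> (det (generic_mat n))) \<noteq> 0" and ij: "i < n" "j < n"
  shows "inv_of n (\<lambda>f. of_poly (\<rho> f)) $$ (i, j) \<in> reg \<phi>"
    and "ev \<phi> (inv_of n (\<lambda>f. of_poly (\<rho> f)) $$ (i, j)) = inv_of n (\<lambda>f. \<phi> (\<rho> f)) $$ (i, j)"
  using ij regI[OF \<phi>, of "\<rho> (det (generic_mat n))"] ev_div[OF \<phi> nz] nz by (simp_all add: inv_of_def)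

context leaf_tree
begin

abbreviation "X \<equiv> mat_coords n"
abbreviation "\<delta> \<equiv> det (generic_mat n)"

fun lcx :: "idx \<Rightarrow> nat" where "lcx (Idx i j) = lc i j"

text \<open>
  A chosen variable in each class of positions. Replacing each variable by the chosen one restricts polynomials to
  the model, so \<open>ev \<pi>\<close> below restricts rational functions to the model.
\<close>
definition rep :: "idx \<Rightarrow> idx" where "rep x = (SOME y. y \<in> X \<and> lcx y = lcx x)"

lemma rep: "x \<in> X \<Longrightarrow> rep x \<in> X" "x \<in> X \<Longrightarrow> lcx (rep x) = lcx x"
proof -
  assume "x \<in> X"
  then have "rep x \<in> X \<and> lcx (rep x) = lcx x" unfolding rep_def by (rule someI[of _ x, OF conjI[OF _ refl]])
  then show "rep x \<in> X" "lcx (rep x) = lcx x" by simp_all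
qed

lemma rep_eq: "lcx x = lcx y \<Longrightarrow> rep x = rep y"
  by (simp add: rep_def)

definition on_model :: "(idx \<Rightarrow> 'a) \<Rightarrow> bool" where
  "on_model a \<longleftrightarrow> (\<forall>x\<in>X. \<forall>y\<in>X. lcx x = lcx y \<longrightarrow> a x = a y)"

lemma coord_mat_index: "i < n \<Longrightarrow> j < n \<Longrightarrow> coord_mat n a $$ (i, j) = a (Idx i j)"
  by (simp add: coord_mat_def)

lemma coord_mat_model: "coord_mat n a \<in> bmt_space n T \<longleftrightarrow> on_model a"
proof
  assume b: "coord_mat n a \<in> bmt_space n T"
  show "on_model a" unfolding on_model_def
  proof (intro ballI impI)
    fix x y assume xy: "x \<in> X" "y \<in> X" "lcx x = lcx y"
    obtain i j k l where ij: "x = Idx i j" "y = Idx k l" by (cases x; cases y)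
    show "a x = a y" using bmt_space_eq[OF b, of i j k l] xy ij by (simp add: coord_mat_index)
  qed
next
  assume a: "on_model a"
  show "coord_mat n a \<in> bmt_space n T"
  proof (rule bmt_spaceI[OF coord_mat_carrier])
    fix i j k l assume "i < n" "j < n" "k < n" "l < n" "lc i j = lc k l"
    then show "coord_mat n a $$ (i, j) = coord_mat n a $$ (k, l)"
      using a[unfolded on_model_def, THEN bspec, of "Idx i j", THEN bspec, of "Idx k l"] by (simp add: coord_mat_index)
  qed
qed

definition to_model :: "idx mpoly \<Rightarrow> idx mpoly" where "to_model f = psubst PConst (\<lambda>x. PVar (rep x)) f"

definition model_relations :: "idx ratfun set" where "model_relations = (\<lambda>x. of_poly (PVar x - PVar (rep x))) ` X"

lemma to_model_hom: "comm_ring_hom to_model"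
  unfolding to_model_def by (rule comm_ring_hom_psubst_PConst)

abbreviation "\<pi> \<equiv> \<lambda>f. of_poly (to_model f) :: idx ratfun"

lemma \<pi>_hom: "comm_ring_hom \<pi>"
  by (rule comm_ring_hom_comp[OF comm_ring_hom_of_poly to_model_hom])

lemma to_model_PVar: "to_model (PVar x) = PVar (rep x)" and to_model_PConst: "to_model (PConst c) = PConst c"
  by (simp_all add: to_model_def psubst_PVar[OF comm_ring_hom_PConst] psubst_PConst)

lemma peval_to_model:
  assumes "on_model a" "f \<in> poly_ring X" shows "peval (to_model f) a = peval f a"
  unfolding to_model_def peval_psubst
proof (rule peval_cong[OF assms(2)])
  fix x assume "x \<in> X"
  then show "peval (PVar (rep x)) a = a x"
    using assms(1)[unfolded on_model_def, THEN bspec, of "rep x", THEN bspec, of x] rep by simp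
qed

context
  fixes a :: "idx \<Rightarrow> complex"
  assumes a: "on_model a"
begin

lemma minus_to_model_in: "f \<in> poly_ring X \<Longrightarrow> of_poly (f - to_model f) \<in> ideal_gen_in (local_ring X a) model_relations"
proof (induction rule: poly_ring_induct)
  note O = local_ring_subring[of X a]
  case (const c) then show ?case by (simp add: to_model_PConst ideal_gen_0[OF O])
next
  note O = local_ring_subring[of X a]
  case (var x) then show ?case unfolding to_model_PVar by (intro ideal_gen_gen[OF O]) (simp add: model_relations_def)
next
  note O = local_ring_subring[of X a]
  interpret to_model: comm_ring_hom to_model by (rule to_model_hom)
  case (add f g)
  have "of_poly (f + g - to_model (f + g)) = of_poly (f - to_model f) + of_poly (g - to_model g)"
    by (simp add: to_model.hom_add flip: of_poly.hom_add)
  then show ?case using ideal_gen_add[OF O add.IH] by simp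
next
  note O = local_ring_subring[of X a]
  interpret to_model: comm_ring_hom to_model by (rule to_model_hom)
  case (mult f g)
  have "to_model f \<in> poly_ring X" unfolding to_model_def by (rule poly_ring_psubst[OF mult.hyps(1)]) (simp add: rep)
  have "of_poly (f * g - to_model (f * g)) = of_poly g * of_poly (f - to_model f) + of_poly (to_model f) * of_poly (g - to_model g)"
    by (simp add: to_model.hom_mult algebra_simps flip: of_poly.hom_add of_poly.hom_mult)
  also have "\<dots> \<in> ideal_gen_in (local_ring X a) model_relations"
    by (intro ideal_gen_add[OF O] ideal_gen_mult[OF O] mult.IH local_ring_of_poly mult.hyps \<open>to_model f \<in> poly_ring X\<close>)
  finally show ?case .
qed

lemma \<pi>_nonzero: "g \<in> poly_ring X \<Longrightarrow> peval g a \<noteq> 0 \<Longrightarrow> \<pi> g \<noteq> 0"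
  using peval_to_model[OF a, of g] by auto

lemma local_ring_reg_\<pi>: "local_ring X a \<subseteq> reg \<pi>"
proof
  fix r assume "r \<in> local_ring X a"
  then obtain f g where fg: "r = of_poly f / of_poly g" "g \<in> poly_ring X" "peval g a \<noteq> 0"
    unfolding local_ring_alt by blast
  show "r \<in> reg \<pi>" unfolding fg(1) by (rule regI[OF \<pi>_hom \<pi>_nonzero[OF fg(2,3)]])
qed

text \<open>
  The linear equations of the model generate all equations of the model in the local ring. So
  identities that hold for the generic matrix of the model hold modulo these equations.
\<close>
lemma \<pi>_zero_in:
  assumes "r \<in> local_ring X a" "ev \<pi> r = 0" shows "r \<in> ideal_gen_in (local_ring X a) model_relations"
proof -
  note O = local_ring_subring[of X a]
  obtain f g where fg: "r = of_poly f / of_poly g" "f \<in> poly_ring X" "g \<in> poly_ring X" "peval g a \<noteq> 0"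
    using assms(1) unfolding local_ring_alt by blast
  have nz: "\<pi> g \<noteq> 0" by (rule \<pi>_nonzero[OF fg(3,4)])
  have "\<pi> f / \<pi> g = 0" using assms(2) unfolding fg(1) ev_div[OF \<pi>_hom nz] .
  then have "to_model f = 0" using nz by simp
  then have "of_poly f \<in> ideal_gen_in (local_ring X a) model_relations" using minus_to_model_in[OF fg(2)] by simp
  from ideal_gen_mult[OF O this local_ring_inverse_poly[OF fg(3,4)]]
  show ?thesis by (simp add: fg(1) divide_inverse mult.commute)
qed

lemma model_relations_subset: "model_relations \<subseteq> local_ring X a"
  unfolding model_relations_def by (intro image_subsetI local_ring_of_poly poly_ring_diff) (auto simp: rep)

lemma model_relations_vanish:
  assumes "r \<in> ideal_gen_in (local_ring X a) model_relations" shows "ev_at a r = 0"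
proof (rule ideal_gen_vanish[OF local_ring_subring ev_at_hom model_relations_subset _ assms])
  fix g assume "g \<in> model_relations"
  then obtain x where x: "x \<in> X" "g = of_poly (PVar x - PVar (rep x))" by (auto simp: model_relations_def)
  have "a (rep x) = a x"
    using a[unfolded on_model_def, THEN bspec, of "rep x", THEN bspec, of x] rep[OF x(1)] x(1) by simp
  then show "ev_at a g = 0" using x by (simp add: peval.hom_minus)
qed

end

text \<open>
  The identity matrix lies in the model, since each leaf is a class of its own. It shows that the determinant and
  the row sums of the inverse of the generic matrix of the model are nonzero.
\<close>
definition id_coords :: "idx \<Rightarrow> complex" where "id_coords x = (case x of Idx i j \<Rightarrow> if i = j then 1 else 0)"

lemma id_coords_model: "on_model id_coords"
  unfolding on_model_def
proof (intro ballI impI)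
  fix x y assume xy: "x \<in> X" "y \<in> X" "lcx x = lcx y"
  obtain i j k l where ij: "x = Idx i j" "y = Idx k l" by (cases x; cases y)
  have "i = j \<longleftrightarrow> k = l"
    using lc_leaf[of k l i] lc_leaf[of i j k] lc_self[of i] lc_self[of k] xy ij by auto
  then show "id_coords x = id_coords y" by (simp add: id_coords_def ij)
qed

lemma coord_mat_id_coords: "coord_mat n id_coords = 1\<^sub>m n"
  by (rule eq_matI) (auto simp: coord_mat_def id_coords_def)

lemma \<delta>_peval: "peval \<delta> a = det (coord_mat n a)"
  by (simp add: det_generic_mat[OF comm_ring_hom_peval])

lemma \<delta>_id_coords: "peval \<delta> id_coords = 1"
  by (simp add: \<delta>_peval coord_mat_id_coords)

lemma \<pi>_\<delta>: "\<pi> \<delta> \<noteq> 0"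
  by (rule \<pi>_nonzero[OF id_coords_model det_generic_in]) (simp add: \<delta>_id_coords)

text \<open>
  The inverses of the generic matrix, of the generic matrix of the model and of the matrix at a point, and the substitution of the
  coordinates of the first of them into polynomials in \<open>p\<close>.
\<close>
abbreviation Kg :: "idx ratfun mat" where "Kg \<equiv> inv_of n of_poly"
abbreviation K0 :: "idx ratfun mat" where "K0 \<equiv> inv_of n \<pi>"
abbreviation Ka :: "(idx \<Rightarrow> complex) \<Rightarrow> complex mat" where "Ka a \<equiv> inv_of n (\<lambda>f. peval f a)"
abbreviation \<Theta> :: "idx mpoly \<Rightarrow> idx ratfun" where "\<Theta> \<equiv> psubst const (p_of Kg)"

lemma \<Theta>_hom: "comm_ring_hom \<Theta>"
  by (rule psubst_hom[OF comm_ring_hom_const])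

lemma Kg_local:
  assumes "peval \<delta> a \<noteq> 0" "i < n" "j < n" shows "Kg $$ (i, j) \<in> local_ring X a"
  using local_ringI[OF adj_generic_in[OF assms(2,3)] det_generic_in assms(1)] assms by (simp add: inv_of_def)

lemma ev_Kg:
  assumes "comm_ring_hom \<phi>" "\<phi> \<delta> \<noteq> 0" "i < n" "j < n"
  shows "Kg $$ (i, j) \<in> reg \<phi>" "ev \<phi> (Kg $$ (i, j)) = inv_of n \<phi> $$ (i, j)"
  using ev_inv_of[where \<rho> = "\<lambda>f. f", OF assms] by simp_all

lemma p_of_Kg_local: "peval \<delta> a \<noteq> 0 \<Longrightarrow> c \<in> C \<Longrightarrow> p_of Kg c \<in> local_ring X a"
  by (rule p_of_in_subring[OF local_ring_subring Kg_local])

lemma const_local: "const c \<in> local_ring X' a"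
  by (rule local_ring_of_poly) simp

lemma \<Theta>_local: "peval \<delta> a \<noteq> 0 \<Longrightarrow> f \<in> poly_ring C \<Longrightarrow> \<Theta> f \<in> local_ring X a"
  by (rule psubst_in_subring[OF local_ring_subring]) (auto intro: const_local p_of_Kg_local)

lemma ev_\<Theta>:
  assumes \<phi>: "comm_ring_hom \<phi>" and d: "\<phi> \<delta> \<noteq> 0" and f: "f \<in> poly_ring C"
  shows "ev \<phi> (\<Theta> f) = psubst (\<lambda>c. \<phi> (PConst c)) (p_of (inv_of n \<phi>)) f"
proof -
  note S = reg_subring[OF \<phi>] and h = ev_hom[OF \<phi>] and K = ev_Kg[OF \<phi> d]
  have "ev \<phi> (\<Theta> f) = psubst (\<lambda>c. ev \<phi> (const c)) (\<lambda>c. ev \<phi> (p_of Kg c)) f"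
    by (rule hom_on_psubst[OF S h f]) (auto intro: of_poly_reg[OF \<phi>] p_of_in_subring[OF S K(1)])
  also have "\<dots> = psubst (\<lambda>c. \<phi> (PConst c)) (p_of (inv_of n \<phi>)) f"
    unfolding ev_of_poly[OF \<phi>] by (rule psubst_cong[OF f]) (rule hom_on_p_of[OF S h K])
  finally show ?thesis .
qed

lemma K0_model: "coord_mat n (\<lambda>x. \<pi> (PVar x)) \<in> bmt_space n T"
  unfolding coord_mat_model on_model_def
proof (intro ballI impI)
  fix x y assume "lcx x = lcx y"
  then have "rep x = rep y" by (rule rep_eq)
  then show "\<pi> (PVar x) = \<pi> (PVar y)" unfolding to_model_PVar by (rule arg_cong)
qed

lemma K0_sym: "transpose_mat K0 = K0"
  by (rule symmetric_inverse[OF coord_mat_carrier bmt_space_transpose[OF K0_model] inv_of_carrier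
        inv_of_inverse(1)[OF \<pi>_hom \<pi>_\<delta>]])

text \<open>
  If the row sum were zero on the model, it would be zero at the identity matrix, where it is 1.
\<close>
lemma K0_row_sum:
  assumes i: "i < n" shows "(\<Sum>m<n. K0 $$ (i, m)) \<noteq> 0"
proof
  assume "(\<Sum>m<n. K0 $$ (i, m)) = 0"
  note S = reg_subring[OF \<pi>_hom] and h = ev_hom[OF \<pi>_hom]
  have d: "peval \<delta> id_coords \<noteq> 0" by (simp add: \<delta>_id_coords)
  let ?r = "\<Sum>m<n. Kg $$ (i, m)"
  have "ev \<pi> ?r = (\<Sum>m<n. ev \<pi> (Kg $$ (i, m)))"
    by (rule hom_on_sum[OF S h]) (use ev_Kg(1)[OF \<pi>_hom \<pi>_\<delta> i] in auto)
  also have "\<dots> = (\<Sum>m<n. K0 $$ (i, m))" using ev_Kg(2)[OF \<pi>_hom \<pi>_\<delta> i] by (intro sum.cong) auto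
  finally have "ev \<pi> ?r = 0" using \<open>(\<Sum>m<n. K0 $$ (i, m)) = 0\<close> by simp
  moreover have rL: "?r \<in> local_ring X id_coords" using Kg_local[OF d i] by (intro subring_sum[OF local_ring_subring]) auto
  ultimately have "ev_at id_coords ?r = 0" using model_relations_vanish[OF id_coords_model] \<pi>_zero_in[OF id_coords_model] by metis
  moreover have "ev_at id_coords ?r = (\<Sum>m<n. ev_at id_coords (Kg $$ (i, m)))"
    by (rule hom_on_sum[OF local_ring_subring ev_at_hom]) (use Kg_local[OF d i] in auto)
  moreover have "\<dots> = (\<Sum>m<n. 1\<^sub>m n $$ (i, m))"
  proof (intro sum.cong refl)
    fix m assume "m \<in> {..<n}"
    have "Ka id_coords = 1\<^sub>m n"
      using inv_of_inverse(1)[OF comm_ring_hom_peval, of n id_coords] d inv_of_carrier[of n "\<lambda>f. peval f id_coords"]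
      by (simp add: coord_mat_id_coords)
    then show "ev_at id_coords (Kg $$ (i, m)) = 1\<^sub>m n $$ (i, m)"
      using ev_Kg(2)[OF comm_ring_hom_peval d i] \<open>m \<in> {..<n}\<close> by simp
  qed
  ultimately show False using i by simp
qed

lemma \<Theta>_I:
  assumes a: "on_model a" and d: "peval \<delta> a \<noteq> 0" and f: "f \<in> P.I"
  shows "\<Theta> f \<in> ideal_gen_in (local_ring X a) model_relations"
proof (rule \<pi>_zero_in[OF a])
  have fC: "f \<in> poly_ring C" using f by (simp add: P.I_def vanishing_ideal_def)
  show "\<Theta> f \<in> local_ring X a" by (rule \<Theta>_local[OF d fC])
  have "ev \<pi> (\<Theta> f) = psubst const (p_of K0) f" using ev_\<Theta>[OF \<pi>_hom \<pi>_\<delta> fC] by (simp add: to_model_PConst)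
  also have "\<dots> = 0"
    by (rule toric_ideal_vanishes_on_inverse[OF K0_model inv_of_carrier inv_of_inverse(1)[OF \<pi>_hom \<pi>_\<delta>]
          K0_row_sum comm_ring_hom_const f])
  finally show "ev \<pi> (\<Theta> f) = 0" .
qed

text \<open>
  For the generic matrix of the model this is \<open>toric_ideal_vanishes_on_inverse\<close>. Specialization gives it also for
  matrices whose inverse has vanishing row sums.
\<close>
lemma I_vanishes:
  assumes a: "on_model a" and d: "peval \<delta> a \<noteq> 0" and f: "f \<in> P.I"
  shows "peval f (p_of (Ka a)) = 0"
proof -
  have fC: "f \<in> poly_ring C" using f by (simp add: P.I_def vanishing_ideal_def)
  have "ev_at a (\<Theta> f) = peval f (p_of (Ka a))"
    using ev_\<Theta>[OF comm_ring_hom_peval d fC] by (simp add: peval_def psubst_PConst)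
  then show ?thesis using model_relations_vanish[OF a \<Theta>_I[OF a d f]] by simp
qed

section \<open>Critical points and the toric fibre\<close>

lemma Ka_inverse:
  assumes "peval \<delta> a \<noteq> 0"
  shows "coord_mat n a * Ka a = 1\<^sub>m n" "Ka a * coord_mat n a = 1\<^sub>m n"
  using inv_of_inverse[OF comm_ring_hom_peval, of n a] assms by simp_all

lemma Ka_sym:
  assumes "on_model a" "peval \<delta> a \<noteq> 0" shows "transpose_mat (Ka a) = Ka a"
  using symmetric_inverse[OF coord_mat_carrier bmt_space_transpose inv_of_carrier Ka_inverse(1)[OF assms(2)]]
    assms(1) by (simp add: coord_mat_model)

text \<open>
  The real matrices \<open>E\<close> in the model are the combinations of the indicators of the classes.
\<close>
lemma critical_iff:
  assumes KS: "mat_inv S \<in> carrier_mat n n"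
  shows "a \<in> rec_critical_points n T S \<longleftrightarrow>
    a \<in> X \<rightarrow>\<^sub>E UNIV \<and> on_model a \<and> peval \<delta> a \<noteq> 0 \<and> (\<forall>v\<in>R. tr v (Ka a) = tr v (mat_inv S))"
proof -
  have inv: "invertible_mat (coord_mat n a) \<longleftrightarrow> peval \<delta> a \<noteq> 0"
    using invertible_mat_iff[OF coord_mat_carrier[of n a]] det_nonzero_inverse[OF coord_mat_carrier[of n a]]
      inverse_det_nonzero[OF coord_mat_carrier[of n a]] by (auto simp: \<delta>_peval)
  have "(\<forall>E\<in>bmt_space n T. mat_trace (mat_inv (coord_mat n a) * map_mat complex_of_real E) =
      mat_trace (mat_inv S * map_mat complex_of_real E)) \<longleftrightarrow> (\<forall>v\<in>R. tr v (Ka a) = tr v (mat_inv S))"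
    if d: "peval \<delta> a \<noteq> 0"
  proof -
    have Ka: "mat_inv (coord_mat n a) = Ka a"
      by (rule mat_inv_eq[OF coord_mat_carrier inv_of_carrier Ka_inverse(1)[OF d]])
    show ?thesis unfolding Ka
    proof (intro iffI ballI)
      fix v assume l: "\<forall>E\<in>bmt_space n T. mat_trace (Ka a * map_mat complex_of_real E) =
        mat_trace (mat_inv S * map_mat complex_of_real E)"
      show "tr v (Ka a) = tr v (mat_inv S)"
        using bspec[OF l class_indicator_in[of v]] trace_class_indicator[OF inv_of_carrier, of complex_of_real] trace_class_indicator[OF KS, of complex_of_real]
        by simp
    next
      fix E :: "real mat" assume r: "\<forall>v\<in>R. tr v (Ka a) = tr v (mat_inv S)" and E: "E \<in> bmt_space n T"
      obtain e where e: "\<forall>K\<in>carrier_mat n n. mat_trace (K * map_mat complex_of_real E) = (\<Sum>v\<in>R. e v * tr v K)"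
        using trace_tr[OF E] by (rule exE)
      show "mat_trace (Ka a * map_mat complex_of_real E) = mat_trace (mat_inv S * map_mat complex_of_real E)"
        using bspec[OF e inv_of_carrier] bspec[OF e KS] r by simp
    qed
  qed
  then show ?thesis unfolding rec_critical_points_def mem_Collect_eq coord_mat_model inv by metis
qed

lemma trace_factor_nz: "of_int (trace_factor v) \<noteq> (0::complex)"
  by (simp add: trace_factor_def)

text \<open>
  The binomials that \<open>inverse_in_space\<close> requires.
\<close>
lemma leaf_binomial:
  assumes ijkl: "i < n" "j < n" "k < n" "l < n" "i \<noteq> j" "k \<noteq> l" "lc i j = lc k l"
  shows "PVar (pr (Suc i) (Suc j)) * PVar (Idx 0 (Suc k)) * PVar (Idx 0 (Suc l)) -
    PVar (pr (Suc k) (Suc l)) * PVar (Idx 0 (Suc i)) * PVar (Idx 0 (Suc j)) \<in> P.I"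
proof -
  interpret Z: comm_ring_hom "psubst PConst zt" by (rule comm_ring_hom_psubst_PConst)
  have 0: "Idx 0 (Suc m) \<in> C" if "m < n" for m using that by (simp add: leaf_pairs_def)
  show ?thesis
    unfolding P.I_def vanishing_ideal_def using ijkl
    by (auto intro!: poly_ring_closed pr_in 0
      simp: Z.hom_minus Z.hom_mult psubst_PVar[OF comm_ring_hom_PConst] zt_pr mult_ac)
qed

context
  fixes d h and S KS :: "complex mat"
  assumes good: "good_data d h" and KS: "KS \<in> carrier_mat n n" "mat_inv S = KS" "transpose_mat KS = KS"
    and nz: "peval h (row_sums C A (p_of KS)) \<noteq> 0"
begin

abbreviation (input) "Fib \<equiv> zero_set C (P.eqs (p_of KS))"

text \<open>
  The bijection from the critical points to the toric fibre: the \<open>p\<close>-coordinates of the inverse.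
\<close>
definition \<psi> :: "(idx \<Rightarrow> complex) \<Rightarrow> idx \<Rightarrow> complex" where "\<psi> a = restrict (p_of (Ka a)) C"

lemma crit: 
  assumes "a \<in> rec_critical_points n T S"
  shows "a \<in> X \<rightarrow>\<^sub>E UNIV" "on_model a" "peval \<delta> a \<noteq> 0" "v \<in> R \<Longrightarrow> tr v (Ka a) = tr v KS"
  using assms critical_iff[of S a] KS by auto

lemma row_sums_restrict: "row_sums C A (restrict p C) v = row_sums C A p v"
  unfolding row_sums_def by (intro sum.cong) auto

lemma crit_in_fibre:
  assumes a: "a \<in> rec_critical_points n T S" shows "\<psi> a \<in> Fib"
  unfolding P.fibre_alt
proof (intro CollectI conjI ballI)
  note c = crit[OF a]
  show "\<psi> a \<in> C \<rightarrow>\<^sub>E UNIV" by (simp add: \<psi>_def)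
  fix f assume f: "f \<in> P.I"
  then have "peval f (\<psi> a) = peval f (p_of (Ka a))"
    by (intro peval_cong[of f C]) (auto simp: \<psi>_def P.I_def vanishing_ideal_def)
  then show "peval f (\<psi> a) = 0" using I_vanishes[OF c(2,3) f] by simp
next
  note c = crit[OF a]
  fix v assume v: "v \<in> R"
  have "of_int (trace_factor v) * row_sums C A (p_of (Ka a)) v = of_int (trace_factor v) * row_sums C A (p_of KS) v"
    using tr_row_sums[OF v Ka_sym[OF c(2,3)] inv_of_carrier] tr_row_sums[OF v KS(3,1)] c(4)[OF v] by simp
  then show "row_sums C A (\<psi> a) v = row_sums C A (p_of KS) v"
    using trace_factor_nz[of v] by (simp add: \<psi>_def row_sums_restrict)
qed

lemma K_of_\<psi>:
  assumes a: "a \<in> rec_critical_points n T S" shows "K_of (\<psi> a) = Ka a"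
proof -
  have "K_of (\<psi> a) = K_of (p_of (Ka a))" by (rule K_of_cong) (simp add: \<psi>_def)
  then show ?thesis using K_of_p_of[OF Ka_sym[OF crit(2,3)[OF a]] inv_of_carrier] by simp
qed

lemma coord_mat_inj:
  assumes "a \<in> X \<rightarrow>\<^sub>E UNIV" "a' \<in> X \<rightarrow>\<^sub>E UNIV" "coord_mat n a = coord_mat n a'" shows "a = a'"
proof (rule PiE_ext[OF assms(1,2)])
  fix x assume "x \<in> X"
  then obtain i j where x: "x = Idx i j" "i < n" "j < n" by (auto simp: mat_coords_def)
  show "a x = a' x" using arg_cong[OF assms(3), of "\<lambda>M. M $$ (i, j)"] x by (simp add: coord_mat_index)
qed

lemma crit_bij: "bij_betw \<psi> (rec_critical_points n T S) Fib"
  unfolding bij_betw_def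
proof
  show "inj_on \<psi> (rec_critical_points n T S)"
  proof (rule inj_onI)
    fix a a' assume a: "a \<in> rec_critical_points n T S" "a' \<in> rec_critical_points n T S" "\<psi> a = \<psi> a'"
    note c = crit[OF a(1)] and c' = crit[OF a(2)]
    have K: "Ka a = Ka a'" using K_of_\<psi>[OF a(1)] K_of_\<psi>[OF a(2)] a(3) by simp
    have "coord_mat n a = coord_mat n a * (Ka a' * coord_mat n a')" unfolding Ka_inverse(2)[OF c'(3)]
      by (rule right_mult_one_mat[OF coord_mat_carrier, symmetric])
    also have "\<dots> = (coord_mat n a * Ka a) * coord_mat n a'"
      unfolding K by (rule assoc_mult_mat[OF coord_mat_carrier inv_of_carrier coord_mat_carrier, symmetric])
    also have "\<dots> = coord_mat n a'" unfolding Ka_inverse(1)[OF c(3)]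
      by (rule left_mult_one_mat[OF coord_mat_carrier])
    finally show "a = a'" by (rule coord_mat_inj[OF c(1) c'(1)])
  qed
  show "\<psi> ` rec_critical_points n T S = Fib"
  proof (intro equalityI subsetI)
    fix p assume p: "p \<in> Fib"
    note co = fibre_coords[OF good nz p]
    obtain L where L: "L \<in> carrier_mat n n" "K_of p * L = 1\<^sub>m n" "L * K_of p = 1\<^sub>m n"
      using det_nonzero_inverse[OF K_of_carrier co(2)] by blast
    have LT: "L \<in> bmt_space n T"
    proof (rule inverse_in_space[OF L])
      show "p (Idx 0 (Suc i)) \<noteq> 0" if "i < n" for i
        using that by (intro co(1)) (simp add: leaf_pairs_def)
      fix i j k l assume ijkl: "i < n" "j < n" "k < n" "l < n" "i \<noteq> j" "k \<noteq> l" "lc i j = lc k l"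
      show "p (pr (Suc i) (Suc j)) * p (Idx 0 (Suc k)) * p (Idx 0 (Suc l)) =
          p (pr (Suc k) (Suc l)) * p (Idx 0 (Suc i)) * p (Idx 0 (Suc j))"
        using p leaf_binomial[OF ijkl] unfolding P.fibre_alt
        by (auto simp: peval.hom_minus peval.hom_mult dest!: bspec)
    qed
    define a where "a = (\<lambda>x\<in>X. case x of Idx i j \<Rightarrow> L $$ (i, j))"
    have aL: "coord_mat n a = L" using L(1) by (intro eq_matI) (auto simp: coord_mat_def a_def)
    have d: "peval \<delta> a \<noteq> 0" unfolding \<delta>_peval aL by (rule inverse_det_nonzero[OF L(1) K_of_carrier L(3)])
    have m: "on_model a" using LT by (simp add: coord_mat_model[symmetric] aL)
    have Ka: "Ka a = K_of p"
    proof -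
      have "Ka a = Ka a * (L * K_of p)" unfolding L(3)
        by (rule right_mult_one_mat[OF inv_of_carrier, symmetric])
      also have "\<dots> = (Ka a * L) * K_of p" by (rule assoc_mult_mat[OF inv_of_carrier L(1) K_of_carrier, symmetric])
      also have "\<dots> = K_of p" using Ka_inverse(2)[OF d] left_mult_one_mat[OF K_of_carrier] by (simp add: aL)
      finally show ?thesis .
    qed
    have pp: "row_sums C A (p_of (K_of p)) v = row_sums C A p v" for v
      unfolding row_sums_def by (intro sum.cong) (auto simp: p_of_K_of)
    have "tr v (Ka a) = tr v KS" if v: "v \<in> R" for v
      unfolding Ka tr_row_sums[OF v K_of_symmetric K_of_carrier, symmetric] tr_row_sums[OF v KS(3,1), symmetric] pp
      using p v by (simp add: P.fibre_alt)
    then have "a \<in> rec_critical_points n T S"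
      using critical_iff[of S a] KS d m by (simp add: a_def)
    moreover have "\<psi> a = p"
    proof (rule PiE_ext[of _ C "\<lambda>_. UNIV"])
      show "\<psi> a \<in> C \<rightarrow>\<^sub>E UNIV" by (simp add: \<psi>_def)
      show "p \<in> C \<rightarrow>\<^sub>E UNIV" using p by (simp add: P.fibre_alt)
      show "\<psi> a c = p c" if "c \<in> C" for c using that by (simp add: \<psi>_def Ka p_of_K_of)
    qed
    ultimately show "p \<in> \<psi> ` rec_critical_points n T S" by blast
  qed (use crit_in_fibre in blast)
qed

abbreviation (input) "G \<equiv> rec_equations n T S"

lemma mat_inv_generic: "mat_inv (coord_mat n (\<lambda>x. of_poly (PVar x))) = Kg"
proof (rule mat_inv_eq[OF coord_mat_carrier inv_of_carrier inv_of_inverse(1)[OF comm_ring_hom_of_poly]])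
  have "\<delta> \<noteq> 0" using \<delta>_id_coords by auto
  then show "of_poly \<delta> \<noteq> (0 :: idx ratfun)" by simp
qed

lemma rec_equations_alt:
  "G = {of_poly (PVar x - PVar y) | x y. x \<in> X \<and> y \<in> X \<and> lcx x = lcx y} \<union>
    {mat_trace (Kg * map_mat (\<lambda>r. const (complex_of_real r)) E) -
      const (mat_trace (KS * map_mat complex_of_real E)) | E. E \<in> bmt_space n T}"
proof -
  have "{of_poly (PVar (Idx i j) - PVar (Idx k l)) | i j k l.
        i < n \<and> j < n \<and> k < n \<and> l < n \<and> lc i j = lc k l} =
      {of_poly (PVar x - PVar y) | x y. x \<in> X \<and> y \<in> X \<and> lcx x = lcx y}" (is "?L = ?R")
  proof (intro equalityI subsetI)
    fix r assume "r \<in> ?L"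
    then obtain i j k l where r: "r = of_poly (PVar (Idx i j) - PVar (Idx k l))" "i < n" "j < n" "k < n" "l < n"
      "lc i j = lc k l" by blast
    show "r \<in> ?R"
      by (rule CollectI, rule exI[of _ "Idx i j"], rule exI[of _ "Idx k l"]) (use r in simp)
  next
    fix r assume "r \<in> ?R"
    then obtain x y where r: "r = of_poly (PVar x - PVar y)" "x \<in> X" "y \<in> X" "lcx x = lcx y" by blast
    obtain i j k l where ij: "x = Idx i j" "y = Idx k l" by (cases x; cases y)
    show "r \<in> ?L"
      by (rule CollectI, rule exI[of _ i], rule exI[of _ j], rule exI[of _ k], rule exI[of _ l]) (use r ij in simp)
  qed
  then show ?thesis unfolding rec_equations_def mat_inv_generic KS(2) by simp
qed

context
  fixes a assumes a: "a \<in> rec_critical_points n T S"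
begin

lemmas ac = crit[OF a]

abbreviation (input) "J \<equiv> ideal_gen_in (local_ring X a) G"

lemma trace_generic: "E \<in> bmt_space n T \<Longrightarrow>
  mat_trace (Kg * map_mat (\<lambda>r. const (complex_of_real r)) E) =
    (\<Sum>i<n. \<Sum>k<n. Kg $$ (i, k) * const (complex_of_real (E $$ (k, i))))"
  by (rule mat_trace_mult[OF inv_of_carrier bmt_space_carrier])

lemma rec_equations_local: "G \<subseteq> local_ring X a"
proof
  note O = local_ring_subring[of X a]
  fix g assume "g \<in> G"
  then consider x y where "x \<in> X" "y \<in> X" "g = of_poly (PVar x - PVar y)"
    | E where "E \<in> bmt_space n T" "g = mat_trace (Kg * map_mat (\<lambda>r. const (complex_of_real r)) E) -
      const (mat_trace (KS * map_mat complex_of_real E))" unfolding rec_equations_alt by blast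
  then show "g \<in> local_ring X a"
  proof cases
    case 1 then show ?thesis by (simp add: local_ring_of_poly poly_ring_diff)
  next
    case 2
    have "Kg $$ (i, k) * const (complex_of_real (E $$ (k, i))) \<in> local_ring X a" if "i < n" "k < n" for i k
      by (intro subring_mult[OF O] Kg_local[OF ac(3) that] const_local)
    then show ?thesis unfolding 2(2) trace_generic[OF 2(1)]
      by (intro subring_diff[OF O] subring_sum[OF O] const_local) auto
  qed
qed

lemma rec_equations_vanish:
  assumes "g \<in> G" shows "ev_at a g = 0"
proof -
  note O = local_ring_subring[of X a] and h = ev_at_hom[of X a]
  consider x y where "x \<in> X" "y \<in> X" "lcx x = lcx y" "g = of_poly (PVar x - PVar y)"
    | E where "E \<in> bmt_space n T" "g = mat_trace (Kg * map_mat (\<lambda>r. const (complex_of_real r)) E) -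
      const (mat_trace (KS * map_mat complex_of_real E))" using assms unfolding rec_equations_alt by blast
  then show ?thesis
  proof cases
    case 1
    then have "a x = a y" using ac(2) unfolding on_model_def by metis
    then show ?thesis using 1(4) by (simp add: peval.hom_minus)
  next
    case 2
    have t: "Kg $$ (i, k) * const (complex_of_real (E $$ (k, i))) \<in> local_ring X a" if "i < n" "k < n" for i k
      by (intro subring_mult[OF O] Kg_local[OF ac(3) that] const_local)
    have te: "ev_at a (Kg $$ (i, k) * const (complex_of_real (E $$ (k, i)))) = Ka a $$ (i, k) * complex_of_real (E $$ (k, i))"
      if "i < n" "k < n" for i k
      using hom_on_mult[OF O h Kg_local[OF ac(3) that] const_local] ev_Kg(2)[OF comm_ring_hom_peval ac(3) that] by simp
    let ?t = "\<Sum>i<n. \<Sum>k<n. Kg $$ (i, k) * const (complex_of_real (E $$ (k, i)))"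
    have tO: "?t \<in> local_ring X a" using t by (intro subring_sum[OF O]) auto
    have "ev_at a ?t = (\<Sum>i<n. ev_at a (\<Sum>k<n. Kg $$ (i, k) * const (complex_of_real (E $$ (k, i)))))"
      using t by (intro hom_on_sum[OF O h] subring_sum[OF O]) auto
    also have "\<dots> = (\<Sum>i<n. \<Sum>k<n. ev_at a (Kg $$ (i, k) * const (complex_of_real (E $$ (k, i)))))"
      using t by (intro sum.cong refl hom_on_sum[OF O h]) auto
    also have "\<dots> = (\<Sum>i<n. \<Sum>k<n. Ka a $$ (i, k) * complex_of_real (E $$ (k, i)))"
      using te by (intro sum.cong refl) auto
    also have "\<dots> = mat_trace (Ka a * map_mat complex_of_real E)"
      by (rule mat_trace_mult[OF inv_of_carrier bmt_space_carrier[OF 2(1)], symmetric])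
    also have "\<dots> = mat_trace (KS * map_mat complex_of_real E)"
    proof -
      obtain e where e: "\<forall>K\<in>carrier_mat n n. mat_trace (K * map_mat complex_of_real E) = (\<Sum>v\<in>R. e v * tr v K)"
        using trace_tr[OF 2(1)] by (rule exE)
      show ?thesis using bspec[OF e inv_of_carrier] bspec[OF e KS(1)] ac(4) by simp
    qed
    finally show ?thesis
      unfolding 2(2) trace_generic[OF 2(1)] using hom_on_diff[OF O h tO const_local] by simp
  qed
qed

lemma model_relations_in_J: "r \<in> ideal_gen_in (local_ring X a) model_relations \<Longrightarrow> r \<in> J"
proof (erule ideal_gen_mono[OF local_ring_subring])
  fix g assume "g \<in> model_relations"
  then obtain x where x: "x \<in> X" "g = of_poly (PVar x - PVar (rep x))" by (auto simp: model_relations_def)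
  have "lcx x = lcx (rep x)" "rep x \<in> X" using rep[OF x(1)] by simp_all
  then have "g \<in> G" unfolding rec_equations_alt x(2) using x(1) by blast
  then show "g \<in> J" by (rule ideal_gen_gen[OF local_ring_subring])
qed

lemma \<pi>_zero_in_J: "r \<in> local_ring X a \<Longrightarrow> ev \<pi> r = 0 \<Longrightarrow> r \<in> J"
  by (intro model_relations_in_J \<pi>_zero_in[OF ac(2)])

lemma tr_generic_local: "tr v Kg \<in> local_ring X a"
  unfolding tr_def using Kg_local[OF ac(3)]
  by (intro subring_sum[OF local_ring_subring]) (auto intro: subring_0[OF local_ring_subring])

lemma ev_tr: "ev \<pi> (tr v Kg) = tr v K0"
proof -
  note S = reg_subring[OF \<pi>_hom] and h = ev_hom[OF \<pi>_hom] and K = ev_Kg[OF \<pi>_hom \<pi>_\<delta>]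
  have t: "(if lc i j = v then Kg $$ (i, j) else 0) \<in> reg \<pi>" if "i < n" "j < n" for i j
    using K(1)[OF that] subring_0[OF S] by simp
  have "ev \<pi> (tr v Kg) = (\<Sum>i<n. ev \<pi> (\<Sum>j<n. if lc i j = v then Kg $$ (i, j) else 0))"
    unfolding tr_def using t by (intro hom_on_sum[OF S h] subring_sum[OF S]) auto
  also have "\<dots> = (\<Sum>i<n. \<Sum>j<n. ev \<pi> (if lc i j = v then Kg $$ (i, j) else 0))"
    using t by (intro sum.cong refl hom_on_sum[OF S h]) auto
  also have "\<dots> = tr v K0"
    unfolding tr_def using K(2) hom_on_0[OF S h] by (intro sum.cong refl) auto
  finally show ?thesis .
qed

text \<open>
  By \<open>tr_row_sums\<close> for the generic matrix of the model, a row of \<open>A p - A u\<close> is a multiple of a likelihood equation, up to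
  the linear equations of the model.
\<close>
lemma \<Theta>_linear:
  assumes v: "v \<in> R"
  shows "\<Theta> (row_sums C A PVar v - PConst (row_sums C A (p_of KS) v)) \<in> J"
proof -
  note O = local_ring_subring[of X a] and S = reg_subring[OF \<pi>_hom] and h = ev_hom[OF \<pi>_hom]
  interpret \<Theta>: comm_ring_hom \<Theta> by (rule \<Theta>_hom)
  let ?k = "of_int (trace_factor v) :: complex" and ?y = "\<Theta> (row_sums C A PVar v)" and ?b = "row_sums C A (p_of KS) v"
  have yO: "?y \<in> local_ring X a" by (rule \<Theta>_local[OF ac(3) P.row_sums_in])
  let ?r = "const ?k * ?y - tr v Kg"
  have yR: "?y \<in> reg \<pi>" "tr v Kg \<in> reg \<pi>"
    using local_ring_reg_\<pi>[OF ac(2)] yO tr_generic_local by blast+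
  have "ev \<pi> ?y = psubst const (p_of K0) (row_sums C A PVar v)"
    using ev_\<Theta>[OF \<pi>_hom \<pi>_\<delta> P.row_sums_in] by (simp add: to_model_PConst)
  also have "\<dots> = row_sums C A (p_of K0) v"
    by (simp add: hom_row_sums[OF psubst_hom[OF comm_ring_hom_const]] psubst_PVar[OF comm_ring_hom_const])
  finally have y0: "ev \<pi> ?y = row_sums C A (p_of K0) v" .
  have "ev \<pi> (const ?k) = \<pi> (PConst ?k)" by (rule ev_of_poly[OF \<pi>_hom])
  also have "\<dots> = of_int (trace_factor v)" unfolding to_model_PConst by (rule const.hom_of_int)
  finally have "ev \<pi> (const ?k) = of_int (trace_factor v)" .
  then have "ev \<pi> ?r = of_int (trace_factor v) * row_sums C A (p_of K0) v - tr v K0"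
    using hom_on_diff[OF S h subring_mult[OF S of_poly_reg[OF \<pi>_hom, of "PConst ?k"] yR(1)] yR(2)]
      hom_on_mult[OF S h of_poly_reg[OF \<pi>_hom, of "PConst ?k"] yR(1)] y0 ev_tr by simp
  also have "\<dots> = 0" using tr_row_sums[OF v K0_sym inv_of_carrier] by simp
  finally have 1: "?r \<in> J"
    by (intro \<pi>_zero_in_J subring_diff[OF O] subring_mult[OF O] const_local yO tr_generic_local)
  have "mat_trace (Kg * map_mat (\<lambda>r. const (complex_of_real r)) (class_indicator v)) -
      const (mat_trace (KS * map_mat complex_of_real (class_indicator v))) \<in> G"
    unfolding rec_equations_alt using class_indicator_in by blast
  then have "tr v Kg - const (tr v KS) \<in> G"
    using trace_class_indicator[OF KS(1), of complex_of_real v]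
      trace_class_indicator[OF inv_of_carrier[of n of_poly], of "\<lambda>r. const (complex_of_real r)" v] by simp
  then have 2: "tr v Kg - const (tr v KS) \<in> J" by (rule ideal_gen_gen[OF O])
  have "tr v KS = ?k * ?b" using tr_row_sums[OF v KS(3,1)] by simp
  with ideal_gen_add[OF O 1 2] have 3: "const ?k * ?y - const (?k * ?b) \<in> J" by simp
  have "const (1 / ?k) * (const ?k * ?y - const (?k * ?b)) = const (1 / ?k * ?k) * ?y - const (1 / ?k * (?k * ?b))"
    unfolding const.hom_mult by (simp only: right_diff_distrib mult.assoc)
  also have "\<dots> = ?y - const ?b" using trace_factor_nz[of v] by simp
  finally have "?y - const ?b \<in> J" using ideal_gen_mult[OF O 3 const_local[of "1 / ?k"]] by simp
  then show ?thesis by (simp add: \<Theta>.hom_minus psubst_PConst)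
qed

lemma \<Theta>_eqs: "g \<in> P.eqs (p_of KS) \<Longrightarrow> \<Theta> g \<in> J"
  unfolding P.eqs_def linear_forms_alt
  using model_relations_in_J[OF \<Theta>_I[OF ac(2,3)]] \<Theta>_linear by blast

text \<open>
  The polynomial identity that gives multiplicity one on the toric fibre, pulled back along matrix inversion.
\<close>
lemma p_coordinate_in_J:
  assumes c: "c \<in> C" shows "p_of Kg c - const (p_of (Ka a) c) \<in> J"
proof -
  note O = local_ring_subring[of X a]
  interpret \<Theta>: comm_ring_hom \<Theta> by (rule \<Theta>_hom)
  let ?p = "\<psi> a"
  have p: "?p \<in> Fib" by (rule crit_in_fibre[OF a])
  obtain w where w: "w \<in> poly_ring C" "peval w ?p \<noteq> 0"
    "w * (PVar c - PConst (?p c)) \<in> ideal_gen_in (poly_ring C) (P.eqs (p_of KS))"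
    using fibre_cert[OF good nz p c] by blast
  have "\<Theta> (w * (PVar c - PConst (?p c))) \<in> J"
    by (rule hom_on_ideal_gen[OF is_subring_poly_ring O hom_on_ring_hom[OF \<Theta>_hom] P.eqs_subset _ _ w(3)])
      (auto intro: \<Theta>_local[OF ac(3)] \<Theta>_eqs)
  then have 1: "\<Theta> w * (p_of Kg c - const (?p c)) \<in> J"
    by (simp add: \<Theta>.hom_mult \<Theta>.hom_minus psubst_PConst psubst_PVar[OF comm_ring_hom_const])
  have "ev_at a (\<Theta> w) = peval w (p_of (Ka a))"
    using ev_\<Theta>[OF comm_ring_hom_peval ac(3) w(1)] by (simp add: peval_def psubst_PConst)
  also have "\<dots> = peval w ?p" by (rule peval_cong[OF w(1)]) (simp add: \<psi>_def)
  finally have nzw: "ev_at a (\<Theta> w) \<noteq> 0" using w(2) by simp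
  then have "\<Theta> w \<noteq> 0" using hom_on_0[OF O ev_at_hom] by metis
  moreover have "inverse (\<Theta> w) * (\<Theta> w * (p_of Kg c - const (?p c))) \<in> J"
    by (rule ideal_gen_mult[OF O 1 local_ring_inverse[OF \<Theta>_local[OF ac(3) w(1)] nzw]])
  ultimately have "p_of Kg c - const (?p c) \<in> J" by (simp add: mult.assoc[symmetric])
  then show ?thesis using c by (simp add: \<psi>_def)
qed

text \<open>
  The entries of the inverse are linear combinations of its \<open>p\<close>-coordinates, for symmetric matrices; the
  inverse of the generic matrix is symmetric only modulo the linear equations of the model.
\<close>
lemma inverse_entry_in_J:
  assumes ij: "i < n" "j < n" shows "Kg $$ (i, j) - const (Ka a $$ (i, j)) \<in> J"
proof -
  note O = local_ring_subring[of X a] and S = reg_subring[OF \<pi>_hom] and h = ev_hom[OF \<pi>_hom]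
    and K = ev_Kg[OF \<pi>_hom \<pi>_\<delta>]
  let ?e = "\<lambda>p. K_of p $$ (i, j)"
  have pr: "pr (Suc i) m \<in> C" if "m \<le> n" "m \<noteq> Suc i" for m
    using that ij by (intro pr_in) auto
  have e1: "?e (p_of Kg) - const (?e (p_of (Ka a))) \<in> J"
  proof (cases "i = j")
    case True
    have "?e (p_of Kg) - const (?e (p_of (Ka a))) =
      (\<Sum>m\<in>{..n} - {Suc i}. p_of Kg (pr (Suc i) m) - const (p_of (Ka a) (pr (Suc i) m)))"
      using True ij by (simp add: K_of_index const.hom_sum sum_subtractf)
    also have "\<dots> \<in> J" using pr by (intro ideal_gen_sum[OF O] p_coordinate_in_J) auto
    finally show ?thesis .
  next
    case False
    have "?e (p_of Kg) - const (?e (p_of (Ka a))) =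
      - (p_of Kg (pr (Suc i) (Suc j)) - const (p_of (Ka a) (pr (Suc i) (Suc j))))"
      using False ij by (simp add: K_of_index const.hom_uminus)
    also have "\<dots> \<in> J" using pr[of "Suc j"] ij False by (intro ideal_gen_uminus[OF O] p_coordinate_in_J) auto
    finally show ?thesis .
  qed
  have pO: "p_of Kg c \<in> local_ring X a" if "c \<in> C" for c using p_of_Kg_local[OF ac(3) that] .
  have pe: "ev \<pi> (p_of Kg c) = p_of K0 c" if "c \<in> C" for c by (rule hom_on_p_of[OF S h K that])
  have pR: "p_of Kg c \<in> reg \<pi>" if "c \<in> C" for c using local_ring_reg_\<pi>[OF ac(2)] pO[OF that] by blast
  have eO: "?e (p_of Kg) \<in> local_ring X a"
    using ij pr pO by (auto simp: K_of_def intro!: subring_sum[OF O] subring_uminus[OF O])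
  have "ev \<pi> (?e (p_of Kg)) = ?e (p_of K0)"
  proof (cases "i = j")
    case True
    have "ev \<pi> (\<Sum>m\<in>{..n} - {Suc i}. p_of Kg (pr (Suc i) m)) = (\<Sum>m\<in>{..n} - {Suc i}. ev \<pi> (p_of Kg (pr (Suc i) m)))"
      using pr pR by (intro hom_on_sum[OF S h]) auto
    also have "\<dots> = (\<Sum>m\<in>{..n} - {Suc i}. p_of K0 (pr (Suc i) m))" using pr pe by (intro sum.cong) auto
    finally show ?thesis using True ij by (simp add: K_of_index)
  next
    case False
    have "pr (Suc i) (Suc j) \<in> C" using pr[of "Suc j"] ij False by auto
    then show ?thesis using False ij hom_on_uminus[OF S h pR] pe by (simp add: K_of_index)
  qed
  also have "\<dots> = K0 $$ (i, j)" by (simp add: K_of_p_of[OF K0_sym])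
  finally have "ev \<pi> (Kg $$ (i, j) - ?e (p_of Kg)) = 0"
    using hom_on_diff[OF S h K(1)[OF ij], of "?e (p_of Kg)"] K(2)[OF ij] local_ring_reg_\<pi>[OF ac(2)] eO
    by (simp add: subset_iff)
  then have e2: "Kg $$ (i, j) - ?e (p_of Kg) \<in> J"
    by (intro \<pi>_zero_in_J subring_diff[OF O] Kg_local[OF ac(3) ij] eO)
  have "K_of (p_of (Ka a)) = Ka a" by (rule K_of_p_of[OF Ka_sym[OF ac(2,3)] inv_of_carrier])
  then show ?thesis using ideal_gen_add[OF O e1 e2] by simp
qed

text \<open>\<open>\<Sigma> - \<Sigma>\<^sub>0 = \<Sigma>\<^sub>0 (K\<^sub>0 - K) \<Sigma>\<close> for the inverses \<open>K\<close> of \<open>\<Sigma>\<close> and \<open>K\<^sub>0\<close> of \<open>\<Sigma>\<^sub>0\<close>.\<close>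
lemma coordinate_in_J:
  assumes x: "x \<in> X" shows "of_poly (PVar x - PConst (a x)) \<in> J"
proof -
  note O = local_ring_subring[of X a]
  obtain i j where ij: "x = Idx i j" "i < n" "j < n" using x by (auto simp: mat_coords_def)
  let ?Y = "\<lambda>i j. of_poly (PVar (Idx i j)) :: idx ratfun"
  let ?D = "\<lambda>k l. Kg $$ (k, l) - const (Ka a $$ (k, l))"
  have d: "of_poly \<delta> \<noteq> (0 :: idx ratfun)" using ac(3) by auto
  have KY: "(\<Sum>l<n. Kg $$ (k, l) * ?Y l j) = (if k = j then 1 else 0)" if "k < n" for k
    using mat_mult_index[OF inv_of_carrier coord_mat_carrier that ij(3), of of_poly "\<lambda>x. of_poly (PVar x)"]
      inv_of_inverse(2)[OF comm_ring_hom_of_poly d] that ij by (simp add: coord_mat_index)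
  have aK: "(\<Sum>k<n. a (Idx i k) * Ka a $$ (k, l)) = (if i = l then 1 else 0)" if "l < n" for l
    using mat_mult_index[OF coord_mat_carrier inv_of_carrier ij(2) that, of a "\<lambda>f. peval f a"]
      Ka_inverse(1)[OF ac(3)] that ij by (simp add: coord_mat_index)
  have "(\<Sum>k<n. \<Sum>l<n. const (a (Idx i k)) * ?D k l * ?Y l j) =
    (\<Sum>k<n. const (a (Idx i k)) * (\<Sum>l<n. Kg $$ (k, l) * ?Y l j)) -
    (\<Sum>k<n. \<Sum>l<n. const (a (Idx i k) * Ka a $$ (k, l)) * ?Y l j)"
    by (simp add: sum_distrib_left sum_subtractf[symmetric] const.hom_mult algebra_simps)
  also have "(\<Sum>k<n. const (a (Idx i k)) * (\<Sum>l<n. Kg $$ (k, l) * ?Y l j)) = const (a x)"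
    using KY ij by (simp add: if_distrib[of "(*) _"] cong: if_cong)
  also have "(\<Sum>k<n. \<Sum>l<n. const (a (Idx i k) * Ka a $$ (k, l)) * ?Y l j) =
    (\<Sum>l<n. const (\<Sum>k<n. a (Idx i k) * Ka a $$ (k, l)) * ?Y l j)"
    by (subst sum.swap) (simp add: const.hom_sum sum_distrib_right)
  also have "\<dots> = (\<Sum>l<n. if l = i then ?Y i j else 0)"
    using aK by (intro sum.cong refl) auto
  also have "\<dots> = of_poly (PVar x)" using ij by simp
  finally have "of_poly (PVar x - PConst (a x)) = - (\<Sum>k<n. \<Sum>l<n. (const (a (Idx i k)) * ?Y l j) * ?D k l)"
    by (simp add: of_poly.hom_minus mult_ac)
  also have "\<dots> \<in> J"
    using ij by (intro ideal_gen_uminus[OF O] ideal_gen_sum[OF O] ideal_gen_mult[OF O] inverse_entry_in_J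
      subring_mult[OF O] const_local local_ring_of_poly) auto
  finally show ?thesis .
qed

lemma rec_mult: "has_mult X G a 1"
  by (rule has_mult_1[OF rec_equations_local rec_equations_vanish coordinate_in_J])

end

lemma rec_count: "has_count X (rec_equations n T S) (rec_critical_points n T S) d"
  unfolding has_count_def
proof (intro conjI exI[of _ "\<lambda>_. 1"] ballI)
  show "finite (rec_critical_points n T S)"
    using bij_betw_finite[OF crit_bij] fibre_finite[OF good nz] by simp
  show "d = (\<Sum>a\<in>rec_critical_points n T S. 1)"
    using bij_betw_same_card[OF crit_bij] fibre_card[OF good nz] by simp
qed (rule rec_mult)

end

section \<open>Generic data\<close>

text \<open>
  Restriction to symmetric matrices: \<open>\<phi>s\<close> replaces the variables of a matrix by those of a symmetric
  matrix, which are indexed by the upper triangle.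
\<close>
definition \<phi>s :: "idx mpoly \<Rightarrow> idx mpoly" where
  "\<phi>s f = psubst PConst (\<lambda>x. case x of Idx i j \<Rightarrow> PVar (Idx (min i j) (max i j))) f"

lemma \<phi>s_hom: "comm_ring_hom \<phi>s"
  unfolding \<phi>s_def by (rule comm_ring_hom_psubst_PConst)

lemma \<phi>s_in: "f \<in> poly_ring X \<Longrightarrow> \<phi>s f \<in> poly_ring (sym_coords n)"
  unfolding \<phi>s_def
  by (rule poly_ring_psubst) (auto simp: mat_coords_def sym_coords_def)

lemma peval_\<phi>s_hom: "comm_ring_hom (\<lambda>f. peval (\<phi>s f) s)"
  by (rule comm_ring_hom_comp[OF comm_ring_hom_peval \<phi>s_hom])

lemma coord_mat_\<phi>s: "coord_mat n (\<lambda>x. peval (\<phi>s (PVar x)) s) = sym_mat n s"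
  by (rule eq_matI) (auto simp: coord_mat_def sym_mat_def \<phi>s_def psubst_PVar[OF comm_ring_hom_PConst])

lemma sym_mat_sym: "transpose_mat (sym_mat n s) = sym_mat n s"
  by (rule eq_matI) (auto simp: sym_mat_def min.commute max.commute)

lemma sym_mat_carrier: "sym_mat n s \<in> carrier_mat n n"
  by (simp add: sym_mat_def)

lemma sym_inverse:
  assumes "peval (\<phi>s \<delta>) s \<noteq> 0"
  defines "KS \<equiv> inv_of n (\<lambda>f. peval (\<phi>s f) s)"
  shows "sym_mat n s * KS = 1\<^sub>m n" "mat_inv (sym_mat n s) = KS" "transpose_mat KS = KS"
proof -
  show 1: "sym_mat n s * KS = 1\<^sub>m n"
    using inv_of_inverse(1)[OF peval_\<phi>s_hom assms(1)] by (simp add: coord_mat_\<phi>s KS_def)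
  show "mat_inv (sym_mat n s) = KS"
    by (rule mat_inv_eq[OF sym_mat_carrier _ 1]) (simp add: KS_def)
  show "transpose_mat KS = KS"
    by (rule symmetric_inverse[OF sym_mat_carrier sym_mat_sym _ 1]) (simp add: KS_def)
qed

text \<open>
  It remains to see that generic data matrices have an inverse whose coordinates \<open>u\<close> make \<open>A u\<close> generic. This
  condition is a rational function \<open>H\<close> of the data matrix. It is not zero, because the inverse of the data matrix can be any
  invertible symmetric matrix.
\<close>
lemma rec_ML_degree:
  assumes good: "good_data d h" shows "has_rec_ML_degree n T d"
proof -
  let ?X = "sym_coords n" and ?hh = "psubst PConst (row_sums C A PVar) h"
  let ?KS = "\<lambda>s. inv_of n (\<lambda>f. peval (\<phi>s f) s)" and ?Ks = "inv_of n (\<lambda>f. of_poly (\<phi>s f) :: idx ratfun)"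
  have hh: "?hh \<in> poly_ring C" "\<And>u. peval ?hh u = peval h (row_sums C A u)"
    using nonvanishing_ex(2,4)[OF good, of 1] by auto
  define H where "H = psubst const (p_of ?Ks) ?hh"
  have H: "H \<in> local_ring ?X s \<and> ev_at s H = peval h (row_sums C A (p_of (?KS s)))"
    if d: "peval (\<phi>s \<delta>) s \<noteq> 0" for s
  proof -
    note O = local_ring_subring[of ?X s] and e = ev_at_hom[of ?X s]
    have K: "?Ks $$ (i, j) \<in> local_ring ?X s" if "i < n" "j < n" for i j
      using local_ringI[OF \<phi>s_in[OF adj_generic_in[OF that]] \<phi>s_in[OF det_generic_in] d] that by (simp add: inv_of_def)
    have K': "ev_at s (?Ks $$ (i, j)) = ?KS s $$ (i, j)" if "i < n" "j < n" for i j
      using ev_inv_of(2)[OF comm_ring_hom_peval, of \<phi>s n s, OF d that] .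
    have "H \<in> local_ring ?X s"
      unfolding H_def by (rule psubst_in_subring[OF O hh(1)]) (auto intro: const_local p_of_in_subring[OF O K])
    moreover have "ev_at s H = psubst (\<lambda>c. ev_at s (const c)) (\<lambda>c. ev_at s (p_of ?Ks c)) ?hh"
      unfolding H_def by (rule hom_on_psubst[OF O e hh(1)]) (auto intro: const_local p_of_in_subring[OF O K])
    then have "ev_at s H = peval ?hh (\<lambda>c. ev_at s (p_of ?Ks c))"
      unfolding ev_at_of_poly peval_PConst peval_def[of ?hh] .
    moreover have "\<dots> = peval ?hh (p_of (?KS s))"
      by (rule peval_cong[OF hh(1)]) (rule hom_on_p_of[OF O e K K'])
    ultimately show ?thesis using hh(2) by simp
  qed
  have "det (K_of PVar) \<noteq> 0"
    using boundary_poly_notin by (auto simp: boundary_poly_def P.I_def vanishing_ideal_def psubst_def)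
  then obtain u where u: "peval (det (K_of PVar)) u \<noteq> 0" "peval h (row_sums C A u) \<noteq> 0"
    using nonvanishing_ex(1)[OF good det_K_of_poly_ring] by blast
  have "det (K_of u) \<noteq> 0" using u(1) by (simp add: det_K_of[OF comm_ring_hom_peval])
  then obtain N where N: "N \<in> carrier_mat n n" "K_of u * N = 1\<^sub>m n" "N * K_of u = 1\<^sub>m n"
    using det_nonzero_inverse[OF K_of_carrier] by blast
  have Ns: "transpose_mat N = N" by (rule symmetric_inverse[OF K_of_carrier K_of_symmetric N(1,2)])
  have Nij: "N $$ (i, j) = N $$ (j, i)" if "i < n" "j < n" for i j
    using Ns N(1) that by (metis carrier_matD index_transpose_mat(1))
  define s0 where "s0 x = (case x of Idx i j \<Rightarrow> N $$ (i, j))" for x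
  have s0: "sym_mat n s0 = N"
    using N(1) Nij by (intro eq_matI) (auto simp: sym_mat_def s0_def min_def max_def)
  have d0: "peval (\<phi>s \<delta>) s0 \<noteq> 0"
    using inverse_det_nonzero[OF N(1) K_of_carrier N(3)] det_generic_mat[OF peval_\<phi>s_hom, of n s0]
    by (simp add: coord_mat_\<phi>s s0)
  have KS0: "?KS s0 = K_of u"
    using sym_inverse(2)[OF d0] mat_inv_eq[OF N(1) K_of_carrier N(3)] s0 by simp
  have "row_sums C A (p_of (K_of u)) v = row_sums C A u v" for v
    unfolding row_sums_def by (intro sum.cong) (auto simp: p_of_K_of)
  then have "row_sums C A (p_of (?KS s0)) = row_sums C A u" unfolding KS0 by blast
  then have ev0: "H \<in> local_ring ?X s0" "ev_at s0 H \<noteq> 0" using H[OF d0] u(2) by simp_all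
  obtain f g where fg: "H = of_poly f / of_poly g" "f \<in> poly_ring ?X" "g \<in> poly_ring ?X" "peval g s0 \<noteq> 0"
    using ev0(1) unfolding local_ring_alt by blast
  have f0: "peval f s0 \<noteq> 0" using ev0(2) fg by (simp add: ev_div[OF comm_ring_hom_peval])
  \<comment> \<open>Numerator and denominator of \<open>H\<close>, and the determinant of the data matrix.\<close>
  let ?F = "f * g * \<phi>s \<delta>"
  show ?thesis unfolding has_rec_ML_degree_def generic_def
  proof (intro bexI[of _ ?F] conjI ballI impI)
    show "?F \<in> poly_ring ?X" by (intro poly_ring_mult fg \<phi>s_in det_generic_in)
    have "peval ?F s0 \<noteq> 0" using f0 fg d0 by (simp add: peval.hom_mult)
    then show "?F \<noteq> 0" by auto
    fix s assume "peval ?F s \<noteq> 0"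
    then have s: "peval f s \<noteq> 0" "peval g s \<noteq> 0" "peval (\<phi>s \<delta>) s \<noteq> 0" by (auto simp: peval.hom_mult)
    have "ev_at s H \<noteq> 0" using s by (simp add: fg(1) ev_div[OF comm_ring_hom_peval])
    then have nz: "peval h (row_sums C A (p_of (?KS s))) \<noteq> 0" using H[OF s(3)] by simp
    show "has_count X (rec_equations n T (sym_mat n s)) (rec_critical_points n T (sym_mat n s)) d"
      by (rule rec_count[OF good inv_of_carrier sym_inverse(2,3)[OF s(3)] nz])
  qed
qed

end

theorem theorem2p3:
  fixes T :: "(nat, 'e) pre_digraph" and n :: nat
  assumes "leaf_rooted_tree n T"
  shows "\<exists>d. has_rec_ML_degree n T d \<and>
             has_ML_degree (tree_rows T) (leaf_pairs n) (tree_matrix T) d \<and>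
             generic (leaf_pairs n) (\<lambda>u. has_degree (leaf_pairs n)
               (toric_ideal (tree_rows T) (leaf_pairs n) (tree_matrix T) \<union>
                linear_forms (tree_rows T) (leaf_pairs n) (tree_matrix T) u) d)"
proof -
  interpret leaf_tree n T by unfold_locales fact
  obtain d h where good: "good_data d h" using good_ex by blast
  show ?thesis
    using rec_ML_degree[OF good] toric_ML_degree[OF good] toric_degree[OF good] by blast
qed

end
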